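(* Any finite ring (commutative or not, unital or not) that generates a residually small variety is dualizable.
   Context: Rings are associative. They are viewed as universal algebras; the ring may be considered either in the language without a constant for $1$, or, if it is unital, in the language with a constant $1$. A variety is residually small if there is a cardinal $c$ such that every subdirectly irreducible algebra in it has cardinality less than $c$. Dualizable (standard notion of natural duality theory): $\mathsf{SP}(\mathbf{A})$ is the class of all algebras isomorphic to subalgebras of powers of $\mathbf{A}$. A compatible relation of $\mathbf{A}$ is a nonempty subuniverse of some finite power $\mathbf{A}^n$, $n\ge1$. A finite algebra $\mathbf{A}$ is dualizable if there is a set $R$ of compatible relations of $\mathbf{A}$ such that for every $\mathbf{B}\in\mathsf{SP}(\mathbf{A})$, every continuous map $f\colon\mathrm{Hom}(\mathbf{B},\mathbf{A})\to A$ preserving all relations in $R$ is evaluation $h\mapsto h(b)$ at some $b\in B$; here $A$ is discrete, $\mathrm{Hom}(\mathbf{B},\mathbf{A})$ is a subspace of the product space $A^B$, and its relations are defined pointwise. *)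

theory Defs
  imports "HOL-Analysis.Function_Topology" "HOL-Algebra.Ring"
begin

unbundle cardinal_syntax

section \<open>Universal algebra\<close>

text \<open>\<^term>\<open>L f = Some n\<close> means that \<^term>\<open>f\<close> is an operation symbol of arity \<^term>\<open>n\<close> of the
  language \<^term>\<open>L\<close>.\<close>

type_synonym 'f signature = "'f \<rightharpoonup> nat"

record ('f, 'a) ualg =
  univ :: "'a set"
  interp :: "'f \<Rightarrow> 'a list \<Rightarrow> 'a"

definition closed_under :: "'f signature \<Rightarrow> ('f, 'a) ualg \<Rightarrow> 'a set \<Rightarrow> bool" where
  "closed_under L A S \<longleftrightarrow>
     (\<forall>f xs. L f = Some (length xs) \<and> set xs \<subseteq> S \<longrightarrow> interp A f xs \<in> S)"

definition ualgebra :: "'f signature \<Rightarrow> ('f, 'a) ualg \<Rightarrow> bool" where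
  "ualgebra L A \<longleftrightarrow> univ A \<noteq> {} \<and> closed_under L A (univ A)"

definition subuniverse :: "'f signature \<Rightarrow> ('f, 'a) ualg \<Rightarrow> 'a set \<Rightarrow> bool" where
  "subuniverse L A S \<longleftrightarrow> S \<subseteq> univ A \<and> closed_under L A S"

definition power_alg :: "('f, 'a) ualg \<Rightarrow> 'i set \<Rightarrow> ('f, 'i \<Rightarrow> 'a) ualg" where
  "power_alg A I =
     \<lparr>univ = I \<rightarrow>\<^sub>E univ A, interp = (\<lambda>f gs. \<lambda>i\<in>I. interp A f (map (\<lambda>g. g i) gs))\<rparr>"

definition Hom :: "'f signature \<Rightarrow> ('f, 'b) ualg \<Rightarrow> ('f, 'a) ualg \<Rightarrow> ('b \<Rightarrow> 'a) set" where
  "Hom L B A = {h \<in> univ B \<rightarrow>\<^sub>E univ A.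
     \<forall>f xs. L f = Some (length xs) \<and> set xs \<subseteq> univ B \<longrightarrow>
       h (interp B f xs) = interp A f (map h xs)}"

definition congruence :: "'f signature \<Rightarrow> ('f, 'a) ualg \<Rightarrow> 'a rel \<Rightarrow> bool" where
  "congruence L A \<theta> \<longleftrightarrow> equiv (univ A) \<theta> \<and>
     (\<forall>f xs ys. L f = Some (length xs) \<and> list_all2 (\<lambda>x y. (x, y) \<in> \<theta>) xs ys \<longrightarrow>
        (interp A f xs, interp A f ys) \<in> \<theta>)"

text \<open>Existence of a monolith; one-element algebras do not count as subdirectly irreducible, which is
  immaterial for residual smallness.\<close>

definition subdirectly_irreducible :: "'f signature \<Rightarrow> ('f, 'a) ualg \<Rightarrow> bool" where
  "subdirectly_irreducible L A \<longleftrightarrow>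
     (\<exists>\<mu>. congruence L A \<mu> \<and> \<mu> \<noteq> Id_on (univ A) \<and>
        (\<forall>\<theta>. congruence L A \<theta> \<and> \<theta> \<noteq> Id_on (univ A) \<longrightarrow> \<mu> \<subseteq> \<theta>))"


section \<open>Generated varieties and residual smallness\<close>

datatype 'f trm = Var nat | App 'f "'f trm list"

fun wf_trm :: "'f signature \<Rightarrow> 'f trm \<Rightarrow> bool" where
  "wf_trm L (Var i) \<longleftrightarrow> True"
| "wf_trm L (App f ts) \<longleftrightarrow> L f = Some (length ts) \<and> (\<forall>t\<in>set ts. wf_trm L t)"

fun eval_trm :: "('f, 'a) ualg \<Rightarrow> (nat \<Rightarrow> 'a) \<Rightarrow> 'f trm \<Rightarrow> 'a" where
  "eval_trm A \<sigma> (Var i) = \<sigma> i"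
| "eval_trm A \<sigma> (App f ts) = interp A f (map (eval_trm A \<sigma>) ts)"

definition satisfies_identity :: "('f, 'a) ualg \<Rightarrow> 'f trm \<Rightarrow> 'f trm \<Rightarrow> bool" where
  "satisfies_identity A s t \<longleftrightarrow> (\<forall>\<sigma>. range \<sigma> \<subseteq> univ A \<longrightarrow> eval_trm A \<sigma> s = eval_trm A \<sigma> t)"

text \<open>Varieties are equational classes; the variety generated by \<^term>\<open>A\<close> is the class of all algebras,
  over any carrier type, that satisfy every identity of \<^term>\<open>A\<close>.\<close>

definition in_generated_variety ::
    "'f signature \<Rightarrow> ('f, 'a) ualg \<Rightarrow> ('f, 'b) ualg \<Rightarrow> bool" where
  "in_generated_variety L A B \<longleftrightarrow> ualgebra L B \<and>
     (\<forall>s t. wf_trm L s \<and> wf_trm L t \<and> satisfies_identity A s t \<longrightarrow> satisfies_identity B s t)"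

text \<open>HOL cannot quantify over carrier types inside a formula.  A cardinal is a cardinal order
  \<^term>\<open>c\<close> on some type \<open>'k\<close>, and the subdirectly irreducible algebras tested against it have their
  carriers in the strictly larger infinite type \<open>('k + nat) set\<close>.  For countable languages nothing is
  lost: by \<open>residual_bound_all_types\<close> below the bound then holds for the subdirectly
  irreducible algebras over every type.  Since a bound may live on any type, \<open>'k\<close> must be left
  arbitrary where \<open>generates_residually_small\<close> is used as a hypothesis.\<close>

definition residual_bound :: "'f signature \<Rightarrow> ('f, 'a) ualg \<Rightarrow> 'k rel \<Rightarrow> bool" where
  "residual_bound L A c \<longleftrightarrow>
     (\<forall>B :: ('f, ('k + nat) set) ualg.
        in_generated_variety L A B \<and> subdirectly_irreducible L B \<longrightarrow> |univ B| <o c)"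

definition generates_residually_small ::
    "'k itself \<Rightarrow> 'f signature \<Rightarrow> ('f, 'a) ualg \<Rightarrow> bool" where
  "generates_residually_small _ L A \<longleftrightarrow> (\<exists>c :: 'k rel. Card_order c \<and> residual_bound L A c)"


section \<open>Dualizability\<close>

text \<open>\<^term>\<open>B\<close> is isomorphic to a subalgebra of a power of \<^term>\<open>A\<close>.  By \<open>in_SP_I\<close> below,
  allowing only exponents of type \<open>('b \<Rightarrow> 'a) set\<close> is no restriction.\<close>

definition in_SP :: "'f signature \<Rightarrow> ('f, 'a) ualg \<Rightarrow> ('f, 'b) ualg \<Rightarrow> bool" where
  "in_SP L A B \<longleftrightarrow> ualgebra L B \<and>
     (\<exists>(I :: ('b \<Rightarrow> 'a) set) \<phi>. \<phi> \<in> Hom L B (power_alg A I) \<and> inj_on \<phi> (univ B))"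

text \<open>An \<^term>\<open>n\<close>-ary relation is a pair \<^term>\<open>(n, r)\<close>; its tuples are functions on
  \<^term>\<open>{..<n}\<close>, extended by \<^term>\<open>undefined\<close>.\<close>

type_synonym 'a relation = "nat \<times> (nat \<Rightarrow> 'a) set"

definition compatible_relation :: "'f signature \<Rightarrow> ('f, 'a) ualg \<Rightarrow> 'a relation \<Rightarrow> bool" where
  "compatible_relation L A = (\<lambda>(n, r).
     n \<ge> 1 \<and> r \<noteq> {} \<and> subuniverse L (power_alg A {..<n}) r)"

definition Hom_topology ::
    "'f signature \<Rightarrow> ('f, 'b) ualg \<Rightarrow> ('f, 'a) ualg \<Rightarrow> ('b \<Rightarrow> 'a) topology" where
  "Hom_topology L B A =
     subtopology (product_topology (\<lambda>_. discrete_topology (univ A)) (univ B)) (Hom L B A)"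

definition preserves ::
    "'f signature \<Rightarrow> ('f, 'b) ualg \<Rightarrow> ('f, 'a) ualg \<Rightarrow> (('b \<Rightarrow> 'a) \<Rightarrow> 'a) \<Rightarrow> 'a relation \<Rightarrow> bool" where
  "preserves L B A F = (\<lambda>(n, r).
     \<forall>h. (\<forall>i<n. h i \<in> Hom L B A) \<and> (\<forall>b\<in>univ B. (\<lambda>i\<in>{..<n}. h i b) \<in> r) \<longrightarrow>
       (\<lambda>i\<in>{..<n}. F (h i)) \<in> r)"

definition yields_duality ::
    "'f signature \<Rightarrow> ('f, 'a) ualg \<Rightarrow> 'a relation set \<Rightarrow> ('f, 'b) ualg \<Rightarrow> bool" where
  "yields_duality L A R B \<longleftrightarrow>
     (\<forall>F. continuous_map (Hom_topology L B A) (discrete_topology (univ A)) F \<and>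
          (\<forall>\<rho>\<in>R. preserves L B A F \<rho>) \<longrightarrow>
        (\<exists>b\<in>univ B. \<forall>h\<in>Hom L B A. F h = h b))"

text \<open>Only algebras \<^term>\<open>B\<close> over the type \<open>'b\<close> are tested, so \<open>'b\<close> must be left arbitrary where
  \<open>dualizable\<close> is a conclusion.  The choice of \<^term>\<open>R\<close> does not depend on \<open>'b\<close>: by
  \<open>dualizable_iff_all_compatible\<close> below one may always take all compatible relations.\<close>

definition dualizable :: "'b itself \<Rightarrow> 'f signature \<Rightarrow> ('f, 'a) ualg \<Rightarrow> bool" where
  "dualizable _ L A \<longleftrightarrow>
     (\<exists>R. (\<forall>\<rho>\<in>R. compatible_relation L A \<rho>) \<and>
        (\<forall>B :: ('f, 'b) ualg. in_SP L A B \<longrightarrow> yields_duality L A R B))"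


section \<open>Rings as universal algebras\<close>

text \<open>Not necessarily unital rings; the field \<^term>\<open>one R\<close> of the record is ignored.\<close>

locale rng = abelian_group R for R (structure) +
  assumes rng_m_closed:
      "\<lbrakk>x \<in> carrier R; y \<in> carrier R\<rbrakk> \<Longrightarrow> x \<otimes> y \<in> carrier R"
    and rng_m_assoc:
      "\<lbrakk>x \<in> carrier R; y \<in> carrier R; z \<in> carrier R\<rbrakk> \<Longrightarrow> (x \<otimes> y) \<otimes> z = x \<otimes> (y \<otimes> z)"
    and rng_l_distr:
      "\<lbrakk>x \<in> carrier R; y \<in> carrier R; z \<in> carrier R\<rbrakk> \<Longrightarrow> (x \<oplus> y) \<otimes> z = x \<otimes> z \<oplus> y \<otimes> z"
    and rng_r_distr:
      "\<lbrakk>x \<in> carrier R; y \<in> carrier R; z \<in> carrier R\<rbrakk> \<Longrightarrow> z \<otimes> (x \<oplus> y) = z \<otimes> x \<oplus> z \<otimes> y"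

datatype ring_symbol = Zero | Plus | Neg | Times | One

definition rng_signature :: "ring_symbol signature" where
  "rng_signature = [Zero \<mapsto> 0, Plus \<mapsto> 2, Neg \<mapsto> 1, Times \<mapsto> 2]"

definition unital_ring_signature :: "ring_symbol signature" where
  "unital_ring_signature = rng_signature(One \<mapsto> 0)"

definition ring_algebra :: "('a, 'm) ring_scheme \<Rightarrow> (ring_symbol, 'a) ualg" where
  "ring_algebra R = \<lparr>univ = carrier R, interp = (\<lambda>f xs. case f of
       Zero \<Rightarrow> \<zero>\<^bsub>R\<^esub>
     | Plus \<Rightarrow> xs ! 0 \<oplus>\<^bsub>R\<^esub> xs ! 1
     | Neg \<Rightarrow> \<ominus>\<^bsub>R\<^esub> (xs ! 0)
     | Times \<Rightarrow> xs ! 0 \<otimes>\<^bsub>R\<^esub> xs ! 1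
     | One \<Rightarrow> \<one>\<^bsub>R\<^esub>)\<rparr>"


section \<open>Independence of the carrier types\<close>

lemma dualizable_iff_all_compatible:
  "dualizable TYPE('b) L A \<longleftrightarrow>
     (\<forall>B :: ('f, 'b) ualg. in_SP L A B \<longrightarrow> yields_duality L A {\<rho>. compatible_relation L A \<rho>} B)"
  unfolding dualizable_def yields_duality_def by blast

lemma in_SP_I:
  fixes B :: "('f, 'b) ualg" and A :: "('f, 'a) ualg" and I :: "'i set"
  assumes B: "ualgebra L B" and hom: "\<phi> \<in> Hom L B (power_alg A I)" and inj: "inj_on \<phi> (univ B)"
  shows "in_SP L A B"
proof -
  define pr where "pr i = (\<lambda>b\<in>univ B. \<phi> b i)" for i
  define \<psi> where "\<psi> = (\<lambda>b\<in>univ B. \<lambda>j\<in>pr ` I. j b)"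
  have \<phi>E: "\<phi> b \<in> I \<rightarrow>\<^sub>E univ A" if "b \<in> univ B" for b
    using hom that by (auto simp: Hom_def power_alg_def)
  have op: "pr i (interp B f xs) = interp A f (map (pr i) xs)"
    if "i \<in> I" "L f = Some (length xs)" "set xs \<subseteq> univ B" for i f xs
  proof -
    have "interp B f xs \<in> univ B"
      using B that by (auto simp: ualgebra_def closed_under_def)
    moreover have "\<phi> (interp B f xs) i = interp A f (map (\<lambda>x. \<phi> x i) xs)"
      using hom that by (auto simp: Hom_def power_alg_def comp_def)
    moreover have "map (pr i) xs = map (\<lambda>x. \<phi> x i) xs"
      using that(3) by (auto simp: pr_def)
    moreover have "pr i b = \<phi> b i" if "b \<in> univ B" for b
      using that by (simp add: pr_def)
    ultimately show ?thesis by (simp del: map_eq_conv)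
  qed
  have "\<psi> \<in> Hom L B (power_alg A (pr ` I))"
  proof -
    have "\<psi> \<in> univ B \<rightarrow>\<^sub>E (pr ` I \<rightarrow>\<^sub>E univ A)"
      using \<phi>E by (fastforce simp: \<psi>_def pr_def PiE_iff)
    moreover have "\<psi> (interp B f xs) = interp (power_alg A (pr ` I)) f (map \<psi> xs)"
      if f: "L f = Some (length xs)" "set xs \<subseteq> univ B" for f xs
    proof
      fix j
      have "interp B f xs \<in> univ B"
        using B that by (auto simp: ualgebra_def closed_under_def)
      then have "\<psi> (interp B f xs) j = (if j \<in> pr ` I then j (interp B f xs) else undefined)"
        by (simp add: \<psi>_def)
      also have "\<dots> = (if j \<in> pr ` I then interp A f (map j xs) else undefined)"
        using op f by auto
      also have "\<dots> = (if j \<in> pr ` I then interp A f (map (\<lambda>x. \<psi> x j) xs) else undefined)"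
      proof -
        have "map (\<lambda>x. \<psi> x j) xs = map j xs" if "j \<in> pr ` I"
          using f(2) that by (auto simp: \<psi>_def)
        then show ?thesis by (simp del: map_eq_conv)
      qed
      also have "\<dots> = interp (power_alg A (pr ` I)) f (map \<psi> xs) j"
        by (simp add: power_alg_def comp_def)
      finally show "\<psi> (interp B f xs) j = interp (power_alg A (pr ` I)) f (map \<psi> xs) j" .
    qed
    ultimately show ?thesis by (auto simp: Hom_def power_alg_def)
  qed
  moreover have "inj_on \<psi> (univ B)"
  proof
    fix x y assume xy: "x \<in> univ B" "y \<in> univ B" "\<psi> x = \<psi> y"
    have "\<phi> x i = \<phi> y i" if "i \<in> I" for i
    proof -
      have "\<psi> x (pr i) = \<psi> y (pr i)" using xy by simp
      then show ?thesis using xy that by (simp add: \<psi>_def pr_def)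
    qed
    then have "\<phi> x = \<phi> y" using \<phi>E xy by (meson PiE_ext)
    then show "x = y" using inj xy by (auto dest: inj_onD)
  qed
  ultimately show ?thesis using B unfolding in_SP_def by blast
qed

text \<open>A downward Loewenheim-Skolem argument: a subdirectly irreducible algebra that violates the bound
  has a subdirectly irreducible subalgebra that violates it and embeds into \<open>('k + nat) set\<close>.\<close>

context
  fixes L :: "'f signature" and B :: "('f, 'u) ualg" and W :: "'u \<Rightarrow> 'u \<Rightarrow> 'u set"
begin

inductive_set skolem_hull :: "'u set \<Rightarrow> 'u set" for X where
  base: "x \<in> X \<Longrightarrow> x \<in> skolem_hull X"
| op: "L f = Some (length xs) \<Longrightarrow> \<forall>x\<in>set xs. x \<in> skolem_hull X \<Longrightarrow> interp B f xs \<in> skolem_hull X"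
| wit: "x \<in> skolem_hull X \<Longrightarrow> y \<in> skolem_hull X \<Longrightarrow> z \<in> W x y \<Longrightarrow> z \<in> skolem_hull X"

lemma skolem_hull_mono: "u \<in> skolem_hull X \<Longrightarrow> X \<subseteq> Y \<Longrightarrow> u \<in> skolem_hull Y"
proof (induction rule: skolem_hull.induct)
  case (base x)
  then show ?case by (auto intro: skolem_hull.base)
next
  case (op f xs)
  then show ?case by (intro skolem_hull.op) auto
next
  case (wit x y z)
  then show ?case by (auto intro: skolem_hull.wit[of x Y y z])
qed

lemma skolem_hull_finitary: "u \<in> skolem_hull X \<Longrightarrow> \<exists>F. finite F \<and> F \<subseteq> X \<and> u \<in> skolem_hull F"
proof (induction rule: skolem_hull.induct)
  case (base x)
  then show ?case by (intro exI[of _ "{x}"]) (auto intro: skolem_hull.base)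
next
  case (op f xs)
  then obtain G where G: "\<And>x. x \<in> set xs \<Longrightarrow> finite (G x) \<and> G x \<subseteq> X \<and> x \<in> skolem_hull (G x)"
    by metis
  have "interp B f xs \<in> skolem_hull (\<Union>(G ` set xs))"
    using op(1) G by (intro skolem_hull.op) (auto intro: skolem_hull_mono)
  then show ?case using G by (intro exI[of _ "\<Union>(G ` set xs)"]) auto
next
  case (wit x y z)
  then obtain F G where F: "finite F" "F \<subseteq> X" "x \<in> skolem_hull F" and G: "finite G" "G \<subseteq> X" "y \<in> skolem_hull G"
    by auto
  have "z \<in> skolem_hull (F \<union> G)"
    using skolem_hull_mono[OF F(3)] skolem_hull_mono[OF G(3)] wit.hyps(3)
    by (auto intro: skolem_hull.wit[of x _ y z])
  then show ?case using F G by (intro exI[of _ "F \<union> G"]) auto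
qed

lemma countable_skolem_hull:
  assumes "countable (dom L)" "\<And>x y. countable (W x y)" "countable X"
  shows "countable (skolem_hull X)"
proof -
  define step where "step S = S \<union> (\<Union>f\<in>dom L. interp B f ` lists S) \<union> (\<Union>x\<in>S. \<Union>y\<in>S. W x y)" for S
  define S where "S n = (step ^^ n) X" for n
  have S0: "S 0 = X" and SS: "S (Suc n) = step (S n)" for n by (auto simp: S_def)
  have "countable (S n)" for n
    by (induction n) (auto simp: S0 SS step_def assms intro!: countable_UN countable_lists)
  then have cnt: "countable (\<Union>n. S n)" by auto
  have "S n \<subseteq> S (Suc n)" for n by (auto simp: SS step_def)
  then have mono: "S m \<subseteq> S n" if "m \<le> n" for m n using that by (rule lift_Suc_mono_le)
  have "u \<in> (\<Union>n. S n)" if "u \<in> skolem_hull X" for u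
    using that
  proof (induction rule: skolem_hull.induct)
    case (base x)
    then show ?case using S0 by auto
  next
    case (op f xs)
    then have "\<forall>x\<in>set xs. \<exists>n. x \<in> S n" by auto
    then obtain N where N: "\<And>x. x \<in> set xs \<Longrightarrow> x \<in> S (N x)" by metis
    define m where "m = Max (insert 0 (N ` set xs))"
    have "x \<in> S m" if "x \<in> set xs" for x
    proof -
      have "N x \<le> m" unfolding m_def using that by (intro Max_ge) auto
      then show ?thesis using N[OF that] mono by blast
    qed
    then have "interp B f xs \<in> S (Suc m)" using op(1) by (auto simp: SS step_def)
    then show ?case by blast
  next
    case (wit x y z)
    then obtain m n where "x \<in> S m" "y \<in> S n" by auto
    then have "x \<in> S (max m n)" "y \<in> S (max m n)"
      using mono[of m "max m n"] mono[of n "max m n"] by auto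
    then have "z \<in> S (Suc (max m n))" using wit by (auto simp: SS step_def)
    then show ?case by blast
  qed
  then show ?thesis using countable_subset[OF subsetI cnt] by metis
qed

end

lemma congruence_generated_witness:
  assumes B: "ualgebra L B" and xy: "x \<in> univ B" "y \<in> univ B"
    and p: "\<And>\<theta>. congruence L B \<theta> \<Longrightarrow> (x, y) \<in> \<theta> \<Longrightarrow> p \<in> \<theta>"
  shows "\<exists>F. finite F \<and> F \<subseteq> univ B \<and>
    (\<forall>C \<psi>. F \<subseteq> C \<and> x \<in> C \<and> y \<in> C \<and> subuniverse L B C \<and> congruence L (B\<lparr>univ := C\<rparr>) \<psi> \<and> (x, y) \<in> \<psi>
      \<longrightarrow> p \<in> \<psi>)"
proof -
  define P where "P F q \<longleftrightarrow> finite F \<and> F \<subseteq> univ B \<and>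
    (\<forall>C \<psi>. F \<subseteq> C \<and> x \<in> C \<and> y \<in> C \<and> subuniverse L B C \<and> congruence L (B\<lparr>univ := C\<rparr>) \<psi> \<and> (x, y) \<in> \<psi>
      \<longrightarrow> q \<in> \<psi>)" for F q
  define \<theta> where "\<theta> = {q \<in> univ B \<times> univ B. \<exists>F. P F q}"
  have eqv: "equiv C \<psi>" if "congruence L (B\<lparr>univ := C\<rparr>) \<psi>" for C \<psi>
    using that by (simp add: congruence_def)
  have "congruence L B \<theta>"
    unfolding congruence_def
  proof (intro conjI allI impI equivI)
    show "\<theta> \<subseteq> univ B \<times> univ B" by (auto simp: \<theta>_def)
    show "refl_on (univ B) \<theta>"
    proof (rule refl_onI)
      fix u assume u: "u \<in> univ B"
      have "P {u} (u, u)"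
        using u eqv by (auto simp: P_def equiv_def refl_on_def)
      then show "(u, u) \<in> \<theta>" using u by (auto simp: \<theta>_def)
    qed
    show "sym \<theta>"
    proof (rule symI)
      fix u v assume uv: "(u, v) \<in> \<theta>"
      then obtain F where "P F (u, v)" by (auto simp: \<theta>_def)
      then have "P F (v, u)" unfolding P_def using eqv by (metis equiv_def symD)
      then show "(v, u) \<in> \<theta>" using uv by (auto simp: \<theta>_def)
    qed
    show "trans \<theta>"
    proof (rule transI)
      fix u v w assume uv: "(u, v) \<in> \<theta>" "(v, w) \<in> \<theta>"
      then obtain F G where FG: "P F (u, v)" "P G (v, w)" by (auto simp: \<theta>_def)
      have "P (F \<union> G) (u, w)"
        unfolding P_def
      proof (intro conjI allI impI)
        fix C \<psi>
        assume a: "F \<union> G \<subseteq> C \<and> x \<in> C \<and> y \<in> C \<and> subuniverse L B C \<and>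
          congruence L (B\<lparr>univ := C\<rparr>) \<psi> \<and> (x, y) \<in> \<psi>"
        then have "(u, v) \<in> \<psi>" "(v, w) \<in> \<psi>" using FG by (auto simp: P_def)
        moreover have "trans \<psi>" using eqv[of C \<psi>] a by (simp add: equiv_def)
        ultimately show "(u, w) \<in> \<psi>" by (meson transD)
      qed (use FG in \<open>auto simp: P_def\<close>)
      then show "(u, w) \<in> \<theta>" using uv by (auto simp: \<theta>_def)
    qed
    fix f xs ys
    assume a: "L f = Some (length xs) \<and> list_all2 (\<lambda>x y. (x, y) \<in> \<theta>) xs ys"
    then have "\<forall>q\<in>set (zip xs ys). \<exists>F. P F q" by (auto simp: \<theta>_def list_all2_iff)
    then obtain F where F: "\<And>q. q \<in> set (zip xs ys) \<Longrightarrow> P (F q) q" by metis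
    have len: "length xs = length ys" using a by (auto dest: list_all2_lengthD)
    have sub: "set xs \<subseteq> univ B" "set ys \<subseteq> univ B"
      using a by (auto simp: \<theta>_def list_all2_conv_all_nth in_set_conv_nth)
    then have "interp B f xs \<in> univ B" "interp B f ys \<in> univ B"
      using B a len by (auto simp: ualgebra_def closed_under_def)
    moreover have "P (\<Union>(F ` set (zip xs ys))) (interp B f xs, interp B f ys)"
      unfolding P_def
    proof (intro conjI allI impI)
      fix C \<psi>
      assume c: "\<Union>(F ` set (zip xs ys)) \<subseteq> C \<and> x \<in> C \<and> y \<in> C \<and> subuniverse L B C \<and>
          congruence L (B\<lparr>univ := C\<rparr>) \<psi> \<and> (x, y) \<in> \<psi>"
      have "q \<in> \<psi>" if "q \<in> set (zip xs ys)" for q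
      proof -
        have "F q \<subseteq> C" using that c by auto
        then show ?thesis using F[OF that] c unfolding P_def by metis
      qed
      then have "list_all2 (\<lambda>x y. (x, y) \<in> \<psi>) xs ys"
        using len by (auto simp: list_all2_iff)
      then show "(interp B f xs, interp B f ys) \<in> \<psi>"
        using c a by (auto simp: congruence_def)
    qed (use F in \<open>auto simp: P_def\<close>)
    ultimately show "(interp B f xs, interp B f ys) \<in> \<theta>" unfolding \<theta>_def by blast
  qed
  moreover have "(x, y) \<in> \<theta>" using xy by (auto simp: \<theta>_def P_def)
  ultimately have "p \<in> \<theta>" by (rule p)
  then show ?thesis by (auto simp: \<theta>_def P_def)
qed

lemma subdirectly_irreducibleI:
  assumes B: "ualgebra L B" and pq: "p \<in> univ B" "q \<in> univ B" "p \<noteq> q"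
    and min: "\<And>\<theta>. congruence L B \<theta> \<Longrightarrow> \<theta> \<noteq> Id_on (univ B) \<Longrightarrow> (p, q) \<in> \<theta>"
  shows "subdirectly_irreducible L B"
proof -
  define \<mu> where "\<mu> = {(u, v). u \<in> univ B \<and> v \<in> univ B \<and>
    (\<forall>\<theta>. congruence L B \<theta> \<and> \<theta> \<noteq> Id_on (univ B) \<longrightarrow> (u, v) \<in> \<theta>)}"
  have eqv: "equiv (univ B) \<theta>" if "congruence L B \<theta>" for \<theta> using that by (simp add: congruence_def)
  have "congruence L B \<mu>"
    unfolding congruence_def
  proof (intro conjI allI impI equivI)
    show "\<mu> \<subseteq> univ B \<times> univ B" by (auto simp: \<mu>_def)
    show "refl_on (univ B) \<mu>" using eqv by (auto simp: \<mu>_def refl_on_def equiv_def)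
    show "sym \<mu>" using eqv by (auto simp: \<mu>_def sym_def equiv_def)
    show "trans \<mu>"
    proof (rule transI)
      fix u v w assume uv: "(u, v) \<in> \<mu>" "(v, w) \<in> \<mu>"
      have "(u, w) \<in> \<theta>" if "congruence L B \<theta>" "\<theta> \<noteq> Id_on (univ B)" for \<theta>
      proof -
        have "trans \<theta>" using eqv[OF that(1)] by (simp add: equiv_def)
        moreover have "(u, v) \<in> \<theta>" "(v, w) \<in> \<theta>" using uv that by (auto simp: \<mu>_def)
        ultimately show ?thesis by (rule transD)
      qed
      then show "(u, w) \<in> \<mu>" using uv by (auto simp: \<mu>_def)
    qed
    fix f xs ys
    assume a: "L f = Some (length xs) \<and> list_all2 (\<lambda>x y. (x, y) \<in> \<mu>) xs ys"
    then have len: "length xs = length ys" by (auto dest: list_all2_lengthD)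
    have "set xs \<subseteq> univ B" "set ys \<subseteq> univ B"
      using a by (auto simp: \<mu>_def list_all2_conv_all_nth in_set_conv_nth)
    then have "interp B f xs \<in> univ B" "interp B f ys \<in> univ B"
      using B a len by (auto simp: ualgebra_def closed_under_def)
    moreover have "(interp B f xs, interp B f ys) \<in> \<theta>"
      if t: "congruence L B \<theta>" "\<theta> \<noteq> Id_on (univ B)" for \<theta>
    proof -
      have "list_all2 (\<lambda>x y. (x, y) \<in> \<theta>) xs ys"
        using a t by (auto simp: \<mu>_def elim!: list_all2_mono)
      then show ?thesis using t a by (auto simp: congruence_def)
    qed
    ultimately show "(interp B f xs, interp B f ys) \<in> \<mu>" by (auto simp: \<mu>_def)
  qed
  moreover have "(p, q) \<in> \<mu>" using pq min by (auto simp: \<mu>_def)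
  then have "\<mu> \<noteq> Id_on (univ B)" using pq(3) by auto
  ultimately show ?thesis unfolding subdirectly_irreducible_def
    by (intro exI[of _ \<mu>]) (auto simp: \<mu>_def)
qed

lemma equiv_not_Id_on:
  assumes "equiv A r" "r \<noteq> Id_on A"
  obtains x y where "(x, y) \<in> r" "x \<noteq> y" "x \<in> A" "y \<in> A"
proof -
  have r: "r \<subseteq> A \<times> A" "\<And>x. x \<in> A \<Longrightarrow> (x, x) \<in> r"
    using assms(1) by (auto simp: equiv_def refl_on_def)
  have "\<not> r \<subseteq> Id_on A" using r assms(2) by auto
  then show thesis using that r by auto
qed

lemma residual_bound_all_types:
  fixes c :: "'k rel" and B :: "('f, 'u) ualg"
  assumes L: "countable (dom L)" and c: "Card_order c" "residual_bound L A c"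
    and B: "in_generated_variety L A B" "subdirectly_irreducible L B"
  shows "|univ B| <o c"
proof (rule ccontr)
  assume "\<not> |univ B| <o c"
  moreover have "Well_order c" using c(1) by (simp add: card_order_on_def)
  ultimately have "c \<le>o |univ B|"
    using not_ordLess_iff_ordLeq[OF _ card_of_Well_order] by blast
  then have "|Field c| \<le>o |univ B|"
    using ordIso_ordLeq_trans[OF card_of_Field_ordIso[OF c(1)]] by blast
  then obtain g where g: "inj_on g (Field c)" "g ` Field c \<subseteq> univ B"
    using card_of_ordLeq[of "Field c" "univ B"] by blast
  have alg: "ualgebra L B" using B(1) by (simp add: in_generated_variety_def)
  obtain \<mu> where \<mu>: "congruence L B \<mu>" "\<mu> \<noteq> Id_on (univ B)"
    "\<And>\<theta>. congruence L B \<theta> \<Longrightarrow> \<theta> \<noteq> Id_on (univ B) \<Longrightarrow> \<mu> \<subseteq> \<theta>"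
    using B(2) unfolding subdirectly_irreducible_def by blast
  obtain a b where ab: "(a, b) \<in> \<mu>" "a \<noteq> b" "a \<in> univ B" "b \<in> univ B"
    using \<mu>(1,2) equiv_not_Id_on unfolding congruence_def by metis
  have "\<exists>F. finite F \<and> F \<subseteq> univ B \<and> (x \<in> univ B \<and> y \<in> univ B \<and> x \<noteq> y \<longrightarrow>
    (\<forall>C \<psi>. F \<subseteq> C \<and> x \<in> C \<and> y \<in> C \<and> subuniverse L B C \<and> congruence L (B\<lparr>univ := C\<rparr>) \<psi> \<and> (x, y) \<in> \<psi>
      \<longrightarrow> (a, b) \<in> \<psi>))" for x y
  proof (cases "x \<in> univ B \<and> y \<in> univ B \<and> x \<noteq> y")
    case True
    have "(a, b) \<in> \<theta>" if "congruence L B \<theta>" "(x, y) \<in> \<theta>" for \<theta>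
    proof -
      have "\<theta> \<noteq> Id_on (univ B)" using that True by auto
      then show ?thesis using \<mu>(3) that ab by blast
    qed
    then show ?thesis using congruence_generated_witness[OF alg, of x y "(a, b)"] True by metis
  next
    case False
    then show ?thesis by (intro exI[of _ "{}"]) auto
  qed
  then obtain W where W: "\<And>x y. finite (W x y)" "\<And>x y. W x y \<subseteq> univ B"
    "\<And>x y C \<psi>. \<lbrakk>x \<in> univ B; y \<in> univ B; x \<noteq> y; W x y \<subseteq> C; x \<in> C; y \<in> C; subuniverse L B C;
        congruence L (B\<lparr>univ := C\<rparr>) \<psi>; (x, y) \<in> \<psi>\<rbrakk> \<Longrightarrow> (a, b) \<in> \<psi>"
    by metis
  define H where "H F = skolem_hull L B W ({a, b} \<union> g ` F)" for F
  define C where "C = H (Field c)"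
  have CB: "C \<subseteq> univ B"
  proof
    fix u assume "u \<in> C"
    then show "u \<in> univ B" unfolding C_def H_def
    proof (induction rule: skolem_hull.induct)
      case (base x)
      then show ?case using ab g by auto
    next
      case (op f xs)
      then show ?case using alg by (auto simp: ualgebra_def closed_under_def)
    next
      case (wit x y z)
      then show ?case using W(2)[of x y] by auto
    qed
  qed
  have subC: "subuniverse L B C"
    unfolding subuniverse_def closed_under_def
  proof (intro conjI allI impI CB)
    fix f xs assume "L f = Some (length xs) \<and> set xs \<subseteq> C"
    then show "interp B f xs \<in> C" unfolding C_def H_def by (intro skolem_hull.op) auto
  qed
  have opC: "interp B f xs \<in> C" if "L f = Some (length xs)" "set xs \<subseteq> C" for f xs
    using subC that by (simp add: subuniverse_def closed_under_def)
  have abC: "a \<in> C" "b \<in> C" by (auto simp: C_def H_def intro: skolem_hull.base)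
  have WC: "W x y \<subseteq> C" if "x \<in> C" "y \<in> C" for x y
    using skolem_hull.wit[of x L B W "{a, b} \<union> g ` Field c" y] that unfolding C_def H_def by blast
  have "\<exists>F. finite F \<and> F \<subseteq> Field c \<and> u \<in> H F" if u: "u \<in> C" for u
  proof -
    obtain G where G: "finite G" "G \<subseteq> {a, b} \<union> g ` Field c" "u \<in> skolem_hull L B W G"
      using u skolem_hull_finitary unfolding C_def H_def by metis
    obtain F where F: "F \<subseteq> Field c" "finite F" "G - {a, b} = g ` F"
      using finite_subset_image[of "G - {a, b}" g "Field c"] G by auto
    have "u \<in> H F" unfolding H_def using F(3) by (intro skolem_hull_mono[OF G(3)]) auto
    then show ?thesis using F by blast
  qed
  then obtain F where F: "\<And>u. u \<in> C \<Longrightarrow> finite (F u) \<and> F u \<subseteq> Field c \<and> u \<in> H (F u)" by metis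
  have cntH: "countable (H G)" if "finite G" for G
    unfolding H_def using that
    by (intro countable_skolem_hull L) (auto intro: countable_finite W(1))
  define e :: "'u \<Rightarrow> ('k + nat) set" where "e u = Inl ` F u \<union> {Inr (to_nat_on (H (F u)) u)}" for u
  have inj: "inj_on e C"
  proof
    fix u v assume uv: "u \<in> C" "v \<in> C" "e u = e v"
    have "F u = {k. Inl k \<in> e u}" "F v = {k. Inl k \<in> e v}" by (auto simp: e_def)
    then have Fe: "F u = F v" using uv by simp
    have "{n. Inr n \<in> e u} = {to_nat_on (H (F u)) u}" "{n. Inr n \<in> e v} = {to_nat_on (H (F v)) v}"
      by (auto simp: e_def)
    then have "to_nat_on (H (F u)) u = to_nat_on (H (F u)) v" using uv(3) Fe by simp
    then show "u = v" using F[OF uv(1)] F[OF uv(2)] Fe cntH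
      by (metis inj_on_to_nat_on inj_onD)
  qed
  define d where "d = inv_into C e"
  have de: "d (e u) = u" if "u \<in> C" for u using that inj by (simp add: d_def)
  have dC: "d y \<in> C" and ed: "e (d y) = y" if "y \<in> e ` C" for y
    using that de by auto
  define D where "D = \<lparr>univ = e ` C, interp = (\<lambda>f ys. e (interp B f (map d ys)))\<rparr>"
  have algD: "ualgebra L D"
    unfolding ualgebra_def closed_under_def
  proof (intro conjI allI impI)
    show "univ D \<noteq> {}" using abC by (auto simp: D_def)
    fix f ys assume a: "L f = Some (length ys) \<and> set ys \<subseteq> univ D"
    then have "set (map d ys) \<subseteq> C" using dC by (auto simp: D_def)
    then have "interp B f (map d ys) \<in> C"
      using a by (intro opC) auto
    then show "interp D f ys \<in> univ D" by (simp add: D_def)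
  qed
  have ev: "eval_trm B \<tau> t \<in> C \<and> eval_trm D \<sigma> t = e (eval_trm B \<tau> t)"
    if \<tau>: "\<And>i. \<tau> i \<in> C \<and> \<sigma> i = e (\<tau> i)" and "wf_trm L t" for \<sigma> \<tau> t
    using that(2)
  proof (induction t)
    case (Var i)
    then show ?case using \<tau> by simp
  next
    case (App f ts)
    then have IH: "eval_trm B \<tau> t \<in> C \<and> eval_trm D \<sigma> t = e (eval_trm B \<tau> t)"
      if "t \<in> set ts" for t using that by simp
    have "interp B f (map (eval_trm B \<tau>) ts) \<in> C"
      using App.prems IH by (intro opC) auto
    moreover have "map d (map (eval_trm D \<sigma>) ts) = map (eval_trm B \<tau>) ts"
      using IH de by simp
    ultimately show ?case by (simp add: D_def del: map_map)
  qed
  have varD: "in_generated_variety L A D"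
    unfolding in_generated_variety_def satisfies_identity_def
  proof (intro conjI allI impI algD)
    fix s t and \<sigma> :: "nat \<Rightarrow> ('k + nat) set"
    assume st: "wf_trm L s \<and> wf_trm L t \<and>
      (\<forall>\<sigma>. range \<sigma> \<subseteq> univ A \<longrightarrow> eval_trm A \<sigma> s = eval_trm A \<sigma> t)" and "range \<sigma> \<subseteq> univ D"
    then have \<sigma>: "range \<sigma> \<subseteq> e ` C" by (simp add: D_def)
    then have \<tau>: "(d \<circ> \<sigma>) i \<in> C \<and> \<sigma> i = e ((d \<circ> \<sigma>) i)" for i
      using dC ed by (metis comp_apply rangeI subsetD)
    then have "range (d \<circ> \<sigma>) \<subseteq> univ B" using CB by auto
    then have "eval_trm B (d \<circ> \<sigma>) s = eval_trm B (d \<circ> \<sigma>) t"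
      using B(1) st unfolding in_generated_variety_def satisfies_identity_def by blast
    then show "eval_trm D \<sigma> s = eval_trm D \<sigma> t" using ev[of "d \<circ> \<sigma>" \<sigma>, OF \<tau>] st by metis
  qed
  have "subdirectly_irreducible L D"
  proof (rule subdirectly_irreducibleI[OF algD])
    show "e a \<in> univ D" "e b \<in> univ D" using abC by (auto simp: D_def)
    show "e a \<noteq> e b" using inj abC ab(2) by (auto dest: inj_onD)
    fix \<theta> assume \<theta>: "congruence L D \<theta>" "\<theta> \<noteq> Id_on (univ D)"
    then have eqv: "equiv (e ` C) \<theta>" by (simp add: congruence_def D_def)
    define \<psi> where "\<psi> = {(u, v). u \<in> C \<and> v \<in> C \<and> (e u, e v) \<in> \<theta>}"
    have "congruence L (B\<lparr>univ := C\<rparr>) \<psi>"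
      unfolding congruence_def
    proof (intro conjI allI impI)
      show "equiv (univ (B\<lparr>univ := C\<rparr>)) \<psi>"
      proof (rule equivI)
        have eq: "refl_on (e ` C) \<theta>" "sym \<theta>" "trans \<theta>" using eqv by (auto simp: equiv_def)
        show "\<psi> \<subseteq> univ (B\<lparr>univ := C\<rparr>) \<times> univ (B\<lparr>univ := C\<rparr>)" by (auto simp: \<psi>_def)
        show "refl_on (univ (B\<lparr>univ := C\<rparr>)) \<psi>" using eq(1) by (simp add: \<psi>_def refl_on_def)
        show "sym \<psi>" by (rule symI) (auto simp: \<psi>_def dest: symD[OF eq(2)])
        show "trans \<psi>" by (rule transI) (auto simp: \<psi>_def dest: transD[OF eq(3)])
      qed
      fix f xs ys
      assume a: "L f = Some (length xs) \<and> list_all2 (\<lambda>x y. (x, y) \<in> \<psi>) xs ys"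
      have len: "length xs = length ys" using a by (auto dest: list_all2_lengthD)
      have sub: "set xs \<subseteq> C" "set ys \<subseteq> C"
        using a by (auto simp: \<psi>_def list_all2_conv_all_nth in_set_conv_nth)
      have "map d (map e xs) = xs" "map d (map e ys) = ys"
        using sub de by (auto intro!: map_idI)
      moreover have "list_all2 (\<lambda>x y. (x, y) \<in> \<theta>) (map e xs) (map e ys)"
        using a by (auto simp: \<psi>_def list_all2_conv_all_nth)
      then have "(interp D f (map e xs), interp D f (map e ys)) \<in> \<theta>"
        using \<theta>(1) a by (auto simp: congruence_def)
      ultimately have "(e (interp B f xs), e (interp B f ys)) \<in> \<theta>" by (simp add: D_def del: map_map)
      moreover have "interp B f xs \<in> C" "interp B f ys \<in> C"
        using sub a len by (auto intro: opC)
      ultimately show "(interp (B\<lparr>univ := C\<rparr>) f xs, interp (B\<lparr>univ := C\<rparr>) f ys) \<in> \<psi>"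
        by (simp add: \<psi>_def)
    qed
    moreover obtain x y where xy: "x \<in> C" "y \<in> C" "x \<noteq> y" "(e x, e y) \<in> \<theta>"
    proof -
      have "\<theta> \<noteq> Id_on (e ` C)" using \<theta>(2) by (simp add: D_def)
      then obtain p q where "(p, q) \<in> \<theta>" "p \<noteq> q" "p \<in> e ` C" "q \<in> e ` C"
        using equiv_not_Id_on[OF eqv] by metis
      then show thesis using that by blast
    qed
    ultimately have "(a, b) \<in> \<psi>"
      using W(3)[of x y C \<psi>] CB WC subC by (auto simp: \<psi>_def)
    then show "(e a, e b) \<in> \<theta>" by (simp add: \<psi>_def)
  qed
  then have "|univ D| <o c" using c(2) varD unfolding residual_bound_def by blast
  moreover have "|Field c| \<le>o |univ D|"
  proof -
    have "g ` Field c \<subseteq> C" by (auto simp: C_def H_def intro: skolem_hull.base)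
    then have "inj_on (e \<circ> g) (Field c)" "(e \<circ> g) ` Field c \<subseteq> univ D"
      using g inj by (auto simp: D_def intro!: comp_inj_on intro: inj_on_subset)
    then show ?thesis using card_of_ordLeq by blast
  qed
  then have "c \<le>o |univ D|"
    using ordIso_ordLeq_trans[OF ordIso_symmetric[OF card_of_Field_ordIso[OF c(1)]]] by blast
  ultimately show False using not_ordLess_ordLeq by blast
qed

end

theory Submission
  imports Defs "HOL-Library.Function_Algebras" "HOL-Library.Product_Plus"
    "HOL-Computational_Algebra.Primes"
begin

text \<open>Let \<open>R\<close> be the ring.  Two facts are combined: residual smallness forces a quasi-identity on \<open>R\<close>, and
every finite ring with that quasi-identity is dualizable.

The quasi-identity says that a product \<open>a * b\<close> which is annihilated on both sides by \<open>a\<close> and by \<open>b\<close> is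
zero.  If some \<open>t = a * b\<close> violates it, take arbitrarily many copies of \<open>a\<close> and \<open>b\<close> in different
coordinates of a power of \<open>R\<close> and identify all the copies of \<open>t\<close>.  An ideal that is maximal without
\<open>t\<close> gives a subdirectly irreducible quotient, in which the copies of \<open>a\<close> stay distinct because they
are told apart by multiplication with the copies of \<open>b\<close>; hence there is no residual bound
(\<open>residually_small_products_vanish\<close>).  As a quasi-identity it passes to all subrings of powers of
\<open>R\<close>.  It makes nilpotent elements square to zero and kills products such as \<open>u * v\<close> with
\<open>u\<^sup>2 = v\<^sup>2 = 0\<close> and \<open>u * v\<close> nilpotent.  So nil subrings are null, and nilpotent elements annihilate
null ideals.

For the duality, compactness leaves a finitary statement
(\<open>dualizable_if_finitely_local\<close>): there is a number \<open>k\<close>, depending on \<open>R\<close> only, such that a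
function on \<open>Hom(B, R)\<close>, for finite \<open>B\<close>, is an evaluation as soon as it agrees with an evaluation on
every set of \<open>k\<close> homomorphisms.  Suppose that this fails, and let \<open>Y\<close> be a set of homomorphisms of
least size on which some such \<open>k\<close>-local function is not an evaluation.  Restricted to \<open>Y\<close>, the
evaluations and the \<open>k\<close>-local functions form rings \<open>C\<close> and \<open>F\<close> with \<open>C \<subset> F \<subseteq> R\<^sup>Y\<close>, and \<open>C\<close> and
\<open>F\<close> agree after the deletion of any one coordinate.  Therefore each single coordinate
determines how an element of \<open>C\<close> acts on \<open>F / C\<close>, and after passing to a corner of \<open>F\<close> this action
distinguishes boundedly many classes of elements.  If \<open>Y\<close> is large, the pigeonhole principle provides
three coordinates \<open>w\<close>, \<open>y\<close>, \<open>z\<close> which on the corner agree modulo one null ideal \<open>M\<close>, the common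
image under them of the elements of \<open>C\<close> that act trivially.  Then \<open>y - w\<close> and \<open>z - w\<close> are derivations
into \<open>M\<close>, and \<open>w + \<sigma> (y - w) + \<tau> (z - w)\<close> is again a homomorphism for all bimodule maps \<open>\<sigma>\<close> and
\<open>\<tau>\<close> from \<open>M\<close> to \<open>M\<close>.  For a suitable choice of \<open>\<sigma>\<close> and \<open>\<tau>\<close> this one homomorphism still detects what
\<open>y\<close> and \<open>z\<close> detected together (\<open>merge_coordinates\<close>), so it can replace both of them, against
the minimality of \<open>Y\<close> (\<open>finite_local_evaluation\<close>).

Suitable bimodule maps exist because \<open>M\<close> cogenerates the quotients of \<open>M \<times> M\<close>
(\<open>bimodule_separation\<close>).  The rings acting on \<open>M\<close> from the left and from the right have no nonzero
nilpotent elements, so that primitive idempotents cut \<open>M\<close> down to a piece on which each operator is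
zero or bijective.  If one side acts nontrivially, then it acts like a skew field, there are
linear complements for it, and the resulting projection is made linear over the other side by averaging
over the group of its nonzero operators, as in Maschke's theorem.  If both sides act trivially, then
\<open>M\<close> is just a finite abelian group, and a cyclic direct summand of a primary component does the job.

Rings given by carrier sets are embedded in one ring on a whole type, the product of all
rings with elements in the given type (\<open>rng_embeds\<close>), so that all computations can use the laws
of the type class \<open>ring\<close>.\<close>


section \<open>Nilpotent elements\<close>

definition subrng :: "'u::ring set \<Rightarrow> bool" where
  "subrng S \<longleftrightarrow> 0 \<in> S \<and> (\<forall>x\<in>S. \<forall>y\<in>S. x + y \<in> S \<and> x - y \<in> S \<and> x * y \<in> S)"

lemma subrngD:
  assumes "subrng S"
  shows "0 \<in> S" "x \<in> S \<Longrightarrow> y \<in> S \<Longrightarrow> x + y \<in> S" "x \<in> S \<Longrightarrow> y \<in> S \<Longrightarrow> x - y \<in> S"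
    "x \<in> S \<Longrightarrow> y \<in> S \<Longrightarrow> x * y \<in> S" "x \<in> S \<Longrightarrow> - x \<in> S"
proof -
  show 0: "0 \<in> S" and "x \<in> S \<Longrightarrow> y \<in> S \<Longrightarrow> x + y \<in> S" and d: "x \<in> S \<Longrightarrow> y \<in> S \<Longrightarrow> x - y \<in> S"
    and "x \<in> S \<Longrightarrow> y \<in> S \<Longrightarrow> x * y \<in> S" for x y
    using assms by (auto simp: subrng_def)
  show "x \<in> S \<Longrightarrow> - x \<in> S" using d[OF 0, of x] by simp
qed

text \<open>A quasi-identity, hence inherited by subrings and products.  All that is used of residual smallness
is that it implies this condition.\<close>

definition self_annihilating_products_vanish :: "'u::ring set \<Rightarrow> bool" where
  "self_annihilating_products_vanish S \<longleftrightarrow>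
     (\<forall>a\<in>S. \<forall>b\<in>S. a * (a * b) = 0 \<and> a * b * a = 0 \<and> b * (a * b) = 0 \<and> a * b * b = 0 \<longrightarrow> a * b = 0)"

text \<open>The power \<open>x\<^bsup>n + 1\<^esup>\<close>; there is no unit that could serve as \<open>x\<^sup>0\<close>.\<close>

fun pow1 :: "'u::ring \<Rightarrow> nat \<Rightarrow> 'u" where
  "pow1 x 0 = x"
| "pow1 x (Suc n) = x * pow1 x n"

lemma pow1_add: "pow1 x m * pow1 x n = pow1 x (Suc (m + n))"
  by (induction m) (simp_all add: mult.assoc)

lemma pow1_in: "subrng S \<Longrightarrow> x \<in> S \<Longrightarrow> pow1 x n \<in> S"
  by (induction n) (auto dest: subrngD)

lemma pow1_zero_mono: "pow1 x m = 0 \<Longrightarrow> m \<le> n \<Longrightarrow> pow1 x n = 0"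
  by (induction n) (auto simp: le_Suc_eq)

text \<open>If \<open>x\<^bsup>m + 3\<^esup> = 0\<close>, then \<open>x\<close> and \<open>x\<^bsup>m + 1\<^esup>\<close> annihilate their product \<open>x\<^bsup>m + 2\<^esup>\<close>, which is
therefore zero; so the exponent can be lowered until it is 2.\<close>

lemma nilpotent_square_zero:
  fixes x :: "'u::ring"
  assumes S: "subrng S" "self_annihilating_products_vanish S" "x \<in> S"
  shows "pow1 x n = 0 \<Longrightarrow> x * x = 0"
proof (induction n)
  case 0
  then show ?case by simp
next
  case (Suc n)
  show ?case
  proof (cases n)
    case 0
    then show ?thesis using Suc.prems by simp
  next
    case (Suc m)
    have ab: "x * pow1 x m = pow1 x n" using Suc by simp
    have z: "pow1 x (Suc n) = 0" by (fact Suc.prems)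
    have "x * (x * pow1 x m) = 0" using z ab by simp
    moreover have "x * pow1 x m * x = pow1 x (Suc n)"
      using pow1_add[of x n 0] ab by simp
    moreover have "pow1 x m * (x * pow1 x m) = pow1 x (Suc (m + n))"
      using pow1_add[of x m n] ab by simp
    moreover have "x * pow1 x m * pow1 x m = pow1 x (Suc (n + m))"
      using pow1_add[of x n m] ab by simp
    moreover have "pow1 x (Suc (m + n)) = 0" "pow1 x (Suc (n + m)) = 0"
      by (rule pow1_zero_mono[OF z], simp add: Suc)+
    moreover have "pow1 x m \<in> S" using S pow1_in by blast
    ultimately have "x * pow1 x m = 0"
      using S z unfolding self_annihilating_products_vanish_def by (metis (no_types))
    then show ?thesis using Suc.IH ab by simp
  qed
qed

text \<open>The three squares force \<open>y * x = - (x * y)\<close>, and then both factors annihilate \<open>x * y\<close>.\<close>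

lemma square_zero_sum_product_zero:
  fixes x y :: "'u::ring"
  assumes S: "self_annihilating_products_vanish S" "x \<in> S" "y \<in> S"
    and z: "x * x = 0" "y * y = 0" "(x + y) * (x + y) = 0"
  shows "x * y = 0"
proof -
  have "x * y + y * x = 0" using z by (simp add: algebra_simps)
  then have yx: "y * x = - (x * y)" by (simp add: eq_neg_iff_add_eq_0 add.commute)
  have "x * (x * y) = 0" using z by (simp add: mult.assoc[symmetric])
  moreover have "x * y * y = 0" using z by (simp add: mult.assoc)
  moreover have "x * y * x = - (x * x * y)" using yx by (simp add: mult.assoc)
  then have "x * y * x = 0" using z by simp
  moreover have "y * (x * y) = - (x * (y * y))" using yx by (simp add: mult.assoc[symmetric])
  then have "y * (x * y) = 0" using z by simp
  ultimately show ?thesis using S unfolding self_annihilating_products_vanish_def by blast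
qed

text \<open>Here \<open>(u + v)\<^sup>2 = u * v + v * u\<close> is nilpotent, because \<open>u * v\<close> is; so \<open>(u + v)\<^sup>2 = 0\<close> and the preceding
lemma applies.\<close>

lemma square_zero_product_zero:
  fixes u v :: "'u::ring"
  assumes S: "subrng S" "self_annihilating_products_vanish S" "u \<in> S" "v \<in> S"
    and z: "u * u = 0" "v * v = 0" "(u * v) * (u * v) = 0"
  shows "u * v = 0"
proof -
  define s where "s = (u + v) * (u + v)"
  have s: "s = u * v + v * u" using z by (simp add: s_def algebra_simps)
  have uu: "u * (u * x) = 0" and vv: "v * (v * x) = 0" for x
    using z by (simp_all add: mult.assoc[symmetric])
  have uvuv: "u * (v * (u * v)) = 0" "u * (v * (u * (v * x))) = 0" for x
    using z(3) by (simp_all add: mult.assoc[symmetric]) 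
  have "pow1 s 2 = 0"
    by (simp add: s numeral_2_eq_2 algebra_simps uu vv uvuv z)
  moreover have "s \<in> S" using S by (auto simp: s_def intro!: subrngD(2,4))
  ultimately have "s * s = 0" using nilpotent_square_zero S by blast
  then have "pow1 (u + v) 3 = 0" by (simp add: s_def numeral_3_eq_3 mult.assoc)
  moreover have "u + v \<in> S" using S by (auto intro!: subrngD(2))
  ultimately have "(u + v) * (u + v) = 0" using nilpotent_square_zero S by blast
  then show ?thesis using square_zero_sum_product_zero S z by blast
qed

text \<open>A multiple of the period that exceeds the preperiod serves as both at once.\<close>

lemma eventually_periodic:
  fixes a :: "nat \<Rightarrow> 'c"
  assumes step: "\<And>i. a (Suc i) = g (a i)" and fin: "finite (range a)"
  obtains n where "n \<ge> 1" "\<And>j. j \<ge> n \<Longrightarrow> a (j + n) = a j"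
proof -
  have "\<not> inj a" using fin finite_imageD infinite_UNIV_nat by blast
  then obtain i k where ik: "i < k" "a i = a k" by (metis injI linorder_neqE_nat)
  define d where "d = k - i"
  have d: "d \<ge> 1" "a (i + d) = a i" using ik by (auto simp: d_def)
  have per: "a (i + m + d) = a (i + m)" for m
    by (induction m) (use d step in \<open>simp_all\<close>)
  have per': "j \<ge> i \<Longrightarrow> a (j + d) = a j" for j using per[of "j - i"] by simp
  have perm: "j \<ge> i \<Longrightarrow> a (j + m * d) = a j" for j m
  proof (induction m)
    case (Suc m)
    have "a (j + Suc m * d) = a (j + m * d + d)" by (simp add: algebra_simps)
    then show ?case using per'[of "j + m * d"] Suc by simp
  qed simp
  have "(Suc i) * d \<ge> 1" "(Suc i) * d \<ge> i" using d(1) mult_le_mono2[of 1 d "Suc i"] by simp_all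
  then show thesis using perm by (intro that[of "Suc i * d"]) (blast intro: order_trans)+
qed

lemma idempotent_power:
  fixes x :: "'u::ring"
  assumes "finite S" "subrng S" "x \<in> S"
  obtains n where "pow1 x n * pow1 x n = pow1 x n"
proof -
  have "finite (range (pow1 x))" by (rule finite_subset[OF _ assms(1)]) (auto intro: pow1_in assms)
  then obtain n where n: "n \<ge> 1" "\<And>j. j \<ge> n \<Longrightarrow> pow1 x (j + n) = pow1 x j"
    using eventually_periodic[of "pow1 x" "(*) x"] by auto
  have "pow1 x (2*n-1) * pow1 x (2*n-1) = pow1 x (2*n-1 + n + n)"
    unfolding pow1_add using n(1) by (intro arg_cong[of _ _ "pow1 x"]) simp
  also have "\<dots> = pow1 x (2*n-1 + n)" using n(1) by (intro n(2)) simp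
  also have "\<dots> = pow1 x (2*n-1)" using n(1) by (intro n(2)) simp
  finally show thesis using that by blast
qed

text \<open>An idempotent \<open>f \<noteq> 0\<close> in the corner complementary to \<open>e\<close> makes \<open>e + f\<close> an idempotent with a strictly smaller
complementary corner.  So the smallest complementary corner contains no idempotent but 0, and since some
power of every element is idempotent, it is nil.\<close>

lemma nil_corner:
  fixes V :: "'u::ring set"
  assumes "finite V" "subrng V"
  obtains e where "e \<in> V" "e * e = e" "\<And>x. x \<in> V \<Longrightarrow> e * x = 0 \<Longrightarrow> x * e = 0 \<Longrightarrow> \<exists>n. pow1 x n = 0"
proof -
  define K where "K e = {x \<in> V. e * x = 0 \<and> x * e = 0}" for e
  have "0 \<in> V" "(0::'u) * 0 = 0" using assms by (auto dest: subrngD)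
  then obtain e where e: "e \<in> V" "e * e = e"
    and min: "\<And>e'. e' \<in> V \<Longrightarrow> e' * e' = e' \<Longrightarrow> card (K e) \<le> card (K e')"
    using arg_min_nat_lemma[of "\<lambda>e. e \<in> V \<and> e * e = e" 0 "\<lambda>e. card (K e)"] by blast
  have "\<exists>n. pow1 x n = 0" if x: "x \<in> V" "e * x = 0" "x * e = 0" for x
  proof -
    obtain n where n: "pow1 x n * pow1 x n = pow1 x n" using idempotent_power assms x by blast
    define f where "f = pow1 x n"
    have fV: "f \<in> V" using pow1_in assms x by (simp add: f_def)
    have "e * pow1 x i = 0 \<and> pow1 x i * e = 0" for i
      by (induction i) (use x in \<open>auto simp: mult.assoc, simp add: mult.assoc[symmetric]\<close>)
    then have f: "f * f = f" "e * f = 0" "f * e = 0" using n by (auto simp: f_def)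
    have "K (e + f) \<subseteq> K e"
    proof
      fix z assume "z \<in> K (e + f)"
      then have z: "z \<in> V" "e * z + f * z = 0" "z * e + z * f = 0" by (auto simp: K_def algebra_simps)
      have "e * (e * z + f * z) = e * z" "(z * e + z * f) * e = z * e"
        using e f by (simp_all add: distrib_left distrib_right mult.assoc) (simp_all add: mult.assoc[symmetric] e f)
      then show "z \<in> K e" using z by (auto simp: K_def)
    qed
    moreover have "card (K e) \<le> card (K (e + f))"
      by (rule min) (use e f fV assms in \<open>auto intro: subrngD(2) simp: algebra_simps\<close>)
    moreover have "finite (K e)" using assms by (simp add: K_def)
    ultimately have "K (e + f) = K e" using card_seteq by blast
    moreover have "f \<in> K e" using f fV by (simp add: K_def)
    ultimately have "(e + f) * f = 0" by (auto simp: K_def)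
    then have "f = 0" using f by (simp add: algebra_simps)
    then show ?thesis by (auto simp: f_def)
  qed
  then show thesis using that e by blast
qed


section \<open>Rings of additive operators\<close>

definition subgrp :: "'v::ab_group_add set \<Rightarrow> bool" where
  "subgrp V \<longleftrightarrow> 0 \<in> V \<and> (\<forall>x\<in>V. \<forall>y\<in>V. x + y \<in> V \<and> x - y \<in> V)"

lemma subgrpD:
  assumes "subgrp V"
  shows "0 \<in> V" "x \<in> V \<Longrightarrow> y \<in> V \<Longrightarrow> x + y \<in> V" "x \<in> V \<Longrightarrow> y \<in> V \<Longrightarrow> x - y \<in> V"
    "x \<in> V \<Longrightarrow> - x \<in> V" "(\<And>i. i \<in> I \<Longrightarrow> g i \<in> V) \<Longrightarrow> sum g I \<in> V"
proof -
  show 0: "0 \<in> V" and a: "x \<in> V \<Longrightarrow> y \<in> V \<Longrightarrow> x + y \<in> V" and d: "x \<in> V \<Longrightarrow> y \<in> V \<Longrightarrow> x - y \<in> V" for x y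
    using assms by (auto simp: subgrp_def)
  show "x \<in> V \<Longrightarrow> - x \<in> V" using d[OF 0, of x] by simp
  show "(\<And>i. i \<in> I \<Longrightarrow> g i \<in> V) \<Longrightarrow> sum g I \<in> V"
    by (induction I rule: infinite_finite_induct) (auto intro: 0 a)
qed

text \<open>For a relation \<open>L\<close> between two copies of a group, the slice at 0 is the obstruction to replacing a pair
\<open>(m, 0)\<close> by 0 modulo \<open>L\<close>.\<close>

lemma subgrp_slice:
  assumes "subgrp L" shows "subgrp {m. (m, 0) \<in> L}"
proof -
  have "(a + b, 0) \<in> L \<and> (a - b, 0) \<in> L" if "(a, 0) \<in> L" "(b, 0) \<in> L" for a b
    using subgrpD(2,3)[OF assms that] by simp
  then show ?thesis using subgrpD(1)[OF assms] by (simp add: subgrp_def zero_prod_def)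
qed

definition additive_on :: "'v::ab_group_add set \<Rightarrow> ('v \<Rightarrow> 'u::ab_group_add) \<Rightarrow> bool" where
  "additive_on V h \<longleftrightarrow> (\<forall>x\<in>V. \<forall>y\<in>V. h (x + y) = h x + h y)"

lemma additive_onD:
  assumes "additive_on V h" "subgrp V"
  shows "x \<in> V \<Longrightarrow> y \<in> V \<Longrightarrow> h (x + y) = h x + h y" "h 0 = 0"
    "x \<in> V \<Longrightarrow> h (- x) = - h x" "x \<in> V \<Longrightarrow> y \<in> V \<Longrightarrow> h (x - y) = h x - h y"
proof -
  show a: "x \<in> V \<Longrightarrow> y \<in> V \<Longrightarrow> h (x + y) = h x + h y" for x y
    using assms by (auto simp: additive_on_def)
  show 0: "h 0 = 0" using a[of 0 0] subgrpD[OF assms(2)] by simp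
  show n: "x \<in> V \<Longrightarrow> h (- x) = - h x" for x
    using a[of x "- x"] 0 subgrpD[OF assms(2)] by (simp add: eq_neg_iff_add_eq_0 add.commute)
  show "x \<in> V \<Longrightarrow> y \<in> V \<Longrightarrow> h (x - y) = h x - h y" for x y
    using a[of x "- y"] n[of y] subgrpD[OF assms(2)] by simp
qed

lemma inj_on_additive:
  assumes "additive_on V h" "subgrp V" "\<And>x. x \<in> V \<Longrightarrow> h x = 0 \<Longrightarrow> x = 0"
  shows "inj_on h V"
proof
  fix x y assume "x \<in> V" "y \<in> V" "h x = h y"
  then show "x = y" using assms(3)[of "x - y"] additive_onD[OF assms(1,2)] subgrpD[OF assms(2)] by simp
qed

lemma projection_along:
  assumes W: "subgrp W" "W \<subseteq> V" and K: "subgrp K" "K \<subseteq> V" and V: "subgrp V"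
    and triv: "W \<inter> K \<subseteq> {0}" and gen: "\<And>v. v \<in> V \<Longrightarrow> \<exists>w\<in>W. \<exists>k\<in>K. v = w + k"
  obtains \<pi> where "\<And>v. v \<in> V \<Longrightarrow> \<pi> v \<in> K" "\<And>v. v \<in> V \<Longrightarrow> v - \<pi> v \<in> W"
    "additive_on V \<pi>" "\<And>w. w \<in> W \<Longrightarrow> \<pi> w = 0" "\<And>k. k \<in> K \<Longrightarrow> \<pi> k = k"
    "\<And>v k. v \<in> V \<Longrightarrow> k \<in> K \<Longrightarrow> v - k \<in> W \<Longrightarrow> \<pi> v = k"
proof -
  have "\<exists>k\<in>K. v - k \<in> W" if "v \<in> V" for v using gen[OF that] by (metis add_diff_cancel_right')
  then obtain \<pi> where \<pi>: "\<And>v. v \<in> V \<Longrightarrow> \<pi> v \<in> K" "\<And>v. v \<in> V \<Longrightarrow> v - \<pi> v \<in> W" by metis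
  have uniq: "\<pi> v = k" if "v \<in> V" "k \<in> K" "v - k \<in> W" for v k
  proof -
    have "(v - k) - (v - \<pi> v) \<in> W" using subgrpD(3)[OF W(1) that(3) \<pi>(2)[OF that(1)]] .
    moreover have "\<pi> v - k \<in> K" using subgrpD(3)[OF K(1) \<pi>(1)[OF that(1)] that(2)] .
    ultimately show ?thesis using triv by auto
  qed
  have "additive_on V \<pi>" unfolding additive_on_def
  proof (intro ballI uniq)
    fix x y assume xy: "x \<in> V" "y \<in> V"
    show "x + y \<in> V" "\<pi> x + \<pi> y \<in> K" using xy \<pi> V K by (auto intro: subgrpD)
    have "(x - \<pi> x) + (y - \<pi> y) \<in> W" using xy \<pi> W by (auto intro: subgrpD)
    then show "x + y - (\<pi> x + \<pi> y) \<in> W" by (simp add: algebra_simps)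
  qed
  moreover have "\<pi> w = 0" if "w \<in> W" for w using uniq[of w 0] that W K by (auto dest: subgrpD)
  moreover have "\<pi> k = k" if "k \<in> K" for k using uniq[of k k] that W K by (auto dest: subgrpD)
  ultimately show thesis using that \<pi> uniq by blast
qed

definition op_rng :: "('v::ab_group_add \<Rightarrow> 'v) set \<Rightarrow> 'v set \<Rightarrow> bool" where
  "op_rng E V \<longleftrightarrow> finite E \<and> E \<noteq> {} \<and> (\<forall>\<phi>\<in>E. additive_on UNIV \<phi> \<and> \<phi> ` V \<subseteq> V) \<and>
     (\<forall>\<phi>\<in>E. \<forall>\<psi>\<in>E. (\<lambda>x. \<phi> x + \<psi> x) \<in> E \<and> (\<lambda>x. \<phi> x - \<psi> x) \<in> E \<and> \<phi> \<circ> \<psi> \<in> E)"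

lemma subgrp_UNIV: "subgrp UNIV" by (simp add: subgrp_def)

lemma op_rngD:
  assumes "op_rng E V"
  shows "finite E" "\<phi> \<in> E \<Longrightarrow> \<phi> (x + y) = \<phi> x + \<phi> y" "\<phi> \<in> E \<Longrightarrow> \<phi> 0 = 0" "\<phi> \<in> E \<Longrightarrow> \<phi> (x - y) = \<phi> x - \<phi> y"
    "\<phi> \<in> E \<Longrightarrow> x \<in> V \<Longrightarrow> \<phi> x \<in> V" "\<phi> \<in> E \<Longrightarrow> \<psi> \<in> E \<Longrightarrow> (\<lambda>x. \<phi> x + \<psi> x) \<in> E"
    "\<phi> \<in> E \<Longrightarrow> \<psi> \<in> E \<Longrightarrow> (\<lambda>x. \<phi> x - \<psi> x) \<in> E" "\<phi> \<in> E \<Longrightarrow> \<psi> \<in> E \<Longrightarrow> \<phi> \<circ> \<psi> \<in> E"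
    "(\<lambda>x. 0) \<in> E" "\<phi> \<in> E \<Longrightarrow> additive_on X \<phi>"
proof -
  have ad: "\<phi> \<in> E \<Longrightarrow> additive_on UNIV \<phi>" for \<phi> using assms by (auto simp: op_rng_def)
  show "\<phi> \<in> E \<Longrightarrow> \<phi> (x + y) = \<phi> x + \<phi> y" "\<phi> \<in> E \<Longrightarrow> \<phi> 0 = 0" "\<phi> \<in> E \<Longrightarrow> \<phi> (x - y) = \<phi> x - \<phi> y"
    using additive_onD[OF ad subgrp_UNIV] by auto
  show "\<phi> \<in> E \<Longrightarrow> additive_on X \<phi>" using ad by (auto simp: additive_on_def)
  show d: "\<phi> \<in> E \<Longrightarrow> \<psi> \<in> E \<Longrightarrow> (\<lambda>x. \<phi> x - \<psi> x) \<in> E" for \<phi> \<psi> using assms by (auto simp: op_rng_def)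
  obtain \<phi> where "\<phi> \<in> E" using assms by (auto simp: op_rng_def)
  from d[OF this this] show "(\<lambda>x. 0) \<in> E" by simp
qed (use assms in \<open>auto simp: op_rng_def\<close>)

lemma op_power_in:
  assumes "op_rng E V" "\<phi> \<in> E" shows "\<phi> ^^ Suc n \<in> E"
proof (induction n)
  case 0
  then show ?case using assms(2) by simp
next
  case (Suc n)
  then show ?case using op_rngD(8)[OF assms(1,2)] by (simp only: funpow.simps(2)[of "Suc n"])
qed

lemma reduced_ops_nilpotent:
  assumes E: "op_rng E V" and red: "\<And>\<phi>. \<phi> \<in> E \<Longrightarrow> \<forall>x\<in>V. \<phi> (\<phi> x) = 0 \<Longrightarrow> \<forall>x\<in>V. \<phi> x = 0"
    and \<phi>: "\<phi> \<in> E"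
  shows "\<forall>x\<in>V. (\<phi> ^^ Suc n) x = 0 \<Longrightarrow> \<forall>x\<in>V. \<phi> x = 0"
proof (induction n)
  case 0
  then show ?case by simp
next
  case (Suc n)
  let ?\<psi> = "\<phi> ^^ Suc n"
  have 0: "(\<phi> ^^ k) 0 = 0" for k by (induction k) (use op_rngD(3)[OF E \<phi>] in auto)
  have "?\<psi> (?\<psi> x) = 0" if "x \<in> V" for x
  proof -
    have "?\<psi> (?\<psi> x) = (\<phi> ^^ (Suc n + Suc n)) x" by (simp only: funpow_add comp_apply)
    also have "Suc n + Suc n = n + Suc (Suc n)" by simp
    also have "(\<phi> ^^ (n + Suc (Suc n))) x = (\<phi> ^^ n) ((\<phi> ^^ Suc (Suc n)) x)" by (simp only: funpow_add comp_apply)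
    finally show ?thesis using Suc.prems that 0 by simp
  qed
  then have "\<forall>x\<in>V. ?\<psi> x = 0" using red[OF op_power_in[OF E \<phi>]] by blast
  then show ?case by (rule Suc.IH)
qed

text \<open>A commutative ring without nilpotent elements is cut into fields by its primitive idempotents.  The same works
for a reduced ring of operators, because its idempotents are central: for idempotent \<open>\<delta>\<close> the
operators \<open>\<delta> \<phi> (1 - \<delta>)\<close> and \<open>(1 - \<delta>) \<phi> \<delta>\<close> square to zero.  Complements \<open>1 - \<phi>\<close> are admitted in order
to reach also the part of \<open>V\<close> on which \<open>E\<close> acts as zero.  Among the idempotents that keep
\<open>f\<close> out of \<open>L\<close>, one with the smallest image is primitive enough.\<close>

lemma primitive_idempotent_operator:
  assumes V: "finite V" "subgrp V" and E: "op_rng E V"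
    and red: "\<And>\<phi>. \<phi> \<in> E \<Longrightarrow> \<forall>x\<in>V. \<phi> (\<phi> x) = 0 \<Longrightarrow> \<forall>x\<in>V. \<phi> x = 0"
    and L: "subgrp L" "f \<in> V" "f \<notin> L"
  obtains \<delta> where "\<delta> \<in> E \<or> (\<exists>\<phi>\<in>E. \<delta> = (\<lambda>x. x - \<phi> x))" "\<delta> f \<notin> L"
    "\<And>x. x \<in> V \<Longrightarrow> \<delta> (\<delta> x) = \<delta> x" "\<And>\<phi> x. \<phi> \<in> E \<Longrightarrow> x \<in> V \<Longrightarrow> \<delta> (\<phi> x) = \<phi> (\<delta> x)"
    "\<And>\<phi>. \<phi> \<in> E \<Longrightarrow> (\<forall>x\<in>\<delta> ` V. \<phi> x = 0) \<or> inj_on \<phi> (\<delta> ` V)"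
proof -
  define T where "T = {\<delta>. (\<delta> \<in> E \<or> (\<exists>\<phi>\<in>E. \<delta> = (\<lambda>x. x - \<phi> x))) \<and> (\<forall>x\<in>V. \<delta> (\<delta> x) = \<delta> x) \<and> \<delta> f \<notin> L}"
  have "(\<lambda>x. x - 0) \<in> T" using L op_rngD(9)[OF E] by (auto simp: T_def intro: bexI[of _ "\<lambda>x. 0"])
  then obtain \<delta> where \<delta>T: "\<delta> \<in> T" and min: "\<And>\<mu>. \<mu> \<in> T \<Longrightarrow> card (\<delta> ` V) \<le> card (\<mu> ` V)"
    using arg_min_nat_lemma[of "\<lambda>\<mu>. \<mu> \<in> T" _ "\<lambda>\<mu>. card (\<mu> ` V)"] by blast
  have \<delta>: "\<delta> \<in> E \<or> (\<exists>\<phi>\<in>E. \<delta> = (\<lambda>x. x - \<phi> x))" "\<And>x. x \<in> V \<Longrightarrow> \<delta> (\<delta> x) = \<delta> x" "\<delta> f \<notin> L"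
    using \<delta>T by (auto simp: T_def)
  note Ea = op_rngD(2,3,4)[OF E]
  note Ev = op_rngD(5)[OF E]
  have \<delta>a: "\<delta> (x - y) = \<delta> x - \<delta> y" "\<delta> 0 = 0" for x y using \<delta>(1) Ea by (auto simp: algebra_simps)
  have \<delta>V: "\<delta> x \<in> V" if "x \<in> V" for x using \<delta>(1) that V(2) Ev by (auto intro: subgrpD)
  have left: "\<delta> \<circ> \<phi> \<in> E" and right: "\<phi> \<circ> \<delta> \<in> E" if "\<phi> \<in> E" for \<phi>
  proof -
    have "(\<lambda>x. \<phi> x - (\<psi> \<circ> \<phi>) x) \<in> E" "(\<lambda>x. \<phi> x - (\<phi> \<circ> \<psi>) x) \<in> E" if "\<psi> \<in> E" for \<psi>
      using op_rngD(7)[OF E \<open>\<phi> \<in> E\<close>] op_rngD(8)[OF E] that \<open>\<phi> \<in> E\<close> by blast+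
    then show "\<delta> \<circ> \<phi> \<in> E" "\<phi> \<circ> \<delta> \<in> E"
      using \<delta>(1) that op_rngD(8)[OF E] Ea(3)[OF that] by (auto simp: comp_def)
  qed
  have comm: "\<delta> (\<phi> x) = \<phi> (\<delta> x)" if \<phi>: "\<phi> \<in> E" and x: "x \<in> V" for \<phi> x
  proof -
    \<comment> \<open>the two off-diagonal parts of \<open>\<phi>\<close>\<close>
    define \<chi> where "\<chi> = (\<lambda>x. (\<delta> \<circ> \<phi>) x - (\<delta> \<circ> (\<phi> \<circ> \<delta>)) x)"
    define \<xi> where "\<xi> = (\<lambda>x. (\<phi> \<circ> \<delta>) x - (\<delta> \<circ> (\<phi> \<circ> \<delta>)) x)"
    have "\<chi> \<in> E" "\<xi> \<in> E" unfolding \<chi>_def \<xi>_def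
      by (rule op_rngD(7)[OF E left[OF \<phi>] left[OF right[OF \<phi>]]]
          op_rngD(7)[OF E right[OF \<phi>] left[OF right[OF \<phi>]]])+
    moreover have "\<chi> (\<chi> y) = 0" if "y \<in> V" for y
      using that \<phi> \<delta>V Ev by (simp add: \<chi>_def \<delta>a Ea(3)[OF \<phi>] \<delta>(2))
    moreover have "\<xi> (\<xi> y) = 0" if "y \<in> V" for y
      using that \<phi> \<delta>V Ev by (simp add: \<xi>_def \<delta>a Ea(3)[OF \<phi>] Ea(2)[OF \<phi>] \<delta>(2))
    ultimately have "\<chi> x = 0" "\<xi> x = 0" using red x by blast+
    then show ?thesis by (simp add: \<chi>_def \<xi>_def)
  qed
  have "(\<forall>x\<in>\<delta> ` V. \<phi> x = 0) \<or> inj_on \<phi> (\<delta> ` V)" if \<phi>: "\<phi> \<in> E" for \<phi>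
  proof -
    define \<psi> where "\<psi> = \<delta> \<circ> \<phi>"
    have \<psi>: "\<psi> \<in> E" using left \<phi> by (simp add: \<psi>_def)
    have "finite (range (\<lambda>i. \<psi> ^^ Suc i))"
      by (rule finite_subset[OF _ op_rngD(1)[OF E]]) (use op_power_in[OF E \<psi>] in blast)
    then obtain n where n: "n \<ge> 1" "\<And>j. j \<ge> n \<Longrightarrow> \<psi> ^^ Suc (j + n) = \<psi> ^^ Suc j"
      using eventually_periodic[of "\<lambda>i. \<psi> ^^ Suc i" "(\<circ>) \<psi>"] by (metis funpow.simps(2))
    \<comment> \<open>the idempotent power of \<open>\<delta> \<phi>\<close>; it and \<open>\<delta> - \<epsilon>\<close> split \<open>\<delta>\<close>, and one of them keeps \<open>f\<close> out of \<open>L\<close>\<close>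
    define \<epsilon> where "\<epsilon> = \<psi> ^^ Suc (2 * n - 1)"
    have \<epsilon>E: "\<epsilon> \<in> E" unfolding \<epsilon>_def using op_power_in[OF E \<psi>] .
    have "\<epsilon> \<circ> \<epsilon> = \<psi> ^^ Suc (2 * n - 1 + n + n)"
      unfolding \<epsilon>_def funpow_add[symmetric] using n(1) by (intro arg_cong[of _ _ "\<lambda>k. \<psi> ^^ k"]) simp
    also have "\<dots> = \<psi> ^^ Suc (2 * n - 1 + n)" using n(1) by (intro n(2)) simp
    also have "\<dots> = \<epsilon>" unfolding \<epsilon>_def using n(1) by (intro n(2)) simp
    finally have \<epsilon>\<epsilon>: "\<epsilon> (\<epsilon> x) = \<epsilon> x" for x by (metis comp_apply)
    have \<psi>V: "\<psi> x \<in> V" if "x \<in> V" for x using Ev \<psi> that by blast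
    have pV: "(\<psi> ^^ k) x \<in> V" if "x \<in> V" for x k by (induction k) (use that \<psi>V in auto)
    have \<delta>\<epsilon>: "\<delta> (\<epsilon> x) = \<epsilon> x" if "x \<in> V" for x
      unfolding \<epsilon>_def using pV[OF that] Ev \<phi> by (simp add: \<psi>_def \<delta>(2))
    have \<epsilon>\<delta>: "\<epsilon> (\<delta> x) = \<epsilon> x" if "x \<in> V" for x using comm[OF \<epsilon>E that] \<delta>\<epsilon>[OF that] by simp
    show ?thesis
    proof (cases "\<epsilon> f \<in> L")
      case False
      then have "\<epsilon> \<in> T" using \<epsilon>E \<epsilon>\<epsilon> by (auto simp: T_def)
      moreover have "\<epsilon> ` V \<subseteq> \<delta> ` V" using \<delta>\<epsilon> Ev \<epsilon>E by (metis image_subsetI image_eqI)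
      ultimately have im: "\<epsilon> ` V = \<delta> ` V" using min card_seteq V(1) by (metis finite_imageI)
      have 0: "(\<psi> ^^ k) 0 = 0" for k by (induction k) (use Ea \<psi> in auto)
      have "x = 0" if x: "x \<in> \<delta> ` V" "\<phi> x = 0" for x
      proof -
        have "x \<in> \<epsilon> ` V" using x(1) im by simp
        then have "\<epsilon> x = x" using \<epsilon>\<epsilon> by auto
        moreover have "\<epsilon> x = (\<psi> ^^ (2 * n - 1)) (\<psi> x)" by (simp add: \<epsilon>_def funpow_swap1)
        moreover have "\<psi> x = 0" using x by (simp add: \<psi>_def \<delta>a)
        ultimately show ?thesis using 0 by simp
      qed
      moreover have "subgrp (\<delta> ` V)"
      proof -
        have pl: "\<delta> x + \<delta> y = \<delta> (x + y)" for x y using \<delta>a(1)[of "x + y" y] by (simp add: algebra_simps)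
        have "\<delta> 0 \<in> \<delta> ` V" using subgrpD(1)[OF V(2)] by (rule imageI)
        then show ?thesis using subgrpD(2,3)[OF V(2)] \<delta>a(2)
          by (auto simp: subgrp_def pl \<delta>a(1)[symmetric])
      qed
      ultimately have "inj_on \<phi> (\<delta> ` V)" using inj_on_additive op_rngD(10)[OF E \<phi>] by blast
      then show ?thesis ..
    next
      case True
      define \<mu> where "\<mu> = (\<lambda>x. \<delta> x - \<epsilon> x)"
      have "\<mu> \<in> E \<or> (\<exists>\<phi>\<in>E. \<mu> = (\<lambda>x. x - \<phi> x))"
        using \<delta>(1)
      proof
        assume "\<delta> \<in> E"
        then show ?thesis using op_rngD(7)[OF E _ \<epsilon>E] by (simp add: \<mu>_def)
      next
        assume "\<exists>\<phi>\<in>E. \<delta> = (\<lambda>x. x - \<phi> x)"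
        then obtain \<phi>' where "\<phi>' \<in> E" "\<delta> = (\<lambda>x. x - \<phi>' x)" by blast
        then show ?thesis using op_rngD(6)[OF E _ \<epsilon>E, of \<phi>'] by (auto simp: \<mu>_def diff_diff_eq intro!: bexI)
      qed
      moreover have "\<mu> (\<mu> x) = \<mu> x" if "x \<in> V" for x
        using that by (simp add: \<mu>_def \<delta>a \<delta>(2) \<delta>\<epsilon> \<epsilon>\<delta> \<epsilon>\<epsilon> Ea(3)[OF \<epsilon>E])
      moreover have "\<mu> f \<notin> L" using True \<delta>(3) subgrpD(2)[OF L(1), of "\<mu> f" "\<epsilon> f"] by (auto simp: \<mu>_def)
      ultimately have \<mu>T: "\<mu> \<in> T" by (auto simp: T_def)
      have "\<mu> x = \<delta> (\<mu> x)" if "x \<in> V" for x using that by (simp add: \<mu>_def \<delta>a \<delta>(2) \<delta>\<epsilon>)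
      moreover have "\<mu> x \<in> V" if "x \<in> V" for x
        using that Ev[OF \<epsilon>E] \<delta>V subgrpD(3)[OF V(2)] by (simp add: \<mu>_def)
      ultimately have "\<mu> ` V \<subseteq> \<delta> ` V" by blast
      then have im: "\<mu> ` V = \<delta> ` V" using min[OF \<mu>T] card_seteq V(1) by (metis finite_imageI)
      have "\<epsilon> x = 0" if "x \<in> V" for x
      proof -
        have "\<delta> x \<in> \<mu> ` V" using im that by blast
        then obtain y where y: "y \<in> V" "\<delta> x = \<mu> y" by blast
        have "\<epsilon> x = \<epsilon> (\<mu> y)" using \<epsilon>\<delta>[OF that] y by simp
        also have "\<dots> = 0" using y by (simp add: \<mu>_def Ea(3)[OF \<epsilon>E] \<epsilon>\<delta> \<epsilon>\<epsilon>)
        finally show ?thesis .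
      qed
      then have "\<forall>x\<in>V. \<psi> x = 0" using reduced_ops_nilpotent[OF E red \<psi>] unfolding \<epsilon>_def by blast
      then have "\<phi> (\<delta> x) = 0" if "x \<in> V" for x using comm[OF \<phi> that] that by (simp add: \<psi>_def)
      then show ?thesis by blast
    qed
  qed
  then show thesis using that \<delta> comm by blast
qed


section \<open>Splittings by complements and by averaging\<close>

text \<open>The situation behind a primitive idempotent: the operators form a skew field or act as zero.\<close>

definition ops_zero_or_inj :: "('v::ab_group_add \<Rightarrow> 'v) set \<Rightarrow> 'v set \<Rightarrow> bool" where
  "ops_zero_or_inj E V \<longleftrightarrow> (\<forall>\<phi>\<in>E. (\<forall>x\<in>V. \<phi> x = 0) \<or> inj_on \<phi> V)"

text \<open>On a finite set an injective operator has finite order, so that its inverse is one of its powers.\<close>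

lemma op_inverse:
  assumes V: "finite V" and E: "op_rng E V" and \<phi>: "\<phi> \<in> E" "inj_on \<phi> V" and x: "x \<in> V"
  obtains \<psi> where "\<psi> \<in> E" "\<psi> (\<phi> x) = x"
proof -
  have "finite (range (\<lambda>i. \<phi> ^^ Suc i))"
    by (rule finite_subset[OF _ op_rngD(1)[OF E]]) (use op_power_in[OF E \<phi>(1)] in blast)
  then obtain n where n: "n \<ge> 1" "\<And>j. j \<ge> n \<Longrightarrow> \<phi> ^^ Suc (j + n) = \<phi> ^^ Suc j"
    using eventually_periodic[of "\<lambda>i. \<phi> ^^ Suc i" "(\<circ>) \<phi>"] by (metis funpow.simps(2))
  have pV: "(\<phi> ^^ k) y \<in> V" if "y \<in> V" for k y by (induction k) (use that op_rngD(5)[OF E \<phi>(1)] in auto)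
  have inj: "inj_on (\<phi> ^^ k) V" for k
  proof (induction k)
    case (Suc k)
    have "inj_on (\<phi> \<circ> \<phi> ^^ k) V"
      by (rule comp_inj_on[OF Suc inj_on_subset[OF \<phi>(2)]]) (use pV in auto)
    then show ?case by (simp only: funpow.simps(2))
  qed simp
  have "(\<phi> ^^ Suc n) ((\<phi> ^^ n) x) = (\<phi> ^^ Suc (n + n)) x"
    by (simp only: funpow_add[THEN fun_cong, unfolded comp_apply, symmetric] add_Suc)
  also have "\<dots> = (\<phi> ^^ Suc n) x" using n(2)[of n] by simp
  finally have "(\<phi> ^^ n) x = x" using inj[of "Suc n"] pV[OF x] x by (meson inj_onD)
  then have "(\<phi> ^^ (n + n)) x = x" by (simp add: funpow_add)
  moreover obtain m where m: "n + n = Suc (Suc m)" using n(1) by (metis Suc_leD add_Suc add_Suc_right le_add1 not0_implies_Suc not_one_le_zero One_nat_def Suc_le_D)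
  ultimately have "(\<phi> ^^ Suc m) (\<phi> x) = x" by (simp add: funpow_swap1)
  then show thesis using that op_power_in[OF E \<phi>(1)] by blast
qed

lemma maximal_superset:
  assumes "finite V" "P W0" "W0 \<subseteq> V"
  obtains W where "P W" "W0 \<subseteq> W" "W \<subseteq> V" "\<And>W'. P W' \<Longrightarrow> W \<subseteq> W' \<Longrightarrow> W' \<subseteq> V \<Longrightarrow> W' = W"
proof -
  define S where "S = {W. P W \<and> W0 \<subseteq> W \<and> W \<subseteq> V}"
  have "finite S" by (rule finite_subset[of _ "Pow V"]) (auto simp: S_def assms)
  moreover have "W0 \<in> S" using assms by (simp add: S_def)
  ultimately obtain W where "W \<in> S" "\<And>W'. W' \<in> S \<Longrightarrow> W \<subseteq> W' \<Longrightarrow> W = W'"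
    using finite_has_maximal[of S] by auto
  then show thesis using that[of W] unfolding S_def by (metis (no_types, lifting) mem_Collect_eq subset_trans)
qed

text \<open>The usual argument for vector spaces: a maximal stable \<open>W\<close> above \<open>W0\<close> which meets \<open>K\<close> trivially is a complement of
\<open>K\<close>, since \<open>W + E v\<close> still meets \<open>K\<close> trivially for \<open>v\<close> outside \<open>W + K\<close>.  The nonzero operator \<open>\<phi>0\<close> provides the
identity of the skew field, and thereby \<open>v \<in> W + E v\<close>.\<close>

lemma linear_complement:
  assumes V: "finite V" "subgrp V" and E: "op_rng E V" and div: "ops_zero_or_inj E V"
    and nz: "\<phi>0 \<in> E" "x0 \<in> V" "\<phi>0 x0 \<noteq> 0"
    and W0: "subgrp W0" "W0 \<subseteq> V" "\<forall>\<phi>\<in>E. \<phi> ` W0 \<subseteq> W0"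
    and K: "subgrp K" "K \<subseteq> V" "\<forall>\<phi>\<in>E. \<phi> ` K \<subseteq> K" and triv: "W0 \<inter> K \<subseteq> {0}"
  obtains \<pi> where "\<And>v. v \<in> V \<Longrightarrow> \<pi> v \<in> K" "additive_on V \<pi>" "\<And>w. w \<in> W0 \<Longrightarrow> \<pi> w = 0"
    "\<And>k. k \<in> K \<Longrightarrow> \<pi> k = k" "\<And>\<phi> v. \<phi> \<in> E \<Longrightarrow> v \<in> V \<Longrightarrow> \<pi> (\<phi> v) = \<phi> (\<pi> v)"
proof -
  define P where "P W \<longleftrightarrow> subgrp W \<and> (\<forall>\<phi>\<in>E. \<forall>w\<in>W. \<phi> w \<in> W) \<and> W \<inter> K \<subseteq> {0}" for W
  have KE: "\<phi> k \<in> K" if "\<phi> \<in> E" "k \<in> K" for \<phi> k using K(3) that by blast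
  have "P W0" using W0 triv by (auto simp: P_def)
  then obtain W where W: "P W" "W0 \<subseteq> W" "W \<subseteq> V"
    and max: "\<And>W'. P W' \<Longrightarrow> W \<subseteq> W' \<Longrightarrow> W' \<subseteq> V \<Longrightarrow> W' = W"
    using maximal_superset[OF V(1), of P W0] W0 by metis
  have Wg: "subgrp W" "\<And>\<phi> w. \<phi> \<in> E \<Longrightarrow> w \<in> W \<Longrightarrow> \<phi> w \<in> W" "W \<inter> K \<subseteq> {0}" using W(1) by (auto simp: P_def)
  have gen: "\<exists>w\<in>W. \<exists>k\<in>K. v = w + k" if v: "v \<in> V" for v
  proof (rule ccontr)
    assume not: "\<not> (\<exists>w\<in>W. \<exists>k\<in>K. v = w + k)"
    define W' where "W' = {w + \<phi> v | w \<phi>. w \<in> W \<and> \<phi> \<in> E}"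
    have W'I: "w + \<phi> v \<in> W'" if "w \<in> W" "\<phi> \<in> E" for w \<phi> using that by (auto simp: W'_def)
    have "subgrp W'"
    proof -
      have "0 + (\<lambda>x. 0) v \<in> W'" using W'I[OF subgrpD(1)[OF Wg(1)] op_rngD(9)[OF E]] .
      moreover have "x + y \<in> W' \<and> x - y \<in> W'" if xy: "x \<in> W'" "y \<in> W'" for x y
      proof -
        obtain w \<phi> u \<psi> where d: "x = w + \<phi> v" "y = u + \<psi> v" "w \<in> W" "u \<in> W" "\<phi> \<in> E" "\<psi> \<in> E"
          using xy by (auto simp: W'_def)
        have "(w + u) + (\<lambda>x. \<phi> x + \<psi> x) v \<in> W'" "(w - u) + (\<lambda>x. \<phi> x - \<psi> x) v \<in> W'"
          by (rule W'I[OF subgrpD(2)[OF Wg(1) d(3,4)] op_rngD(6)[OF E d(5,6)]]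
              W'I[OF subgrpD(3)[OF Wg(1) d(3,4)] op_rngD(7)[OF E d(5,6)]])+
        then show ?thesis using d by (simp add: algebra_simps)
      qed
      ultimately show ?thesis by (simp add: subgrp_def)
    qed
    moreover have "\<phi> x \<in> W'" if "\<phi> \<in> E" "x \<in> W'" for \<phi> x
    proof -
      obtain w \<psi> where d: "x = w + \<psi> v" "w \<in> W" "\<psi> \<in> E" using \<open>x \<in> W'\<close> by (auto simp: W'_def)
      have "\<phi> w + (\<phi> \<circ> \<psi>) v \<in> W'" using W'I[OF Wg(2)[OF that(1) d(2)] op_rngD(8)[OF E that(1) d(3)]] .
      then show ?thesis using d that op_rngD(2)[OF E] by simp
    qed
    moreover have "W' \<inter> K \<subseteq> {0}"
    proof
      fix x assume "x \<in> W' \<inter> K"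
      then obtain w \<phi> where d: "x = w + \<phi> v" "w \<in> W" "\<phi> \<in> E" "x \<in> K" by (auto simp: W'_def)
      have "\<phi> v = 0"
      proof (rule ccontr)
        assume "\<phi> v \<noteq> 0"
        then have "inj_on \<phi> V" using div d v by (auto simp: ops_zero_or_inj_def)
        then obtain \<psi> where \<psi>: "\<psi> \<in> E" "\<psi> (\<phi> v) = v" using op_inverse[OF V(1) E d(3) _ v] by blast
        have "v = \<psi> (- w) + \<psi> x" using \<psi> d op_rngD(2)[OF E \<psi>(1), of "- w" x] by simp
        moreover have "\<psi> (- w) \<in> W" "\<psi> x \<in> K" by (rule Wg(2)[OF \<psi>(1) subgrpD(4)[OF Wg(1) d(2)]] KE[OF \<psi>(1) d(4)])+
        ultimately show False using not by blast
      qed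
      then show "x \<in> {0}" using d Wg(3) by auto
    qed
    ultimately have "P W'" by (simp add: P_def)
    moreover have "W \<subseteq> W'"
    proof
      fix w assume "w \<in> W"
      then have "w + (\<lambda>x. 0) v \<in> W'" using W'I[OF _ op_rngD(9)[OF E]] by blast
      then show "w \<in> W'" by simp
    qed
    moreover have "W' \<subseteq> V" using W(3) v op_rngD(5)[OF E] subgrpD(2)[OF V(2)] by (auto simp: W'_def)
    ultimately have "W' = W" using max by blast
    moreover have "v \<in> W'"
    proof -
      have "inj_on \<phi>0 V" using div nz by (auto simp: ops_zero_or_inj_def)
      then obtain \<psi> where \<psi>: "\<psi> \<in> E" "\<psi> (\<phi>0 v) = v" using op_inverse[OF V(1) E nz(1) _ v] by blast
      have "0 + (\<psi> \<circ> \<phi>0) v \<in> W'" using W'I[OF subgrpD(1)[OF Wg(1)] op_rngD(8)[OF E \<psi>(1) nz(1)]] .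
      then show ?thesis using \<psi> by simp
    qed
    ultimately have "v \<in> W" by simp
    moreover have "v = v + 0" "0 \<in> K" using subgrpD(1)[OF K(1)] by auto
    ultimately show False using not by blast
  qed
  obtain \<pi> where \<pi>: "\<And>v. v \<in> V \<Longrightarrow> \<pi> v \<in> K" "\<And>v. v \<in> V \<Longrightarrow> v - \<pi> v \<in> W"
    "additive_on V \<pi>" "\<And>w. w \<in> W \<Longrightarrow> \<pi> w = 0" "\<And>k. k \<in> K \<Longrightarrow> \<pi> k = k"
    "\<And>v k. v \<in> V \<Longrightarrow> k \<in> K \<Longrightarrow> v - k \<in> W \<Longrightarrow> \<pi> v = k"
    using projection_along[OF Wg(1) W(3) K(1,2) V(2) Wg(3) gen] by blast
  have "\<pi> (\<phi> v) = \<phi> (\<pi> v)" if "\<phi> \<in> E" "v \<in> V" for \<phi> v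
  proof (rule \<pi>(6))
    show "\<phi> v \<in> V" "\<phi> (\<pi> v) \<in> K" using that op_rngD(5)[OF E] KE \<pi>(1) by blast+
    show "\<phi> v - \<phi> (\<pi> v) \<in> W" using that Wg(2) \<pi>(2) op_rngD(4)[OF E] by metis
  qed
  then show thesis using that[OF \<pi>(1,3) _ \<pi>(5)] \<pi>(4) W(2) by blast
qed


text \<open>The map \<open>(a, b) \<mapsto> \<sigma> a + \<tau> b\<close> factors through \<open>(M \<times> M) / L\<close>, and on the first factor it is the identity modulo the slice
of \<open>L\<close> at 0.  This last property is preserved by averaging, and it implies that \<open>\<sigma>\<close> kills no element outside the slice.\<close>

definition splitting_pair :: "'v::ab_group_add set \<Rightarrow> ('v \<times> 'v) set \<Rightarrow> ('v \<Rightarrow> 'v) \<Rightarrow> ('v \<Rightarrow> 'v) \<Rightarrow> bool" where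
  "splitting_pair M L \<sigma> \<tau> \<longleftrightarrow> \<sigma> ` M \<subseteq> M \<and> \<tau> ` M \<subseteq> M \<and> additive_on M \<sigma> \<and> additive_on M \<tau> \<and>
     (\<forall>(a, b)\<in>L. \<sigma> a + \<tau> b = 0) \<and> (\<forall>m\<in>M. (\<sigma> m - m, 0) \<in> L)"

definition commute_on :: "'v set \<Rightarrow> ('v \<Rightarrow> 'v) set \<Rightarrow> ('v \<Rightarrow> 'v) \<Rightarrow> bool" where
  "commute_on M E \<sigma> \<longleftrightarrow> (\<forall>\<phi>\<in>E. \<forall>m\<in>M. \<sigma> (\<phi> m) = \<phi> (\<sigma> m))"

lemma commute_on_Un: "commute_on M (E \<union> E') \<sigma> \<longleftrightarrow> commute_on M E \<sigma> \<and> commute_on M E' \<sigma>"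
  by (auto simp: commute_on_def)

text \<open>Choose a complement of the slice \<open>L1\<close> in \<open>M\<close>, and project \<open>M \<times> M\<close> to its copy in the first factor along a
complement that contains \<open>L\<close>.\<close>

lemma linear_splitting:
  assumes M: "finite M" "subgrp M" and E: "op_rng E M" and div: "ops_zero_or_inj E M"
    and nz: "\<phi>0 \<in> E" "x0 \<in> M" "\<phi>0 x0 \<noteq> 0"
    and L: "subgrp L" "L \<subseteq> M \<times> M" "\<And>\<phi> a b. \<phi> \<in> E \<Longrightarrow> (a, b) \<in> L \<Longrightarrow> (\<phi> a, \<phi> b) \<in> L"
  obtains \<sigma> \<tau> where "splitting_pair M L \<sigma> \<tau>" "commute_on M E \<sigma>" "commute_on M E \<tau>"
proof -
  define L1 where "L1 = {m. (m, 0) \<in> L}"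
  have L1: "subgrp L1" "L1 \<subseteq> M" "\<And>\<phi> m. \<phi> \<in> E \<Longrightarrow> m \<in> L1 \<Longrightarrow> \<phi> m \<in> L1"
  proof -
    show "subgrp L1" unfolding L1_def by (rule subgrp_slice[OF L(1)])
    show "L1 \<subseteq> M" using L(2) by (auto simp: L1_def)
    show "\<And>\<phi> m. \<phi> \<in> E \<Longrightarrow> m \<in> L1 \<Longrightarrow> \<phi> m \<in> L1" unfolding L1_def by (metis L(3) op_rngD(3)[OF E] mem_Collect_eq)
  qed
  have z: "subgrp {0}" "{0} \<subseteq> M" "\<forall>\<phi>\<in>E. \<phi> ` {0} \<subseteq> {0}" "{0} \<inter> L1 \<subseteq> {0}"
    using subgrpD(1)[OF M(2)] op_rngD(3)[OF E] by (auto simp: subgrp_def)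
  have L1E: "\<forall>\<phi>\<in>E. \<phi> ` L1 \<subseteq> L1" using L1(3) by blast
  obtain \<pi> where \<pi>: "\<And>v. v \<in> M \<Longrightarrow> \<pi> v \<in> L1" "additive_on M \<pi>" "\<And>w. w \<in> {0} \<Longrightarrow> \<pi> w = 0"
    "\<And>k. k \<in> L1 \<Longrightarrow> \<pi> k = k"
    "\<And>\<phi> v. \<phi> \<in> E \<Longrightarrow> v \<in> M \<Longrightarrow> \<pi> (\<phi> v) = \<phi> (\<pi> v)"
    by (rule linear_complement[OF M E div nz z(1-3) L1(1,2) L1E z(4)]) (rule that)
  note \<pi>a = additive_onD[OF \<pi>(2) M(2)]
  \<comment> \<open>the kernel of \<open>\<pi>\<close> is the complement of the slice\<close>
  define K where "K = {m \<in> M. \<pi> m = 0} \<times> {0::'a}"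
  define E2 where "E2 = (\<lambda>\<phi>. map_prod \<phi> \<phi>) ` E"
  have V: "finite (M \<times> M)" "subgrp (M \<times> M)" using M subgrpD(1-3)[OF M(2)] by (auto simp: subgrp_def zero_prod_def)
  have E2: "op_rng E2 (M \<times> M)"
    unfolding op_rng_def
  proof (intro conjI ballI)
    show "finite E2" "E2 \<noteq> {}" using E by (auto simp: E2_def op_rng_def)
    fix \<phi>' assume "\<phi>' \<in> E2"
    then obtain \<phi> where \<phi>: "\<phi> \<in> E" "\<phi>' = map_prod \<phi> \<phi>" by (auto simp: E2_def)
    show "additive_on UNIV \<phi>'" using op_rngD(2)[OF E \<phi>(1)] by (auto simp: \<phi>(2) additive_on_def)
    show "\<phi>' ` (M \<times> M) \<subseteq> M \<times> M" using op_rngD(5)[OF E \<phi>(1)] by (auto simp: \<phi>(2))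
    fix \<psi>' assume "\<psi>' \<in> E2"
    then obtain \<psi> where \<psi>: "\<psi> \<in> E" "\<psi>' = map_prod \<psi> \<psi>" by (auto simp: E2_def)
    have eqs: "(\<lambda>x. \<phi>' x + \<psi>' x) = map_prod (\<lambda>x. \<phi> x + \<psi> x) (\<lambda>x. \<phi> x + \<psi> x)"
      "(\<lambda>x. \<phi>' x - \<psi>' x) = map_prod (\<lambda>x. \<phi> x - \<psi> x) (\<lambda>x. \<phi> x - \<psi> x)"
      "\<phi>' \<circ> \<psi>' = map_prod (\<phi> \<circ> \<psi>) (\<phi> \<circ> \<psi>)"
      by (auto simp: \<phi>(2) \<psi>(2))
    show "(\<lambda>x. \<phi>' x + \<psi>' x) \<in> E2" "(\<lambda>x. \<phi>' x - \<psi>' x) \<in> E2" "\<phi>' \<circ> \<psi>' \<in> E2"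
      unfolding eqs E2_def by (rule imageI op_rngD(6-8)[OF E \<phi>(1) \<psi>(1)])+
  qed
  have div2: "ops_zero_or_inj E2 (M \<times> M)" unfolding ops_zero_or_inj_def
  proof
    fix \<phi>' assume "\<phi>' \<in> E2"
    then obtain \<phi> where \<phi>: "\<phi> \<in> E" "\<phi>' = map_prod \<phi> \<phi>" by (auto simp: E2_def)
    then have "(\<forall>x\<in>M. \<phi> x = 0) \<or> inj_on \<phi> M" using div by (auto simp: ops_zero_or_inj_def)
    then show "(\<forall>x\<in>M \<times> M. \<phi>' x = 0) \<or> inj_on \<phi>' (M \<times> M)"
      using map_prod_inj_on[of \<phi> M \<phi> M] by (auto simp: \<phi>(2) zero_prod_def)
  qed
  have nz2: "map_prod \<phi>0 \<phi>0 \<in> E2" "(x0, x0) \<in> M \<times> M" "map_prod \<phi>0 \<phi>0 (x0, x0) \<noteq> 0"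
    using nz by (auto simp: E2_def zero_prod_def)
  have L2: "\<forall>\<phi>\<in>E2. \<phi> ` L \<subseteq> L" using L(3) by (auto simp: E2_def)
  have K: "subgrp K" "K \<subseteq> M \<times> M" "\<forall>\<phi>\<in>E2. \<phi> ` K \<subseteq> K"
    using subgrpD(1-3)[OF M(2)] \<pi>a \<pi>(5) op_rngD(3,5)[OF E]
    by (auto simp: K_def subgrp_def zero_prod_def E2_def)
  have "L \<inter> K \<subseteq> {0}" using \<pi>(4) by (auto simp: K_def L1_def zero_prod_def)
  then obtain p where p: "\<And>v. v \<in> M \<times> M \<Longrightarrow> p v \<in> K" "additive_on (M \<times> M) p" "\<And>w. w \<in> L \<Longrightarrow> p w = 0"
    "\<And>k. k \<in> K \<Longrightarrow> p k = k" "\<And>\<phi> v. \<phi> \<in> E2 \<Longrightarrow> v \<in> M \<times> M \<Longrightarrow> p (\<phi> v) = \<phi> (p v)"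
    by (rule linear_complement[OF V E2 div2 nz2 L(1,2) L2 K]) (rule that)
  note pa = additive_onD[OF p(2) V(2)]
  note M0 = subgrpD(1)[OF M(2)]
  define \<sigma> where "\<sigma> m = fst (p (m, 0))" for m
  define \<tau> where "\<tau> m = fst (p (0, m))" for m
  have pM: "fst (p v) \<in> M" if "v \<in> M \<times> M" for v using p(1)[OF that] by (auto simp: K_def)
  have "splitting_pair M L \<sigma> \<tau>" unfolding splitting_pair_def
  proof (intro conjI ballI)
    show "\<sigma> ` M \<subseteq> M" "\<tau> ` M \<subseteq> M" using pM M0 by (auto simp: \<sigma>_def \<tau>_def)
    show "additive_on M \<sigma>" unfolding additive_on_def
    proof (intro ballI)
      fix x y assume "x \<in> M" "y \<in> M"
      then show "\<sigma> (x + y) = \<sigma> x + \<sigma> y" using pa(1)[of "(x, 0)" "(y, 0)"] M0 by (simp add: \<sigma>_def)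
    qed
    show "additive_on M \<tau>" unfolding additive_on_def
    proof (intro ballI)
      fix x y assume "x \<in> M" "y \<in> M"
      then show "\<tau> (x + y) = \<tau> x + \<tau> y" using pa(1)[of "(0, x)" "(0, y)"] M0 by (simp add: \<tau>_def)
    qed
    fix v assume v: "v \<in> L"
    obtain a b where ab: "v = (a, b)" by (cases v)
    then have "a \<in> M" "b \<in> M" using v L(2) by auto
    then have "p (a, b) = p (a, 0) + p (0, b)" using pa(1)[of "(a, 0)" "(0, b)"] M0 by simp
    then have "fst (p (a, 0) + p (0, b)) = 0" using p(3)[OF v] by (simp add: ab)
    then show "case v of (a, b) \<Rightarrow> \<sigma> a + \<tau> b = 0" by (simp add: ab \<sigma>_def \<tau>_def)
  next
    fix m assume m: "m \<in> M"
    have mL: "\<pi> m \<in> M" using \<pi>(1)[OF m] L1 by blast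
    have kK: "(m - \<pi> m, 0) \<in> K" using m mL \<pi>(1,4) \<pi>a(4)[OF m mL] subgrpD(3)[OF M(2)] by (simp add: K_def)
    have "p (m, 0) = p (\<pi> m, 0) + p (m - \<pi> m, 0)"
      using pa(1)[of "(\<pi> m, 0)" "(m - \<pi> m, 0)"] m mL M0 subgrpD(3)[OF M(2)] by simp
    also have "p (\<pi> m, 0) = 0" using \<pi>(1)[OF m] p(3) by (simp add: L1_def)
    also have "p (m - \<pi> m, 0) = (m - \<pi> m, 0)" using p(4)[OF kK] .
    finally have "\<sigma> m - m = - \<pi> m" by (simp add: \<sigma>_def)
    then show "(\<sigma> m - m, 0) \<in> L" using subgrpD(4)[OF L1(1) \<pi>(1)[OF m]] by (simp add: L1_def)
  qed
  moreover have "\<sigma> (\<phi> m) = \<phi> (\<sigma> m) \<and> \<tau> (\<phi> m) = \<phi> (\<tau> m)" if "\<phi> \<in> E" "m \<in> M" for \<phi> m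
    using p(5)[of "map_prod \<phi> \<phi>" "(m, 0)"] p(5)[of "map_prod \<phi> \<phi>" "(0, m)"] that M0 op_rngD(3)[OF E that(1)]
    by (auto simp: E2_def \<sigma>_def \<tau>_def)
  ultimately show thesis using that by (auto simp: commute_on_def)
qed


text \<open>Translation by \<open>x\<close> permutes the group, so the sum of all elements does not change when \<open>x\<close> is added to each of them.\<close>

lemma finite_subgrp_sum_const:
  assumes "finite O'" "subgrp O'" "(x::'v::ab_group_add) \<in> O'"
  shows "(\<Sum>y\<in>O'. x) = 0"
proof -
  have "bij_betw (\<lambda>y. y + x) O' O'"
    by (rule bij_betwI[of _ _ _ "\<lambda>y. y - x"]) (use subgrpD[OF assms(2)] assms(3) in auto)
  then have "(\<Sum>y\<in>O'. y + x) = (\<Sum>y\<in>O'. y)" by (rule sum.reindex_bij_betw)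
  then show ?thesis by (simp add: sum.distrib)
qed

lemma op_sum:
  assumes "op_rng E V" "\<phi> \<in> E" shows "\<phi> (sum g I) = (\<Sum>i\<in>I. \<phi> (g i))"
  by (induction I rule: infinite_finite_induct) (simp_all add: op_rngD(2,3)[OF assms])

text \<open>Maschke's argument.  The nonzero operators form a finite group \<open>G\<close>, and the maps
\<open>- (\<Sum>a\<in>G. a\<^sup>-\<^sup>1 \<circ> \<rho> \<circ> a)\<close> with \<open>\<rho>\<close> one of \<open>\<sigma>\<close>, \<open>\<tau>\<close> commute with \<open>E\<close>.  Division by the order of \<open>G\<close> is replaced by a change of sign: \<open>G\<close> and
the zero operator form a skew field, and a sum of as many copies of \<open>m\<close> as the skew field
has elements is zero, so \<open>card G\<close> acts as \<open>-1\<close>.\<close>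

lemma averaged_splitting:
  assumes M: "finite M" "subgrp M" and E: "op_rng E M" and div: "ops_zero_or_inj E M"
    and L: "subgrp L" "L \<subseteq> M \<times> M" "\<And>\<phi> a b. \<phi> \<in> E \<Longrightarrow> (a, b) \<in> L \<Longrightarrow> (\<phi> a, \<phi> b) \<in> L"
    and spl: "splitting_pair M L \<sigma> \<tau>"
    and E': "\<And>\<psi>. \<psi> \<in> E' \<Longrightarrow> additive_on M \<psi>" "\<And>\<psi> m. \<psi> \<in> E' \<Longrightarrow> m \<in> M \<Longrightarrow> \<psi> m \<in> M"
      "\<And>\<phi> \<psi> m. \<phi> \<in> E \<Longrightarrow> \<psi> \<in> E' \<Longrightarrow> m \<in> M \<Longrightarrow> \<phi> (\<psi> m) = \<psi> (\<phi> m)"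
    and comm: "commute_on M E' \<sigma>" "commute_on M E' \<tau>"
  obtains \<sigma>' \<tau>' where "splitting_pair M L \<sigma>' \<tau>'" "commute_on M (E \<union> E') \<sigma>'" "commute_on M (E \<union> E') \<tau>'"
proof -
  note M0 = subgrpD(1)[OF M(2)]
  have s: "\<sigma> ` M \<subseteq> M" "\<tau> ` M \<subseteq> M" "additive_on M \<sigma>" "additive_on M \<tau>"
    "\<And>a b. (a, b) \<in> L \<Longrightarrow> \<sigma> a + \<tau> b = 0" "\<And>m. m \<in> M \<Longrightarrow> (\<sigma> m - m, 0) \<in> L"
    using spl by (auto simp: splitting_pair_def)
  show thesis
  proof (cases "\<forall>\<phi>\<in>E. \<forall>x\<in>M. \<phi> x = 0")
    case True
    have "commute_on M E \<rho>" if "\<rho> ` M \<subseteq> M" "additive_on M \<rho>" for \<rho>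
      using True that additive_onD(2)[OF that(2) M(2)] by (force simp: commute_on_def)
    then have "commute_on M E \<sigma>" "commute_on M E \<tau>" using s by blast+
    then show thesis using that[OF spl] comm by (simp add: commute_on_Un)
  next
    case False
    then obtain \<phi>0 x0 where nz: "\<phi>0 \<in> E" "x0 \<in> M" "\<phi>0 x0 \<noteq> 0" by blast
    \<comment> \<open>restriction identifies operators that agree on \<open>M\<close>\<close>
    define R where "R = (\<lambda>\<phi>. restrict \<phi> M) ` E"
    define G where "G = {a \<in> R. \<exists>m\<in>M. a m \<noteq> 0}"
    have fin: "finite R" "finite G" using op_rngD(1)[OF E] by (auto simp: R_def G_def)
    have Rrep: "\<exists>\<phi>\<in>E. a = restrict \<phi> M" if "a \<in> R" for a using that by (auto simp: R_def)
    have RM: "a m \<in> M" if "a \<in> R" "m \<in> M" for a m using Rrep[OF that(1)] op_rngD(5)[OF E] that by auto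
    have Radd: "a (x + y) = a x + a y" if "a \<in> R" "x \<in> M" "y \<in> M" for a x y
      using Rrep[OF that(1)] op_rngD(2)[OF E] that subgrpD(2)[OF M(2)] by auto
    have RL: "(a x, a y) \<in> L" if "a \<in> R" "(x, y) \<in> L" for a x y
    proof -
      have "x \<in> M" "y \<in> M" using that L(2) by auto
      then show ?thesis using Rrep[OF that(1)] L(3) that(2) by auto
    qed
    have injE: "inj_on \<phi> M" if "\<phi> \<in> E" "m \<in> M" "\<phi> m \<noteq> 0" for \<phi> m
      using div that by (auto simp: ops_zero_or_inj_def)
    have Ginj: "inj_on a M" if "a \<in> G" for a
    proof -
      obtain \<phi> m where "\<phi> \<in> E" "a = restrict \<phi> M" "m \<in> M" "\<phi> m \<noteq> 0"
        using \<open>a \<in> G\<close> Rrep by (force simp: G_def)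
      then show ?thesis using injE by (simp add: inj_on_restrict_eq)
    qed
    have GR: "G \<subseteq> R" by (auto simp: G_def)
    have Gsurj: "a ` M = M" if "a \<in> G" for a
      using endo_inj_surj[OF M(1) _ Ginj[OF that]] RM that GR by blast
    define iv where "iv a = inv_into M a" for a :: "'a \<Rightarrow> 'a"
    have iv: "iv a y \<in> M" "a (iv a y) = y" if "a \<in> G" "y \<in> M" for a y
      using inv_into_into[of y a M] f_inv_into_f[of y a M] Gsurj that by (auto simp: iv_def)
    have ivI: "iv a y = x" if "a \<in> G" "x \<in> M" "a x = y" for a x y
      using inv_into_f_f[OF Ginj] that by (auto simp: iv_def)
    have ivadd: "iv a (x + y) = iv a x + iv a y" if "a \<in> G" "x \<in> M" "y \<in> M" for a x y
      using that iv[OF that(1,2)] iv[OF that(1,3)] Radd[OF subsetD[OF GR that(1)], of "iv a x" "iv a y"]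
        subgrpD(2)[OF M(2)]
      by (intro ivI) auto
    have iv0: "iv a 0 = 0" if "a \<in> G" for a
      using ivadd[OF that M0 M0] by simp
    define avg where "avg \<rho> m = - (\<Sum>a\<in>G. iv a (\<rho> (a m)))" for \<rho> m
    have avg: "avg \<rho> ` M \<subseteq> M" "additive_on M (avg \<rho>)" "commute_on M E (avg \<rho>)" "commute_on M E' (avg \<rho>)"
      if \<rho>: "\<rho> ` M \<subseteq> M" "additive_on M \<rho>" "commute_on M E' \<rho>" for \<rho>
    proof -
      have t: "iv a (\<rho> (a m)) \<in> M" if "a \<in> G" "m \<in> M" for a m
      proof (rule iv(1)[OF that(1)])
        have "a m \<in> M" using RM that GR by blast
        then show "\<rho> (a m) \<in> M" using \<rho>(1) by blast
      qed
      then show avgM: "avg \<rho> ` M \<subseteq> M" by (auto simp: avg_def intro!: subgrpD(4,5)[OF M(2)])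
      note \<rho>a = additive_onD(1)[OF \<rho>(2) M(2)]
      have "iv a (\<rho> (a (x + y))) = iv a (\<rho> (a x)) + iv a (\<rho> (a y))" if "a \<in> G" "x \<in> M" "y \<in> M" for a x y
      proof -
        have "a \<in> R" using that GR by blast
        then show ?thesis using that \<rho>(1) RM by (simp add: Radd \<rho>a ivadd image_subset_iff)
      qed
      then show add: "additive_on M (avg \<rho>)"
        by (simp add: additive_on_def avg_def sum.distrib)
      show "commute_on M E (avg \<rho>)" unfolding commute_on_def
      proof (intro ballI)
        fix b m assume b: "b \<in> E" and m: "m \<in> M"
        show "avg \<rho> (b m) = b (avg \<rho> m)"
        proof (cases "\<forall>x\<in>M. b x = 0")
          case True
          then show ?thesis using additive_onD(2)[OF add M(2)] avgM m by auto
        next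
          case False
          then have binj: "inj_on b M" using injE b by blast
          have bM: "b x \<in> M" if "x \<in> M" for x using op_rngD(5)[OF E b that] .
          have bsurj: "b ` M = M" using endo_inj_surj[OF M(1) _ binj] bM by blast
          \<comment> \<open>reindexing the sum by right translation with \<open>b\<close> moves \<open>b\<close> to the left\<close>
          define \<kappa> where "\<kappa> a = restrict (a \<circ> b) M" for a :: "'a \<Rightarrow> 'a"
          have \<kappa>R: "\<kappa> a \<in> R" if "a \<in> R" for a
          proof -
            obtain \<phi> where "\<phi> \<in> E" "a = restrict \<phi> M" using Rrep \<open>a \<in> R\<close> by blast
            then have "\<phi> \<circ> b \<in> E" "\<kappa> a = restrict (\<phi> \<circ> b) M"
              using op_rngD(8)[OF E _ b] bM by (auto simp: \<kappa>_def restrict_def)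
            then show ?thesis by (auto simp: R_def)
          qed
          have \<kappa>G: "\<kappa> a \<in> G" if "a \<in> G" for a
          proof -
            obtain x where "x \<in> M" "a x \<noteq> 0" using \<open>a \<in> G\<close> by (auto simp: G_def)
            moreover obtain x' where "x' \<in> M" "x = b x'" using bsurj \<open>x \<in> M\<close> by blast
            ultimately have "\<kappa> a x' \<noteq> 0" by (simp add: \<kappa>_def)
            then show ?thesis using \<kappa>R GR that \<open>x' \<in> M\<close> by (auto simp: G_def)
          qed
          have "inj_on \<kappa> G"
          proof
            fix a a' assume a: "a \<in> G" "a' \<in> G" "\<kappa> a = \<kappa> a'"
            have "a x = a' x" for x
            proof (cases "x \<in> M")
              case True
              then obtain x' where "x' \<in> M" "x = b x'" using bsurj by blast
              then show ?thesis using fun_cong[OF a(3), of x'] by (simp add: \<kappa>_def)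
            next
              case False
              then show ?thesis using Rrep[OF subsetD[OF GR a(1)]] Rrep[OF subsetD[OF GR a(2)]] by auto
            qed
            then show "a = a'" by blast
          qed
          then have bij: "bij_betw \<kappa> G G" using endo_inj_surj[OF fin(2)] \<kappa>G by (auto simp: bij_betw_def)
          have "iv a (\<rho> (a (b m))) = b (iv (\<kappa> a) (\<rho> (\<kappa> a m)))" if a: "a \<in> G" for a
          proof (rule ivI[OF a])
            have "\<kappa> a m \<in> M" using RM \<kappa>G[OF a] GR m by blast
            then have y: "\<rho> (\<kappa> a m) \<in> M" using \<rho>(1) by blast
            then show "b (iv (\<kappa> a) (\<rho> (\<kappa> a m))) \<in> M" using iv(1)[OF \<kappa>G[OF a]] bM by blast
            have "a (b (iv (\<kappa> a) (\<rho> (\<kappa> a m)))) = \<kappa> a (iv (\<kappa> a) (\<rho> (\<kappa> a m)))"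
              using iv(1)[OF \<kappa>G[OF a] y] by (simp add: \<kappa>_def)
            also have "\<dots> = \<rho> (\<kappa> a m)" using iv(2)[OF \<kappa>G[OF a] y] .
            finally show "a (b (iv (\<kappa> a) (\<rho> (\<kappa> a m)))) = \<rho> (a (b m))" using m by (simp add: \<kappa>_def)
          qed
          then have "avg \<rho> (b m) = - (\<Sum>a\<in>G. b (iv (\<kappa> a) (\<rho> (\<kappa> a m))))" by (simp add: avg_def)
          also have "(\<Sum>a\<in>G. b (iv (\<kappa> a) (\<rho> (\<kappa> a m)))) = (\<Sum>c\<in>G. b (iv c (\<rho> (c m))))"
            by (rule sum.reindex_bij_betw[OF bij])
          also have "- \<dots> = b (avg \<rho> m)"
            using op_rngD(4)[OF E b, of 0] op_rngD(3)[OF E b] by (simp add: avg_def op_sum[OF E b])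
          finally show ?thesis .
        qed
      qed
      show "commute_on M E' (avg \<rho>)" unfolding commute_on_def
      proof (intro ballI)
        fix \<psi> m assume \<psi>: "\<psi> \<in> E'" and m: "m \<in> M"
        note \<psi>a = additive_onD[OF E'(1)[OF \<psi>] M(2)]
        have \<psi>sum: "\<psi> (sum g I) = (\<Sum>i\<in>I. \<psi> (g i))" if "finite I" "\<And>i. i \<in> I \<Longrightarrow> g i \<in> M" for g and I :: "('a \<Rightarrow> 'a) set"
          using that by (induction I rule: finite_induct) (auto simp: \<psi>a subgrpD(5)[OF M(2)])
        have aa: "a (\<psi> x) = \<psi> (a x)" if "a \<in> R" "x \<in> M" for a x
          using Rrep[OF that(1)] E'(2,3) \<psi> that by auto
        have "iv a (\<rho> (a (\<psi> m))) = \<psi> (iv a (\<rho> (a m)))" if a: "a \<in> G" for a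
        proof (rule ivI[OF a])
          have aR: "a \<in> R" using a GR by blast
          have y: "\<rho> (a m) \<in> M" using \<rho>(1) RM[OF aR m] by blast
          show "\<psi> (iv a (\<rho> (a m))) \<in> M" using iv(1)[OF a y] E'(2) \<psi> by blast
          show "a (\<psi> (iv a (\<rho> (a m)))) = \<rho> (a (\<psi> m))"
            using aa[OF aR] iv[OF a y] m \<rho>(3) \<psi> RM[OF aR m] by (simp add: commute_on_def)
        qed
        then show "avg \<rho> (\<psi> m) = \<psi> (avg \<rho> m)"
          using t m by (simp add: avg_def \<psi>sum fin(2) \<psi>a(3) subgrpD(5)[OF M(2)])
      qed
    qed
    \<comment> \<open>the orbit of \<open>m \<noteq> 0\<close> under \<open>R\<close> is a group in bijection with \<open>R\<close>, and \<open>m\<close> belongs to it\<close>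
    have card0: "(\<Sum>a\<in>R. m) = 0" if m: "m \<in> M" for m
    proof -
      have diff: "a = a'" if a: "a \<in> R" "a' \<in> R" and x: "x \<in> M" "x \<noteq> 0" "a x = a' x" for a a' x
      proof -
        obtain \<phi> \<psi> where d: "\<phi> \<in> E" "a = restrict \<phi> M" "\<psi> \<in> E" "a' = restrict \<psi> M" using Rrep a by metis
        have E0: "(\<lambda>x. \<phi> x - \<psi> x) \<in> E" using op_rngD(7)[OF E] d by blast
        have "\<not> inj_on (\<lambda>x. \<phi> x - \<psi> x) M"
        proof
          assume "inj_on (\<lambda>x. \<phi> x - \<psi> x) M"
          from inj_onD[OF this, of x 0] show False
            using x d M0 op_rngD(3)[OF E d(1)] op_rngD(3)[OF E d(3)] by simp
        qed
        then have "\<forall>y\<in>M. \<phi> y - \<psi> y = 0" using div E0 by (auto simp: ops_zero_or_inj_def)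
        then show ?thesis using d by (auto simp: restrict_def)
      qed
      define orb where "orb x = (\<lambda>a. a x) ` R" for x :: 'a
      have orbinj: "inj_on (\<lambda>a. a x) R" if "x \<in> M" "x \<noteq> 0" for x using diff that by (auto intro: inj_onI)
      have orbg: "subgrp (orb x)" if "x \<in> M" for x
      proof -
        have o: "orb x = (\<lambda>\<phi>. \<phi> x) ` E" using that by (auto simp: orb_def R_def image_image)
        have "0 \<in> orb x" unfolding o using op_rngD(9)[OF E] by (rule rev_image_eqI) simp
        moreover have "\<phi> x + \<psi> x \<in> orb x" "\<phi> x - \<psi> x \<in> orb x" if "\<phi> \<in> E" "\<psi> \<in> E" for \<phi> \<psi>
          unfolding o using op_rngD(6,7)[OF E that] by (auto intro: rev_image_eqI)
        ultimately show ?thesis by (auto simp: subgrp_def o)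
      qed
      have \<phi>0inj: "inj_on \<phi>0 M" using injE nz by blast
      have "\<phi>0 ` M = M" using endo_inj_surj[OF M(1) _ \<phi>0inj] op_rngD(5)[OF E nz(1)] by blast
      then obtain x where x: "x \<in> M" "m = \<phi>0 x" using m by blast
      show ?thesis
      proof (cases "m = 0")
        case False
        then have "x \<noteq> 0" using x op_rngD(3)[OF E nz(1)] by auto
        have "orb m \<subseteq> orb x"
        proof
          fix y assume "y \<in> orb m"
          then obtain \<phi> where \<phi>: "\<phi> \<in> E" "y = \<phi> (\<phi>0 x)" using x m by (auto simp: orb_def R_def)
          then have "restrict (\<phi> \<circ> \<phi>0) M \<in> R" using op_rngD(8)[OF E _ nz(1)] by (auto simp: R_def)
          moreover have "restrict (\<phi> \<circ> \<phi>0) M x = y" using x \<phi> by simp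
          ultimately show "y \<in> orb x" unfolding orb_def by blast
        qed
        moreover have "card (orb m) = card R" "card (orb x) = card R"
          using card_image[OF orbinj] m x False \<open>x \<noteq> 0\<close> by (auto simp: orb_def)
        ultimately have "orb m = orb x" using fin(1) by (intro card_subset_eq) (auto simp: orb_def)
        moreover have "m \<in> orb x" unfolding orb_def
          by (rule image_eqI[of _ _ "restrict \<phi>0 M"]) (use x nz in \<open>auto simp: R_def\<close>)
        ultimately have mo: "m \<in> orb m" by simp
        have "(\<Sum>a\<in>R. m) = (\<Sum>y\<in>orb m. m)"
          unfolding orb_def by (rule sum.reindex_cong[OF orbinj, symmetric]) (use m False in auto)
        also have "\<dots> = 0"
          by (rule finite_subgrp_sum_const[OF _ orbg[OF m] mo]) (use fin in \<open>simp add: orb_def\<close>)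
        finally show ?thesis .
      qed simp
    qed
    define z where "z = restrict (\<lambda>x. 0::'a) M"
    have RG: "R = insert z G" "z \<notin> G"
    proof -
      have zR: "z \<in> R" using op_rngD(9)[OF E] by (auto simp: R_def z_def)
      have "a = z" if "a \<in> R" "a \<notin> G" for a
        using that by (auto simp: G_def R_def z_def restrict_def)
      then show "R = insert z G" using zR GR by blast
      show "z \<notin> G" by (simp add: G_def z_def)
    qed
    have "splitting_pair M L (avg \<sigma>) (avg \<tau>)" unfolding splitting_pair_def
    proof (intro conjI ballI)
      show "avg \<sigma> ` M \<subseteq> M" "avg \<tau> ` M \<subseteq> M" "additive_on M (avg \<sigma>)" "additive_on M (avg \<tau>)"
        using avg[OF s(1,3) comm(1)] avg[OF s(2,4) comm(2)] by blast+
      fix v assume v: "v \<in> L"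
      obtain x y where xy: "v = (x, y)" by (cases v)
      then have xyM: "x \<in> M" "y \<in> M" using v L(2) by auto
      have "iv a (\<sigma> (a x)) + iv a (\<tau> (a y)) = 0" if a: "a \<in> G" for a
      proof -
        have aR: "a \<in> R" using a GR by blast
        have "\<sigma> (a x) \<in> M" "\<tau> (a y) \<in> M" using RM[OF aR] xyM s by blast+
        then have "iv a (\<sigma> (a x)) + iv a (\<tau> (a y)) = iv a (\<sigma> (a x) + \<tau> (a y))" using ivadd[OF a] by simp
        also have "\<sigma> (a x) + \<tau> (a y) = 0" using s(5) RL[OF aR] v xy by blast
        finally show ?thesis using iv0[OF a] by simp
      qed
      then have "(\<Sum>a\<in>G. iv a (\<sigma> (a x))) + (\<Sum>a\<in>G. iv a (\<tau> (a y))) = 0"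
        by (simp add: sum.distrib[symmetric])
      then have "avg \<sigma> x + avg \<tau> y = 0" by (simp add: avg_def add.commute add_eq_0_iff)
      then show "case v of (a, b) \<Rightarrow> avg \<sigma> a + avg \<tau> b = 0" by (simp add: xy)
    next
      fix m assume m: "m \<in> M"
      define L1 where "L1 = {m. (m, 0) \<in> L}"
      have L1: "subgrp L1" "L1 \<subseteq> M"
        using subgrp_slice[OF L(1)] L(2) by (auto simp: L1_def)
      have "iv a (\<sigma> (a m)) - m \<in> L1" if a: "a \<in> G" for a
      proof -
        have aR: "a \<in> R" using a GR by blast
        have am: "a m \<in> M" using RM[OF aR m] .
        define l where "l = \<sigma> (a m) - a m"
        have l: "l \<in> L1" using s(6)[OF am] by (simp add: l_def L1_def)
        have "a ` L1 \<subseteq> L1"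
        proof
          fix y assume "y \<in> a ` L1"
          then obtain x where "(x, 0) \<in> L" "y = a x" by (auto simp: L1_def)
          moreover have "a 0 = 0" using Radd[OF aR M0 M0] by simp
          ultimately show "y \<in> L1" using RL[OF aR, of x 0] by (simp add: L1_def)
        qed
        then have "a ` L1 = L1"
          using endo_inj_surj[of L1 a] finite_subset[OF L1(2) M(1)] inj_on_subset[OF Ginj[OF a] L1(2)] by blast
        then obtain x where x: "x \<in> L1" "a x = l" using l by (metis imageE)
        have "iv a (\<sigma> (a m)) = m + x"
          by (rule ivI[OF a]) (use x m L1(2) subgrpD(2)[OF M(2)] Radd[OF aR m, of x] in \<open>auto simp: l_def\<close>)
        then show ?thesis using x by simp
      qed
      then have "(\<Sum>a\<in>G. iv a (\<sigma> (a m)) - m) \<in> L1" by (intro subgrpD(5)[OF L1(1)])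
      then have "- (\<Sum>a\<in>G. iv a (\<sigma> (a m)) - m) \<in> L1" by (rule subgrpD(4)[OF L1(1)])
      moreover have "(\<Sum>a\<in>G. m) = - m"
        using card0[OF m] RG fin(2) by (simp add: eq_neg_iff_add_eq_0 add.commute)
      then have "- (\<Sum>a\<in>G. iv a (\<sigma> (a m)) - m) = avg \<sigma> m - m" by (simp add: avg_def sum_subtractf)
      ultimately have "avg \<sigma> m - m \<in> L1" by simp
      then show "(avg \<sigma> m - m, 0) \<in> L" by (simp add: L1_def)
    qed
    then show thesis using that avg(3,4)[OF s(1,3) comm(1)] avg(3,4)[OF s(2,4) comm(2)]
      by (simp add: commute_on_Un)
  qed
qed


section \<open>Finite abelian groups\<close>

definition nmul :: "nat \<Rightarrow> 'v::ab_group_add \<Rightarrow> 'v" where "nmul n x = (\<Sum>i<n. x)"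

lemma nmul_simps [simp]: "nmul 0 x = 0" "nmul (Suc n) x = nmul n x + x" "nmul n 0 = 0" "nmul 1 x = x"
  by (simp_all add: nmul_def)

lemma nmul_add: "nmul (m + n) x = nmul m x + nmul n x"
  by (induction n) (simp_all add: algebra_simps)

lemma nmul_mult: "nmul (m * n) x = nmul m (nmul n x)"
  by (induction m) (simp_all add: nmul_add algebra_simps)

lemma nmul_distrib: "nmul n (x + y) = nmul n x + nmul n y" "nmul n (x - y) = nmul n x - nmul n y"
  "nmul n (- x) = - nmul n x"
  by (induction n) (simp_all add: algebra_simps)

lemma nmul_Pair: "nmul n (x, y) = (nmul n x, nmul n y)"
  by (induction n) (simp_all add: zero_prod_def)

lemma nmul_in: "subgrp V \<Longrightarrow> x \<in> V \<Longrightarrow> nmul n x \<in> V"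
  by (induction n) (auto intro: subgrpD)

lemma nmul_additive_on:
  assumes "additive_on V h" "subgrp V" "x \<in> V"
  shows "h (nmul n x) = nmul n (h x)"
  by (induction n) (simp_all add: additive_onD[OF assms(1,2)] assms(3) nmul_in[OF assms(2,3)])

lemma nmul_gcd:
  assumes V: "subgrp V" and m: "nmul m x \<in> V" and n: "nmul n x \<in> V"
  shows "nmul (gcd m n) x \<in> V"
proof (cases "m = 0")
  case False
  then obtain a b where "m * a = n * b + gcd m n" using bezout_nat by blast
  then have "nmul (gcd m n) x = nmul (m * a) x - nmul (n * b) x" by (simp add: nmul_add)
  also have "\<dots> = nmul a (nmul m x) - nmul b (nmul n x)" by (simp add: nmul_mult[symmetric] mult.commute)
  finally show ?thesis using m n V by (auto intro: subgrpD nmul_in)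
qed (use n in simp)

text \<open>Multiplication by \<open>n\<close> is invertible modulo \<open>V\<close> if \<open>V\<close> contains a multiple of \<open>x\<close> coprime to \<open>n\<close>.\<close>

lemma nmul_coprime:
  assumes "subgrp V" "nmul m x \<in> V" "nmul n x \<in> V" "coprime m n"
  shows "x \<in> V"
  using nmul_gcd[OF assms(1-3)] assms(4) by simp

text \<open>In a torsion group negatives are multiples, so that natural numbers suffice as coefficients.\<close>

lemma nmul_inverse:
  assumes "nmul n x = 0" "n \<ge> 1" shows "- nmul k x = nmul (k * (n - 1)) x"
proof -
  have "nmul k x + nmul (k * (n - 1)) x = nmul (k * n) x"
    using assms(2) by (simp add: nmul_add[symmetric]) (simp add: algebra_simps)
  also have "\<dots> = 0" by (simp add: nmul_mult assms(1))
  finally show ?thesis by (simp add: eq_neg_iff_add_eq_0 neg_eq_iff_add_eq_0)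
qed

lemma subgrp_adjoin:
  assumes W: "subgrp W" and n: "nmul n v = 0" "n \<ge> 1"
  shows "subgrp {w + nmul i v | w i. w \<in> W}"
  unfolding subgrp_def
proof (intro conjI ballI)
  let ?S = "{w + nmul i v | w i. w \<in> W}"
  have I: "w + nmul i v \<in> ?S" if "w \<in> W" for w i using that by blast
  show "0 \<in> ?S" using I[OF subgrpD(1)[OF W], of 0] by simp
  fix x y assume "x \<in> ?S" "y \<in> ?S"
  then obtain w i u j where d: "x = w + nmul i v" "y = u + nmul j v" "w \<in> W" "u \<in> W" by blast
  show "x + y \<in> ?S" using I[OF subgrpD(2)[OF W d(3,4)], of "i + j"] d by (simp add: nmul_add algebra_simps)
  obtain k where k: "nmul k v = - nmul j v" using nmul_inverse[OF n, of j] by metis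
  have "x - y = (w - u) + nmul (i + k) v" by (simp add: d nmul_add k)
  then show "x - y \<in> ?S" using I[OF subgrpD(3)[OF W d(3,4)]] by simp
qed

text \<open>A cyclic subgroup of largest order in a finite abelian \<open>p\<close>-group is a direct summand, here with a complement that contains a
prescribed \<open>W0\<close>.  Let \<open>W\<close> be maximal among the subgroups above \<open>W0\<close> that meet \<open>\<langle>a\<rangle>\<close> trivially.  If \<open>W + \<langle>a\<rangle>\<close> were proper, some \<open>v0\<close>
outside would have \<open>p v0 = w + r a\<close>, and since the order of \<open>a\<close> is the exponent of the group, \<open>p\<close> divides \<open>r\<close>.  So \<open>v0\<close> can
be corrected to \<open>v\<close> with \<open>p v \<in> W\<close>, and \<open>W + \<langle>v\<rangle>\<close> contradicts maximality.\<close>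

lemma cyclic_complement:
  fixes V :: "'v::ab_group_add set"
  assumes V: "finite V" "subgrp V" and p: "prime (p::nat)" and exp: "\<And>v. v \<in> V \<Longrightarrow> nmul (p ^ Suc e) v = 0"
    and a: "a \<in> V" "nmul (p ^ e) a \<noteq> 0"
    and W0: "subgrp W0" "W0 \<subseteq> V" and triv: "W0 \<inter> range (\<lambda>i. nmul i a) \<subseteq> {0}"
  obtains \<pi> where "\<And>v. v \<in> V \<Longrightarrow> \<pi> v \<in> range (\<lambda>i. nmul i a)" "additive_on V \<pi>"
    "\<And>w. w \<in> W0 \<Longrightarrow> \<pi> w = 0" "\<And>i. \<pi> (nmul i a) = nmul i a"
proof -
  define K where "K = range (\<lambda>i. nmul i a)"
  have pe: "p ^ Suc e \<ge> 1" using prime_gt_0_nat[OF p] by simp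
  have "subgrp {0 :: 'v}" by (simp add: subgrp_def)
  from subgrp_adjoin[OF this exp[OF a(1)] pe] have K: "subgrp K" by (simp add: K_def full_SetCompr_eq)
  have KV: "K \<subseteq> V" using nmul_in[OF V(2) a(1)] by (auto simp: K_def)
  have PW: "subgrp W0 \<and> W0 \<inter> K \<subseteq> {0}" using W0 triv by (simp add: K_def)
  obtain W where W: "subgrp W \<and> W \<inter> K \<subseteq> {0}" "W0 \<subseteq> W" "W \<subseteq> V"
    and max: "\<And>W'. subgrp W' \<and> W' \<inter> K \<subseteq> {0} \<Longrightarrow> W \<subseteq> W' \<Longrightarrow> W' \<subseteq> V \<Longrightarrow> W' = W"
    by (rule maximal_superset[of V "\<lambda>W. subgrp W \<and> W \<inter> K \<subseteq> {0}", OF V(1) PW W0(2)]) (rule that)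
  have Wg: "subgrp W" and WK: "W \<inter> K \<subseteq> {0}" using W by blast+
  define S where "S = {w + k | w k. w \<in> W \<and> k \<in> K}"
  have S: "subgrp S"
  proof -
    have I: "w + k \<in> S" if "w \<in> W" "k \<in> K" for w k using that by (auto simp: S_def)
    have "x + y \<in> S \<and> x - y \<in> S" if xy: "x \<in> S" "y \<in> S" for x y
    proof -
      obtain w k u l where d: "x = w + k" "y = u + l" "w \<in> W" "u \<in> W" "k \<in> K" "l \<in> K"
        using xy unfolding S_def by blast
      show ?thesis
        using I[OF subgrpD(2)[OF Wg d(3,4)] subgrpD(2)[OF K d(5,6)]]
          I[OF subgrpD(3)[OF Wg d(3,4)] subgrpD(3)[OF K d(5,6)]] d by (simp add: algebra_simps)
    qed
    moreover have "0 \<in> S" using I[OF subgrpD(1)[OF Wg] subgrpD(1)[OF K]] by simp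
    ultimately show ?thesis by (simp add: subgrp_def)
  qed
  have WS: "W \<subseteq> S" and KS: "K \<subseteq> S"
    using subgrpD(1)[OF Wg] subgrpD(1)[OF K] by (force simp: S_def)+
  have "V \<subseteq> S"
  proof (rule ccontr)
    assume "\<not> V \<subseteq> S"
    then obtain u where u: "u \<in> V" "u \<notin> S" by blast
    have ex: "nmul (p ^ Suc e) u \<in> S" using exp[OF u(1)] subgrpD(1)[OF S] by simp
    define n where "n = (LEAST n. nmul (p ^ n) u \<in> S)"
    have n: "nmul (p ^ n) u \<in> S" unfolding n_def using ex by (rule LeastI)
    then have "n \<noteq> 0" using u by (metis nmul_simps(4) power_0)
    then obtain n' where n': "n = Suc n'" using not0_implies_Suc by blast
    then have "nmul (p ^ n') u \<notin> S" using not_less_Least[of n' "\<lambda>n. nmul (p ^ n) u \<in> S"] by (simp add: n_def)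
    then obtain v0 where v0: "v0 \<in> V" "v0 \<notin> S" "nmul p v0 \<in> S"
      using n n' nmul_in[OF V(2) u(1)] by (metis nmul_mult power_Suc)
    obtain w r where wr: "w \<in> W" "nmul p v0 = w + nmul r a" using v0(3) unfolding S_def K_def by blast
    have "nmul (p ^ e) (nmul p v0) = 0" using exp[OF v0(1)] by (simp add: nmul_mult[symmetric] mult.commute)
    then have "nmul (p ^ e) w + nmul (p ^ e * r) a = 0" by (simp add: wr nmul_distrib nmul_mult)
    then have "nmul (p ^ e * r) a = - nmul (p ^ e) w" by (simp add: eq_neg_iff_add_eq_0 add.commute)
    then have "nmul (p ^ e * r) a \<in> W" using subgrpD(4)[OF Wg nmul_in[OF Wg wr(1)]] by simp
    moreover have "nmul (p ^ e * r) a \<in> K" by (simp add: K_def)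
    ultimately have z: "nmul (p ^ e * r) a = 0" using W by blast
    have "p dvd r"
    proof (rule ccontr)
      assume "\<not> p dvd r"
      then have "coprime r p" using p by (metis coprime_commute prime_imp_coprime)
      moreover have "nmul r (nmul (p ^ e) a) \<in> {0}" using z by (simp add: nmul_mult[symmetric] mult.commute)
      moreover have "nmul p (nmul (p ^ e) a) \<in> {0}" using exp[OF a(1)] by (simp add: nmul_mult[symmetric])
      ultimately show False using nmul_coprime[OF \<open>subgrp {0}\<close>] a(2) by blast
    qed
    then obtain s where s: "r = p * s" by (auto elim: dvdE)
    define v where "v = v0 - nmul s a"
    have sK: "nmul s a \<in> K" by (simp add: K_def)
    have pv: "nmul p v \<in> W" using wr by (simp add: v_def nmul_distrib s nmul_mult)
    have vV: "v \<in> V" using subgrpD(3)[OF V(2) v0(1)] sK KV by (auto simp: v_def)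
    have vS: "v \<notin> S"
    proof
      assume "v \<in> S"
      then have "v + nmul s a \<in> S" using subgrpD(2)[OF S] sK KS by blast
      then show False using v0 by (simp add: v_def)
    qed
    define W' where "W' = {w + nmul i v | w i. w \<in> W}"
    have "subgrp W'" unfolding W'_def by (rule subgrp_adjoin[OF Wg exp[OF vV] pe])
    moreover have "W' \<inter> K \<subseteq> {0}"
    proof
      fix x assume x: "x \<in> W' \<inter> K"
      then obtain w i where d: "x = w + nmul i v" "w \<in> W" by (auto simp: W'_def)
      have "nmul i v = x - w" using d by simp
      also have "\<dots> \<in> S" using subgrpD(3)[OF S] x d KS WS by blast
      finally have iv: "nmul i v \<in> S" .
      have "p dvd i"
      proof (rule ccontr)
        assume "\<not> p dvd i"
        then have "coprime i p" using p by (metis coprime_commute prime_imp_coprime)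
        moreover have "nmul p v \<in> S" using pv WS by blast
        ultimately show False using nmul_coprime[OF S iv] vS by blast
      qed
      then obtain j where "i = j * p" by (metis dvdE mult.commute)
      then have "nmul i v \<in> W" using nmul_in[OF Wg pv] by (simp add: nmul_mult)
      then have "x \<in> W" using subgrpD(2)[OF Wg d(2)] d by simp
      then show "x \<in> {0}" using x W by blast
    qed
    moreover have "W \<subseteq> W'"
    proof
      fix w assume "w \<in> W"
      then have "w + nmul 0 v \<in> W'" unfolding W'_def by blast
      then show "w \<in> W'" by simp
    qed
    moreover have "W' \<subseteq> V" using W(3) nmul_in[OF V(2) vV] subgrpD(2)[OF V(2)] by (auto simp: W'_def)
    ultimately have "W' = W" using max by blast
    moreover have "0 + nmul 1 v \<in> W'" unfolding W'_def using subgrpD(1)[OF Wg] by blast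
    ultimately show False using vS WS by auto
  qed
  then have gen: "\<exists>w\<in>W. \<exists>k\<in>K. v = w + k" if "v \<in> V" for v using that unfolding S_def by blast
  obtain \<pi> where \<pi>: "\<And>v. v \<in> V \<Longrightarrow> \<pi> v \<in> K" "\<And>v. v \<in> V \<Longrightarrow> v - \<pi> v \<in> W"
    "additive_on V \<pi>" "\<And>w. w \<in> W \<Longrightarrow> \<pi> w = 0" "\<And>k. k \<in> K \<Longrightarrow> \<pi> k = k"
    "\<And>v k. v \<in> V \<Longrightarrow> k \<in> K \<Longrightarrow> v - k \<in> W \<Longrightarrow> \<pi> v = k"
    by (rule projection_along[OF Wg W(3) K KV V(2) WK gen]) (assumption, rule that)
  show thesis using that[of \<pi>] \<pi>(1,3,4,5) W(2) unfolding K_def by blast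
qed

lemma subgrp_Times: "subgrp A \<Longrightarrow> subgrp B \<Longrightarrow> subgrp (A \<times> B)"
  by (auto simp: subgrp_def zero_prod_def)

text \<open>A homomorphism into a cyclic group of order \<open>p\<^bsup>e + 1\<^esup>\<close>, the exponent of the \<open>p\<close>-part \<open>M'\<close> of \<open>M\<close>, extends from
subgroups of \<open>M' \<times> M'\<close>.  Up to sign, the extension is the projection to \<open>\<langle>a\<rangle>\<close> along a complement which contains the graph of the map to be
extended, namely the one that kills \<open>L\<close> and sends \<open>(h, 0)\<close> to \<open>b\<close>, where \<open>h\<close> is a multiple of \<open>f\<close> of
order \<open>p\<close> modulo \<open>L\<close> and \<open>b\<close> is an element of order \<open>p\<close> in \<open>\<langle>a\<rangle>\<close>.\<close>

lemma abelian_separation: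
  fixes M :: "'v::ab_group_add set"
  assumes M: "finite M" "subgrp M" and L: "subgrp L" "L \<subseteq> M \<times> M" and f: "f \<in> M" "(f, 0) \<notin> L"
  obtains \<sigma> \<tau> where "\<sigma> ` M \<subseteq> M" "\<tau> ` M \<subseteq> M" "additive_on M \<sigma>" "additive_on M \<tau>"
    "\<And>a b. (a, b) \<in> L \<Longrightarrow> \<sigma> a + \<tau> b = 0" "\<sigma> f \<noteq> 0"
proof -
  note M0 = subgrpD(1)[OF M(2)]
  define N where "N = card M"
  have N: "nmul N x = 0" if "x \<in> M" for x
  proof -
    obtain h where h: "bij_betw h {..<card M} M" using ex_bij_betw_nat_finite[OF M(1)] by (auto simp: lessThan_atLeast0)
    show ?thesis using finite_subgrp_sum_const[OF M that] sum.reindex_bij_betw[OF h, of "\<lambda>_. x"]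
      by (simp add: nmul_def N_def)
  qed
  have N1: "N \<ge> 1" using M M0 by (auto simp: N_def Suc_le_eq card_gt_0_iff)
  \<comment> \<open>the least \<open>k\<close> is the order of \<open>f\<close> modulo \<open>L\<close>; a prime factor \<open>p\<close> of it leads to the multiple \<open>g\<close> of order \<open>p\<close>\<close>
  define Q where "Q k \<longleftrightarrow> k \<ge> 1 \<and> (nmul k f, 0) \<in> L" for k
  have "Q N" using N[OF f(1)] N1 subgrpD(1)[OF L(1)] by (simp add: Q_def zero_prod_def)
  then have Qk: "Q (Least Q)" "\<And>j. j < Least Q \<Longrightarrow> \<not> Q j" by (auto intro: LeastI dest: not_less_Least)
  define k where "k = Least Q"
  have "k \<noteq> 1" using Qk(1) f(2) by (auto simp: k_def Q_def)
  then obtain p where p: "prime p" "p dvd k" using prime_factor_nat by blast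
  define j where "j = k div p"
  have kj: "k = p * j" using p by (simp add: j_def)
  have "k \<ge> 1" using Qk(1) by (simp add: k_def Q_def)
  then have j1: "1 \<le> j" "j < k" using kj prime_gt_1_nat[OF p(1)] by (auto intro: Suc_leI)
  define g where "g = nmul j f"
  have gL: "(g, 0) \<notin> L" using Qk(2)[of j] j1 by (auto simp: Q_def k_def g_def)
  have pgL: "nmul p (g, 0) \<in> L" using Qk(1) kj by (simp add: Q_def k_def g_def nmul_Pair nmul_mult)
  have gM: "g \<in> M" using nmul_in[OF M(2) f(1)] by (simp add: g_def)
  obtain c m' where m': "N = p ^ c * m'" "\<not> p dvd m'"
    using multiplicity_decompose'[of N p] N1 p(1) by (metis not_one_le_zero not_prime_unit)
  have cop: "coprime m' p" using m'(2) p(1) by (metis coprime_commute prime_imp_coprime)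
  \<comment> \<open>multiplication by the \<open>p\<close>-free part \<open>m'\<close> of the order of \<open>M\<close> maps to the \<open>p\<close>-part\<close>
  define M' where "M' = nmul m' ` M"
  have M'M: "M' \<subseteq> M" using nmul_in[OF M(2)] by (auto simp: M'_def)
  have M': "finite M'" "subgrp M'"
  proof -
    show "finite M'" using M by (simp add: M'_def)
    have "nmul m' 0 \<in> M'" unfolding M'_def using M0 by (rule imageI)
    then show "subgrp M'" using subgrpD(2,3)[OF M(2)]
      by (auto simp: subgrp_def M'_def nmul_distrib[symmetric])
  qed
  define h where "h = nmul m' g"
  have hM': "h \<in> M'" using gM by (simp add: h_def M'_def)
  have hL: "(h, 0) \<notin> L"
  proof
    assume "(h, 0) \<in> L"
    then have "nmul m' (g, 0) \<in> L" by (simp add: h_def nmul_Pair)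
    then show False using nmul_coprime[OF L(1) _ pgL cop] gL by blast
  qed
  have phL: "(nmul p h, 0) \<in> L"
    using nmul_in[OF L(1) pgL, of m'] by (simp add: nmul_Pair h_def nmul_mult[symmetric] mult.commute)
  have "\<forall>x\<in>M'. nmul (p ^ c) x = 0" using N m' by (auto simp: M'_def nmul_mult[symmetric])
  then have "\<exists>c. \<forall>x\<in>M'. nmul (p ^ c) x = 0" by blast
  define d where "d = (LEAST c. \<forall>x\<in>M'. nmul (p ^ c) x = 0)"
  have d: "\<forall>x\<in>M'. nmul (p ^ d) x = 0" unfolding d_def by (rule LeastI_ex) fact
  have "d \<noteq> 0"
  proof
    assume "d = 0"
    then have "h = 0" using d hM' by (metis nmul_simps(4) power_0)
    then show False using hL subgrpD(1)[OF L(1)] by (simp add: zero_prod_def)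
  qed
  then obtain e where e: "d = Suc e" using not0_implies_Suc by blast
  obtain a where a: "a \<in> M'" "nmul (p ^ e) a \<noteq> 0"
    using not_less_Least[of e "\<lambda>c. \<forall>x\<in>M'. nmul (p ^ c) x = 0"] e by (auto simp: d_def)
  define b where "b = nmul (p ^ e) a"
  have pb: "nmul p b = 0" using d a(1) e by (simp add: b_def nmul_mult[symmetric])
  define V where "V = (M' \<times> M') \<times> M'"
  have V: "finite V" "subgrp V" using M' by (simp_all add: V_def subgrp_Times)
  define L' where "L' = (L \<inter> (M' \<times> M')) \<times> {0::'v}"
  have L': "subgrp L'"
    using L(1) subgrp_Times[OF M'(2) M'(2)] unfolding L'_def by (intro subgrp_Times) (auto simp: subgrp_def)
  have M'0: "0 \<in> M'" using subgrpD(1)[OF M'(2)] .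
  have bM': "b \<in> M'" using nmul_in[OF M'(2) a(1)] by (simp add: b_def)
  have vV: "((h, 0), b) \<in> V" using hM' bM' M'0 by (simp add: V_def)
  have exp: "nmul (p ^ Suc e) v = 0" if "v \<in> V" for v
    using that d e by (auto simp: V_def nmul_Pair zero_prod_def)
  have pe: "p ^ Suc e \<ge> 1" using prime_gt_0_nat[OF p(1)] by simp
  \<comment> \<open>the third coordinate is the target of the map whose graph is \<open>W\<close>\<close>
  define W where "W = {w + nmul i ((h, 0), b) | w i. w \<in> L'}"
  have W: "subgrp W" unfolding W_def by (rule subgrp_adjoin[OF L' exp[OF vV] pe])
  have L'W: "w \<in> W" if "w \<in> L'" for w
  proof -
    have "w + nmul 0 ((h, 0), b) \<in> W" unfolding W_def using that by blast
    then show ?thesis by simp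
  qed
  have vW: "((h, 0), b) \<in> W"
  proof -
    have "0 + nmul 1 ((h, 0), b) \<in> W" unfolding W_def using subgrpD(1)[OF L'] by blast
    then show ?thesis by simp
  qed
  have WV: "W \<subseteq> V"
  proof
    fix x assume "x \<in> W"
    then obtain w i where x: "x = w + nmul i ((h, 0), b)" "w \<in> L'" unfolding W_def by blast
    moreover have "w \<in> V" using x(2) M'0 by (auto simp: L'_def V_def)
    ultimately show "x \<in> V" using subgrpD(2)[OF V(2)] nmul_in[OF V(2) vV] by blast
  qed
  define A where "A = ((0 :: 'v, 0 :: 'v), a)"
  have nA: "nmul i A = ((0, 0), nmul i a)" for i by (simp add: A_def nmul_Pair)
  have AV: "A \<in> V" "nmul (p ^ e) A \<noteq> 0" using a M'0 by (auto simp: nA zero_prod_def V_def) (simp add: A_def)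
  have triv: "W \<inter> range (\<lambda>i. nmul i A) \<subseteq> {0}"
  proof
    fix x assume x: "x \<in> W \<inter> range (\<lambda>i. nmul i A)"
    then obtain w i k where d': "x = w + nmul i ((h, 0), b)" "w \<in> L'" "x = nmul k A" unfolding W_def by blast
    obtain l where l: "w = (l, 0)" "l \<in> L" using d'(2) by (auto simp: L'_def)
    have "l + nmul i (h, 0) = 0" using d' l by (simp add: nA nmul_Pair zero_prod_def)
    then have "nmul i (h, 0) = - l" by (simp add: eq_neg_iff_add_eq_0 add.commute)
    then have ih: "nmul i (h, 0) \<in> L" using subgrpD(4)[OF L(1) l(2)] by simp
    have "p dvd i"
    proof (rule ccontr)
      assume "\<not> p dvd i"
      then have "coprime i p" using p(1) by (metis coprime_commute prime_imp_coprime)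
      moreover have "nmul p (h, 0) \<in> L" using phL by (simp add: nmul_Pair)
      ultimately show False using nmul_coprime[OF L(1) ih] hL by blast
    qed
    then obtain t where "i = t * p" by (metis dvdE mult.commute)
    then have "nmul i b = 0" using pb by (simp add: nmul_mult)
    then have "snd x = 0" using d'(1) l by (simp add: nmul_Pair)
    then show "x \<in> {0}" using d'(3) by (simp add: nA zero_prod_def)
  qed
  obtain \<pi> where \<pi>: "\<And>v. v \<in> V \<Longrightarrow> \<pi> v \<in> range (\<lambda>i. nmul i A)" "additive_on V \<pi>"
    "\<And>w. w \<in> W \<Longrightarrow> \<pi> w = 0" "\<And>i. \<pi> (nmul i A) = nmul i A"
    by (rule cyclic_complement[OF V p(1) exp AV W WV triv]) (assumption, rule that)
  note \<pi>a = additive_onD[OF \<pi>(2) V(2)]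
  define \<sigma> where "\<sigma> x = snd (\<pi> ((nmul m' x, 0), 0))" for x
  define \<tau> where "\<tau> x = snd (\<pi> ((0, nmul m' x), 0))" for x
  have inV: "((nmul m' x, nmul m' y), 0) \<in> V" if "x \<in> M" "y \<in> M" for x y
    using that M'0 by (auto simp: V_def M'_def)
  have inV0: "((nmul m' x, 0), 0) \<in> V" "((0, nmul m' x), 0) \<in> V" if "x \<in> M" for x
    using that M'0 by (auto simp: V_def M'_def)
  have rM: "snd v \<in> M" if "v \<in> range (\<lambda>i. nmul i A)" for v
    using that nmul_in[OF M'(2) a(1)] M'M by (auto simp: nA)
  have sM: "\<sigma> ` M \<subseteq> M" "\<tau> ` M \<subseteq> M" using rM[OF \<pi>(1)[OF inV0(1)]] rM[OF \<pi>(1)[OF inV0(2)]] unfolding \<sigma>_def \<tau>_def by blast+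
  have sadd: "additive_on M \<sigma>" "additive_on M \<tau>"
    unfolding additive_on_def
  proof (safe)
    fix x y assume xy: "x \<in> M" "y \<in> M"
    show "\<sigma> (x + y) = \<sigma> x + \<sigma> y" "\<tau> (x + y) = \<tau> x + \<tau> y"
      using \<pi>a(1)[OF inV0(1)[OF xy(1)] inV0(1)[OF xy(2)]] \<pi>a(1)[OF inV0(2)[OF xy(1)] inV0(2)[OF xy(2)]]
      by (simp_all add: \<sigma>_def \<tau>_def nmul_distrib)
  qed
  have kill: "\<sigma> x + \<tau> y = 0" if xy: "(x, y) \<in> L" for x y
  proof -
    have m: "x \<in> M" "y \<in> M" using xy L(2) by auto
    have "(nmul m' x, nmul m' y) \<in> L" using nmul_in[OF L(1) xy, of m'] by (simp add: nmul_Pair)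
    then have "((nmul m' x, nmul m' y), 0) \<in> L'" using m by (simp add: L'_def M'_def)
    then have "\<pi> ((nmul m' x, nmul m' y), 0) = 0" using \<pi>(3) L'W by blast
    moreover have "\<pi> ((nmul m' x, nmul m' y), 0) = \<pi> ((nmul m' x, 0), 0) + \<pi> ((0, nmul m' y), 0)"
      using \<pi>a(1)[OF inV0(1)[OF m(1)] inV0(2)[OF m(2)]] by simp
    ultimately have "snd (\<pi> ((nmul m' x, 0), 0) + \<pi> ((0, nmul m' y), 0)) = 0" by simp
    then show ?thesis by (simp add: \<sigma>_def \<tau>_def)
  qed
  have "\<sigma> g \<noteq> 0"
  proof
    assume "\<sigma> g = 0"
    then have s0: "snd (\<pi> ((h, 0), 0)) = 0" by (simp add: \<sigma>_def h_def)
    have "((h, 0), 0) \<in> V" "nmul (p ^ e) A \<in> V" using hM' M'0 nmul_in[OF V(2) AV(1)] by (auto simp: V_def)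
    then have "\<pi> (((h, 0), 0) + nmul (p ^ e) A) = \<pi> ((h, 0), 0) + nmul (p ^ e) A"
      using \<pi>a(1) \<pi>(4) by simp
    moreover have "((h, 0), 0) + nmul (p ^ e) A = ((h, 0), b)" by (simp add: nA b_def)
    ultimately have "\<pi> ((h, 0), 0) + nmul (p ^ e) A = 0" using \<pi>(3)[OF vW] by simp
    then have "snd (\<pi> ((h, 0), 0) + nmul (p ^ e) A) = 0" by simp
    then show False using s0 a(2) by (simp add: nA)
  qed
  moreover have "\<sigma> g = nmul j (\<sigma> f)" unfolding g_def by (rule nmul_additive_on[OF sadd(1) M(2) f(1)])
  ultimately have "\<sigma> f \<noteq> 0" by auto
  then show thesis using that sM sadd kill by blast
qed


section \<open>Finite bimodules\<close>

text \<open>If one of the two rings acts nontrivially, a splitting that is linear over it is averaged over the other.  If both act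
trivially, every additive map into \<open>M\<close> is linear.\<close>

lemma two_sided_separation:
  assumes M: "finite M" "subgrp M"
    and E: "op_rng E1 M" "op_rng E2 M" "ops_zero_or_inj E1 M" "ops_zero_or_inj E2 M"
    and comm: "\<And>\<phi> \<psi> m. \<phi> \<in> E1 \<Longrightarrow> \<psi> \<in> E2 \<Longrightarrow> m \<in> M \<Longrightarrow> \<phi> (\<psi> m) = \<psi> (\<phi> m)"
    and L: "subgrp L" "L \<subseteq> M \<times> M" "\<And>\<phi> a b. \<phi> \<in> E1 \<union> E2 \<Longrightarrow> (a, b) \<in> L \<Longrightarrow> (\<phi> a, \<phi> b) \<in> L"
    and f: "f \<in> M" "(f, 0) \<notin> L"
  obtains \<sigma> \<tau> where "\<sigma> ` M \<subseteq> M" "\<tau> ` M \<subseteq> M" "additive_on M \<sigma>" "additive_on M \<tau>"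
    "\<And>a b. (a, b) \<in> L \<Longrightarrow> \<sigma> a + \<tau> b = 0" "\<sigma> f \<noteq> 0"
    "commute_on M (E1 \<union> E2) \<sigma>" "commute_on M (E1 \<union> E2) \<tau>"
proof -
  note main = that
  \<comment> \<open>\<open>E\<close> is a side that acts nontrivially, \<open>E'\<close> the other one\<close>
  have key: "\<exists>\<sigma> \<tau>. splitting_pair M L \<sigma> \<tau> \<and> commute_on M (E \<union> E') \<sigma> \<and> commute_on M (E \<union> E') \<tau>"
    if E: "op_rng E M" "op_rng E' M" "ops_zero_or_inj E M" "ops_zero_or_inj E' M"
      and comm: "\<And>\<phi> \<psi> m. \<phi> \<in> E' \<Longrightarrow> \<psi> \<in> E \<Longrightarrow> m \<in> M \<Longrightarrow> \<phi> (\<psi> m) = \<psi> (\<phi> m)"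
      and LE: "E \<subseteq> E1 \<union> E2" "E' \<subseteq> E1 \<union> E2"
      and nz: "\<phi>0 \<in> E" "x0 \<in> M" "\<phi>0 x0 \<noteq> 0" for E E' \<phi>0 x0
  proof -
    have L3: "(\<phi> a, \<phi> b) \<in> L" if "\<phi> \<in> E" "(a, b) \<in> L" for \<phi> a b using L(3) that LE by blast
    have L3': "(\<phi> a, \<phi> b) \<in> L" if "\<phi> \<in> E'" "(a, b) \<in> L" for \<phi> a b using L(3) that LE by blast
    obtain \<sigma> \<tau> where st: "splitting_pair M L \<sigma> \<tau>" "commute_on M E \<sigma>" "commute_on M E \<tau>"
      by (rule linear_splitting[OF M E(1,3) nz L(1,2)]) (rule L3, assumption, assumption, rule that)
    obtain \<sigma>' \<tau>' where "splitting_pair M L \<sigma>' \<tau>'" "commute_on M (E' \<union> E) \<sigma>'" "commute_on M (E' \<union> E) \<tau>'"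
      by (rule averaged_splitting[OF M E(2,4) L(1,2) _ st(1) _ _ _ st(2,3)])
        (rule L3', assumption, assumption, rule op_rngD(10)[OF E(1)], assumption,
          rule op_rngD(5)[OF E(1)], assumption, assumption, rule comm, assumption, assumption,
          assumption, rule that)
    then show ?thesis by (metis Un_commute)
  qed
  have fin: thesis if "splitting_pair M L \<sigma> \<tau>" "commute_on M (E1 \<union> E2) \<sigma>" "commute_on M (E1 \<union> E2) \<tau>" for \<sigma> \<tau>
  proof -
    have s: "\<sigma> ` M \<subseteq> M" "\<tau> ` M \<subseteq> M" "additive_on M \<sigma>" "additive_on M \<tau>"
      "\<And>a b. (a, b) \<in> L \<Longrightarrow> \<sigma> a + \<tau> b = 0" "(\<sigma> f - f, 0) \<in> L"
      using that(1) f(1) by (auto simp: splitting_pair_def)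
    have "\<sigma> f \<noteq> 0"
    proof
      assume "\<sigma> f = 0"
      then have "- (- f, 0) \<in> L" using s(6) by (intro subgrpD(4)[OF L(1)]) simp
      then show False using f(2) by simp
    qed
    show thesis by (rule main[OF s(1-4) _ \<open>\<sigma> f \<noteq> 0\<close> that(2,3)]) (rule s(5), assumption)
  qed
  consider "\<exists>\<phi>\<in>E1. \<exists>x\<in>M. \<phi> x \<noteq> 0" | "\<exists>\<phi>\<in>E2. \<exists>x\<in>M. \<phi> x \<noteq> 0"
    | "\<forall>\<phi>\<in>E1 \<union> E2. \<forall>x\<in>M. \<phi> x = 0" by blast
  then show thesis
  proof cases
    case 1
    then show thesis using key[OF E] comm fin by (metis Un_upper1 Un_upper2)
  next
    case 2
    then show thesis using key[OF E(2,1,4,3)] comm fin by (metis Un_upper1 Un_upper2 Un_commute)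
  next
    case 3
    obtain \<sigma> \<tau> where s: "\<sigma> ` M \<subseteq> M" "\<tau> ` M \<subseteq> M" "additive_on M \<sigma>" "additive_on M \<tau>"
      "\<And>a b. (a, b) \<in> L \<Longrightarrow> \<sigma> a + \<tau> b = 0" "\<sigma> f \<noteq> 0"
      by (rule abelian_separation[OF M L(1,2) f]) (rule that)
    have cm: "commute_on M (E1 \<union> E2) \<rho>" if "\<rho> ` M \<subseteq> M" "additive_on M \<rho>" for \<rho>
      unfolding commute_on_def
    proof (intro ballI)
      fix \<phi> m assume "\<phi> \<in> E1 \<union> E2" "m \<in> M"
      moreover have "\<rho> m \<in> M" using that \<open>m \<in> M\<close> by blast
      ultimately have "\<phi> m = 0" "\<phi> (\<rho> m) = 0" using 3 by blast+
      then show "\<rho> (\<phi> m) = \<phi> (\<rho> m)" using additive_onD(2)[OF that(2) M(2)] by simp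
    qed
    show thesis by (rule main[OF s(1-4) _ s(6) cm[OF s(1,3)] cm[OF s(2,4)]]) (rule s(5), assumption)
  qed
qed

text \<open>If \<open>s\<^sup>2\<close> kills \<open>m\<close>, then so does the idempotent power \<open>g\<close> of \<open>s\<close>, and \<open>s\<close> acts on \<open>m\<close> like its nilpotent part
\<open>t = s - s * g\<close>.  But \<open>t\<close> and \<open>m\<close> square to zero and their product lies in the null ideal \<open>M\<close>, so the product
is zero.\<close>

lemma reduced_action:
  fixes s :: "'u::ring"
  assumes S: "finite S" "subrng S" "self_annihilating_products_vanish S"
    and M: "M \<subseteq> S" "\<And>m m'. m \<in> M \<Longrightarrow> m' \<in> M \<Longrightarrow> m * m' = 0" and s: "s \<in> S" and m: "m \<in> M"
  shows "s * m \<in> M \<Longrightarrow> s * (s * m) = 0 \<Longrightarrow> s * m = 0" "m * s \<in> M \<Longrightarrow> m * s * s = 0 \<Longrightarrow> m * s = 0"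
proof -
  obtain n where n: "pow1 s n * pow1 s n = pow1 s n" using idempotent_power[OF S(1,2) s] by blast
  define g where "g = pow1 s n"
  have gg: "g * g = g" using n by (simp add: g_def)
  have comm: "g * pow1 s k = pow1 s k * g" for k by (simp add: g_def pow1_add add.commute)
  define t where "t = s - s * g"
  have "pow1 t k = pow1 s k - pow1 s k * g" for k
  proof (induction k)
    case (Suc k)
    have "s * g * pow1 s k = s * (pow1 s k * g)" using comm by (simp add: mult.assoc)
    moreover have "s * g * (pow1 s k * g) = s * (pow1 s k * g)"
      using comm[of k] gg by (metis mult.assoc)
    ultimately have "t * (pow1 s k - pow1 s k * g) = s * pow1 s k - s * pow1 s k * g"
      by (simp add: t_def left_diff_distrib right_diff_distrib mult.assoc)
    then show ?case using Suc by simp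
  qed (simp add: t_def)
  then have "pow1 t n = 0" using gg by (simp add: g_def)
  moreover have tS: "t \<in> S" using pow1_in[OF S(2) s] s by (auto simp: t_def g_def intro!: subrngD(3,4)[OF S(2)])
  ultimately have tt: "t * t = 0" using nilpotent_square_zero S by blast
  have mm: "m * m = 0" and mS: "m \<in> S" using M m by auto
  have gs: "g * s = s * g" using comm[of 0] by simp
  show "s * m = 0" if sm: "s * m \<in> M" and z: "s * (s * m) = 0"
  proof -
    have "pow1 s (Suc k) * m = 0" for k by (induction k) (use z in \<open>simp_all add: mult.assoc\<close>)
    then have "s * (g * m) = 0" by (simp add: g_def mult.assoc[symmetric] flip: pow1.simps(2))
    then have "t * m = s * m" by (simp add: t_def left_diff_distrib mult.assoc)
    then show ?thesis using square_zero_product_zero[OF S(2,3) tS mS tt mm] M(2)[OF sm sm] by simp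
  qed
  show "m * s = 0" if sm: "m * s \<in> M" and z: "m * s * s = 0"
  proof -
    have "m * pow1 s (Suc k) = 0" for k
    proof (induction k)
      case (Suc k)
      have "m * pow1 s (Suc (Suc k)) = m * pow1 s (Suc k) * s" using pow1_add[of s "Suc k" 0] by (simp add: mult.assoc)
      then show ?case using Suc by simp
    qed (use z in \<open>simp add: mult.assoc\<close>)
    then have "m * (s * g) = 0" by (simp add: g_def flip: pow1.simps(2))
    then have "m * t = m * s" by (simp add: t_def right_diff_distrib)
    then show ?thesis using square_zero_product_zero[OF S(2,3) mS tS mm tt] M(2)[OF sm sm] by simp
  qed
qed

lemma op_rng_mult:
  fixes S M :: "'u::ring set"
  assumes S: "finite S" "subrng S" and M: "\<And>s m. s \<in> S \<Longrightarrow> m \<in> M \<Longrightarrow> s * m \<in> M \<and> m * s \<in> M"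
  shows "op_rng ((*) ` S) M" "op_rng ((\<lambda>s m. m * s) ` S) M"
proof -
  have ne: "S \<noteq> {}" using subrngD(1)[OF S(2)] by blast
  show "op_rng ((*) ` S) M" unfolding op_rng_def
  proof (intro conjI ballI)
    fix \<phi> \<psi> assume "\<phi> \<in> (*) ` S" "\<psi> \<in> (*) ` S"
    then obtain s t where st: "\<phi> = (*) s" "s \<in> S" "\<psi> = (*) t" "t \<in> S" by blast
    have "(\<lambda>x. \<phi> x + \<psi> x) = (*) (s + t)" "(\<lambda>x. \<phi> x - \<psi> x) = (*) (s - t)" "\<phi> \<circ> \<psi> = (*) (s * t)"
      by (auto simp: st algebra_simps fun_eq_iff)
    then show "(\<lambda>x. \<phi> x + \<psi> x) \<in> (*) ` S" "(\<lambda>x. \<phi> x - \<psi> x) \<in> (*) ` S" "\<phi> \<circ> \<psi> \<in> (*) ` S"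
      using subrngD(2-4)[OF S(2) st(2,4)] by simp_all
  qed (use S ne M in \<open>auto simp: additive_on_def algebra_simps\<close>)
  show "op_rng ((\<lambda>s m. m * s) ` S) M" unfolding op_rng_def
  proof (intro conjI ballI)
    fix \<phi> \<psi> assume "\<phi> \<in> (\<lambda>s m. m * s) ` S" "\<psi> \<in> (\<lambda>s m. m * s) ` S"
    then obtain s t where st: "\<phi> = (\<lambda>m. m * s)" "s \<in> S" "\<psi> = (\<lambda>m. m * t)" "t \<in> S" by blast
    have "(\<lambda>x. \<phi> x + \<psi> x) = (\<lambda>m. m * (s + t))" "(\<lambda>x. \<phi> x - \<psi> x) = (\<lambda>m. m * (s - t))"
      "\<phi> \<circ> \<psi> = (\<lambda>m. m * (t * s))" by (auto simp: st algebra_simps fun_eq_iff)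
    then show "(\<lambda>x. \<phi> x + \<psi> x) \<in> (\<lambda>s m. m * s) ` S" "(\<lambda>x. \<phi> x - \<psi> x) \<in> (\<lambda>s m. m * s) ` S"
      "\<phi> \<circ> \<psi> \<in> (\<lambda>s m. m * s) ` S"
      using subrngD(2-4)[OF S(2) st(2,4)] subrngD(4)[OF S(2) st(4,2)] by (simp_all add: image_iff) blast+
  qed (use S ne M in \<open>auto simp: additive_on_def algebra_simps\<close>)
qed

text \<open>Primitive idempotents for the left action and then for the right action reduce to a direct summand \<open>M1\<close> of \<open>M\<close> on
which all operators are zero or injective.  The projection \<open>\<gamma>\<close> to \<open>M1\<close> is a bimodule map, since it is composed of central
idempotents; so it can be prefixed to the maps found on \<open>M1\<close>.\<close>

lemma bimodule_separation:
  fixes S M :: "'u::ring set"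
  assumes S: "finite S" "subrng S" "self_annihilating_products_vanish S"
    and M: "M \<subseteq> S" "subgrp M" "\<And>s m. s \<in> S \<Longrightarrow> m \<in> M \<Longrightarrow> s * m \<in> M \<and> m * s \<in> M"
    and null: "\<And>m m'. m \<in> M \<Longrightarrow> m' \<in> M \<Longrightarrow> m * m' = 0"
    and L: "subgrp L" "L \<subseteq> M \<times> M"
      "\<And>s a b. s \<in> S \<Longrightarrow> (a, b) \<in> L \<Longrightarrow> (s * a, s * b) \<in> L \<and> (a * s, b * s) \<in> L"
    and f: "f \<in> M" "(f, 0) \<notin> L"
  obtains \<sigma> \<tau> where "\<sigma> ` M \<subseteq> M" "\<tau> ` M \<subseteq> M" "additive_on M \<sigma>" "additive_on M \<tau>"
    "\<And>s m. s \<in> S \<Longrightarrow> m \<in> M \<Longrightarrow> \<sigma> (s * m) = s * \<sigma> m \<and> \<sigma> (m * s) = \<sigma> m * s"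
    "\<And>s m. s \<in> S \<Longrightarrow> m \<in> M \<Longrightarrow> \<tau> (s * m) = s * \<tau> m \<and> \<tau> (m * s) = \<tau> m * s"
    "\<And>a b. (a, b) \<in> L \<Longrightarrow> \<sigma> a + \<tau> b = 0" "\<sigma> f \<noteq> 0"
proof -
  have finM: "finite M" using M(1) S(1) by (rule finite_subset)
  define E1 where "E1 = (*) ` S"
  define E2 where "E2 = (\<lambda>s m. m * s) ` S"
  have E: "op_rng E1 M" "op_rng E2 M" unfolding E1_def E2_def by (rule op_rng_mult[OF S(1,2) M(3)]; assumption)+
  have red1: "\<forall>x\<in>M. \<phi> x = 0" if "\<phi> \<in> E1" "\<forall>x\<in>M. \<phi> (\<phi> x) = 0" for \<phi>
    using that reduced_action(1)[OF S M(1) null] M(3) by (auto simp: E1_def)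
  have red2: "\<forall>x\<in>M. \<phi> x = 0" if "\<phi> \<in> E2" "\<forall>x\<in>M. \<phi> (\<phi> x) = 0" for \<phi>
    using that reduced_action(2)[OF S M(1) null] M(3) by (auto simp: E2_def)
  define L1 where "L1 = {m. (m, 0) \<in> L}"
  have L1: "subgrp L1" unfolding L1_def by (rule subgrp_slice[OF L(1)])
  have fL1: "f \<notin> L1" using f(2) by (simp add: L1_def)
  obtain \<alpha> where \<alpha>: "\<alpha> \<in> E1 \<or> (\<exists>\<phi>\<in>E1. \<alpha> = (\<lambda>x. x - \<phi> x))" "\<alpha> f \<notin> L1"
    "\<And>x. x \<in> M \<Longrightarrow> \<alpha> (\<alpha> x) = \<alpha> x" "\<And>\<phi> x. \<phi> \<in> E1 \<Longrightarrow> x \<in> M \<Longrightarrow> \<alpha> (\<phi> x) = \<phi> (\<alpha> x)"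
    "\<And>\<phi>. \<phi> \<in> E1 \<Longrightarrow> (\<forall>x\<in>\<alpha> ` M. \<phi> x = 0) \<or> inj_on \<phi> (\<alpha> ` M)"
    by (rule primitive_idempotent_operator[OF finM M(2) E(1) red1 L1 f(1) fL1]) (assumption+, rule that)
  have \<alpha>S: "\<exists>s\<in>S. \<alpha> = (*) s \<or> \<alpha> = (\<lambda>x. x - s * x)" using \<alpha>(1) by (auto simp: E1_def)
  have \<alpha>M: "\<alpha> x \<in> M" if "x \<in> M" for x using \<alpha>S M(3) that subgrpD(3)[OF M(2)] by auto
  obtain \<beta> where \<beta>: "\<beta> \<in> E2 \<or> (\<exists>\<phi>\<in>E2. \<beta> = (\<lambda>x. x - \<phi> x))" "\<beta> (\<alpha> f) \<notin> L1"
    "\<And>x. x \<in> M \<Longrightarrow> \<beta> (\<beta> x) = \<beta> x" "\<And>\<phi> x. \<phi> \<in> E2 \<Longrightarrow> x \<in> M \<Longrightarrow> \<beta> (\<phi> x) = \<phi> (\<beta> x)"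
    "\<And>\<phi>. \<phi> \<in> E2 \<Longrightarrow> (\<forall>x\<in>\<beta> ` M. \<phi> x = 0) \<or> inj_on \<phi> (\<beta> ` M)"
    by (rule primitive_idempotent_operator[OF finM M(2) E(2) red2 L1 \<alpha>M[OF f(1)] \<alpha>(2)]) (assumption+, rule that)
  have \<beta>S: "\<exists>s\<in>S. \<beta> = (\<lambda>x. x * s) \<or> \<beta> = (\<lambda>x. x - x * s)" using \<beta>(1) by (auto simp: E2_def)
  have \<beta>M: "\<beta> x \<in> M" if "x \<in> M" for x using \<beta>S M(3) that subgrpD(3)[OF M(2)] by auto
  have \<alpha>r: "\<alpha> (x * s) = \<alpha> x * s" for x s using \<alpha>S by (auto simp: algebra_simps)
  have \<beta>l: "\<beta> (s * x) = s * \<beta> x" for x s using \<beta>S by (auto simp: algebra_simps)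
  have \<alpha>l: "\<alpha> (s * x) = s * \<alpha> x" if "s \<in> S" "x \<in> M" for x s using \<alpha>(4)[of "(*) s" x] that by (simp add: E1_def)
  have \<beta>r: "\<beta> (x * s) = \<beta> x * s" if "s \<in> S" "x \<in> M" for x s using \<beta>(4)[of "\<lambda>x. x * s" x] that by (simp add: E2_def)
  have \<alpha>\<beta>: "\<alpha> (\<beta> x) = \<beta> (\<alpha> x)" for x using \<alpha>S \<beta>S by (auto simp: algebra_simps)
  define \<gamma> where "\<gamma> x = \<beta> (\<alpha> x)" for x
  have \<gamma>M: "\<gamma> x \<in> M" if "x \<in> M" for x using \<alpha>M \<beta>M that by (simp add: \<gamma>_def)
  have \<gamma>add: "\<gamma> (x + y) = \<gamma> x + \<gamma> y" "\<gamma> (x - y) = \<gamma> x - \<gamma> y" "\<gamma> 0 = 0" for x y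
    using \<alpha>S \<beta>S by (auto simp: \<gamma>_def algebra_simps)
  have \<gamma>S: "\<gamma> (s * x) = s * \<gamma> x" "\<gamma> (x * s) = \<gamma> x * s" if "s \<in> S" "x \<in> M" for s x
    by (simp only: \<gamma>_def \<alpha>l[OF that] \<beta>l, simp only: \<gamma>_def \<alpha>r \<beta>r[OF that(1) \<alpha>M[OF that(2)]])
  have \<gamma>L: "(\<gamma> a, \<gamma> b) \<in> L" if ab: "(a, b) \<in> L" for a b
  proof -
    have \<alpha>L: "(\<alpha> a, \<alpha> b) \<in> L"
      using \<alpha>S L(3) ab subgrpD(3)[OF L(1) ab] by fastforce
    then show ?thesis unfolding \<gamma>_def
      using \<beta>S L(3) subgrpD(3)[OF L(1) \<alpha>L] by fastforce
  qed
  define M1 where "M1 = \<gamma> ` M"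
  have M1M: "M1 \<subseteq> M" using \<gamma>M by (auto simp: M1_def)
  have finM1: "finite M1" using finM by (simp add: M1_def)
  have "\<gamma> 0 \<in> M1" unfolding M1_def using subgrpD(1)[OF M(2)] by (rule imageI)
  then have M1: "subgrp M1" using subgrpD(2,3)[OF M(2)]
    by (auto simp: subgrp_def M1_def \<gamma>add(3) \<gamma>add(1,2)[symmetric])
  have M1S: "s * m \<in> M1 \<and> m * s \<in> M1" if "s \<in> S" "m \<in> M1" for s m
  proof -
    obtain x where x: "x \<in> M" "m = \<gamma> x" using \<open>m \<in> M1\<close> by (auto simp: M1_def)
    then have "s * m = \<gamma> (s * x)" "m * s = \<gamma> (x * s)" using \<gamma>S that(1) by simp_all
    then show ?thesis using M(3)[OF that(1) x(1)] by (simp add: M1_def)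
  qed
  have E': "op_rng E1 M1" "op_rng E2 M1" unfolding E1_def E2_def by (rule op_rng_mult[OF S(1,2) M1S]; assumption)+
  have sub: "M1 \<subseteq> \<alpha> ` M" "M1 \<subseteq> \<beta> ` M" using \<alpha>\<beta> \<alpha>M \<beta>M by (auto simp: M1_def \<gamma>_def) (metis image_eqI)
  have zi: "ops_zero_or_inj E1 M1" "ops_zero_or_inj E2 M1"
    using \<alpha>(5) \<beta>(5) sub unfolding ops_zero_or_inj_def by (meson inj_on_subset subset_iff)+
  define L' where "L' = L \<inter> (M1 \<times> M1)"
  have L': "subgrp L'" "L' \<subseteq> M1 \<times> M1"
    using L(1) subgrp_Times[OF M1 M1] by (auto simp: L'_def subgrp_def)
  have L'3: "(\<phi> a, \<phi> b) \<in> L'" if "\<phi> \<in> E1 \<union> E2" "(a, b) \<in> L'" for \<phi> a b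
    using that L(3) M1S by (auto simp: E1_def E2_def L'_def)
  have f': "\<gamma> f \<in> M1" "(\<gamma> f, 0) \<notin> L'" using f(1) \<beta>(2) by (auto simp: M1_def L'_def \<gamma>_def L1_def)
  have comm: "\<phi> (\<psi> m) = \<psi> (\<phi> m)" if "\<phi> \<in> E1" "\<psi> \<in> E2" "m \<in> M1" for \<phi> \<psi> m
    using that by (auto simp: E1_def E2_def mult.assoc)
  obtain \<sigma> \<tau> where s: "\<sigma> ` M1 \<subseteq> M1" "\<tau> ` M1 \<subseteq> M1" "additive_on M1 \<sigma>" "additive_on M1 \<tau>"
    "\<And>a b. (a, b) \<in> L' \<Longrightarrow> \<sigma> a + \<tau> b = 0" "\<sigma> (\<gamma> f) \<noteq> 0"
    "commute_on M1 (E1 \<union> E2) \<sigma>" "commute_on M1 (E1 \<union> E2) \<tau>"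
    by (rule two_sided_separation[OF finM1 M1 E' zi _ L' _ f'])
      (rule comm, assumption, assumption, assumption, rule L'3, assumption, assumption, rule that)
  have \<gamma>M1: "\<gamma> x \<in> M1" if "x \<in> M" for x using that by (simp add: M1_def)
  have lin: "\<rho> (\<gamma> (s * m)) = s * \<rho> (\<gamma> m) \<and> \<rho> (\<gamma> (m * s)) = \<rho> (\<gamma> m) * s"
    if "commute_on M1 (E1 \<union> E2) \<rho>" "s \<in> S" "m \<in> M" for \<rho> s m
    using that \<gamma>M1[OF that(3)] by (auto simp: commute_on_def E1_def E2_def \<gamma>S)
  show thesis
  proof (rule that[of "\<lambda>x. \<sigma> (\<gamma> x)" "\<lambda>x. \<tau> (\<gamma> x)"])
    show "(\<lambda>x. \<sigma> (\<gamma> x)) ` M \<subseteq> M" "(\<lambda>x. \<tau> (\<gamma> x)) ` M \<subseteq> M" using s(1,2) M1M \<gamma>M1 by blast+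
    show "additive_on M (\<lambda>x. \<sigma> (\<gamma> x))" "additive_on M (\<lambda>x. \<tau> (\<gamma> x))"
      using s(3,4) \<gamma>M1 by (auto simp: additive_on_def \<gamma>add)
    show "\<sigma> (\<gamma> a) + \<tau> (\<gamma> b) = 0" if "(a, b) \<in> L" for a b
      using s(5) \<gamma>L[OF that] \<gamma>M1 L(2) that by (auto simp: L'_def)
    show "\<sigma> (\<gamma> (s * m)) = s * \<sigma> (\<gamma> m) \<and> \<sigma> (\<gamma> (m * s)) = \<sigma> (\<gamma> m) * s"
      if "s \<in> S" "m \<in> M" for s m using lin[OF s(7) that] .
    show "\<tau> (\<gamma> (s * m)) = s * \<tau> (\<gamma> m) \<and> \<tau> (\<gamma> (m * s)) = \<tau> (\<gamma> m) * s"
      if "s \<in> S" "m \<in> M" for s m using lin[OF s(8) that] .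
    show "\<sigma> (\<gamma> f) \<noteq> 0" by fact
  qed
qed


section \<open>Merging coordinates\<close>

text \<open>The local functions \<open>F\<close> and the evaluations \<open>C\<close> on a minimal set \<open>Y\<close> of homomorphisms: the two rings have the same restriction
to the complement of any one point, so that \<open>F = C + N\<close> with \<open>N\<close> the elements of \<open>F\<close> supported at that point.\<close>

locale critical_pair =
  fixes A :: "'u::ring set" and Y :: "'x set" and C F :: "('x \<Rightarrow> 'u) set"
  assumes finA: "finite A" and A: "subrng A" "self_annihilating_products_vanish A" and finY: "finite Y"
    and C: "subrng C" and F: "subrng F" and CF: "C \<subseteq> F"
    and val: "\<And>f x. f \<in> F \<Longrightarrow> f x \<in> A" and off: "\<And>f x. f \<in> F \<Longrightarrow> x \<notin> Y \<Longrightarrow> f x = 0"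
    and approx: "\<And>y f. y \<in> Y \<Longrightarrow> f \<in> F \<Longrightarrow> \<exists>c\<in>C. \<forall>x. x \<noteq> y \<longrightarrow> f x = c x"
    and three: "card Y \<ge> 3"
begin

lemma C_in_F: "c \<in> C \<Longrightarrow> c \<in> F" using CF by blast

lemma finite_F: "finite F"
  by (rule finite_subset[OF _ finite_set_of_finite_funs[OF finY finA, of 0]]) (use val off in auto)

lemma products_vanish_F: "self_annihilating_products_vanish F"
  unfolding self_annihilating_products_vanish_def
proof (intro ballI impI)
  fix f g assume fg: "f \<in> F" "g \<in> F"
    and z: "f * (f * g) = 0 \<and> f * g * f = 0 \<and> g * (f * g) = 0 \<and> f * g * g = 0"
  have "f x * g x = 0" for x
  proof -
    have "f x * (f x * g x) = 0" "f x * g x * f x = 0" "g x * (f x * g x) = 0" "f x * g x * g x = 0"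
      using z by (metis times_fun_apply zero_fun_apply)+
    then show ?thesis using A(2) val[OF fg(1)] val[OF fg(2)] unfolding self_annihilating_products_vanish_def by blast
  qed
  then show "f * g = 0" by (simp add: fun_eq_iff)
qed

lemma decompose:
  assumes "y \<in> Y" "f \<in> F"
  obtains c n where "c \<in> C" "n \<in> F" "f = c + n" "\<And>x. x \<noteq> y \<Longrightarrow> n x = 0"
proof -
  obtain c where c: "c \<in> C" "\<forall>x. x \<noteq> y \<longrightarrow> f x = c x" using approx assms by blast
  show thesis
    by (rule that[of c "f - c"]) (use c subrngD(3)[OF F assms(2) C_in_F] in \<open>auto simp: minus_apply\<close>)
qed

text \<open>The elements of \<open>C\<close> that act trivially on \<open>F / C\<close>.\<close>

definition \<nu> :: "('x \<Rightarrow> 'u) set" where "\<nu> = {c \<in> C. \<forall>f\<in>F. c * f \<in> C \<and> f * c \<in> C}"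

lemma two_in_Y: obtains y z where "y \<in> Y" "z \<in> Y" "y \<noteq> z"
  using three finY by (metis One_nat_def card_le_Suc0_iff_eq le_trans not_less_eq_eq numeral_3_eq_3 Suc_le_mono le0)

lemma disjoint_product:
  assumes "\<And>x. x \<noteq> y \<Longrightarrow> n x = 0" "\<And>x. x \<noteq> z \<Longrightarrow> n' x = 0" "y \<noteq> z"
  shows "n * (g * n') = (0 :: 'x \<Rightarrow> 'u)"
proof
  fix x show "(n * (g * n')) x = 0 x" using assms by (cases "x = y") auto
qed

text \<open>Write \<open>g = c + n\<close> and \<open>f = d + n'\<close> with \<open>n\<close> and \<open>n'\<close> supported at different points.  Then the term \<open>n * x * n'\<close>
is zero, and in the other terms a factor from \<open>C\<close> stands next to an element of \<open>C\<close>.\<close>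

lemma \<nu>_sandwich:
  assumes x: "x \<in> \<nu>" and fg: "f \<in> F" "g \<in> F"
  shows "g * (x * f) \<in> C"
proof -
  obtain y z where yz: "y \<in> Y" "z \<in> Y" "y \<noteq> z" by (rule two_in_Y)
  obtain c n where c: "c \<in> C" "n \<in> F" "g = c + n" "\<And>x. x \<noteq> y \<Longrightarrow> n x = 0" using decompose[OF yz(1) fg(2)] by blast
  obtain d n' where d: "d \<in> C" "n' \<in> F" "f = d + n'" "\<And>x. x \<noteq> z \<Longrightarrow> n' x = 0" using decompose[OF yz(2) fg(1)] by blast
  have x': "x * f \<in> C" "g * x \<in> C" "c * x \<in> C" using x fg C_in_F[OF c(1)] by (auto simp: \<nu>_def)
  have "n * (x * n') = 0" by (rule disjoint_product[OF c(4) d(4) yz(3)])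
  then have "g * (x * f) = c * (x * f) + (g * x - c * x) * d"
    by (simp add: c(3) d(3) algebra_simps)
  then show ?thesis using x' c(1) d(1) C by (auto intro: subrngD)
qed

lemma \<nu>_ideal: "subrng \<nu>" "x \<in> \<nu> \<Longrightarrow> f \<in> F \<Longrightarrow> x * f \<in> \<nu>" "x \<in> \<nu> \<Longrightarrow> f \<in> F \<Longrightarrow> f * x \<in> \<nu>"
proof -
  show 1: "x * f \<in> \<nu>" if "x \<in> \<nu>" "f \<in> F" for x f
    using that \<nu>_sandwich[OF that(1,2)] subrngD(4)[OF F that(2)] by (auto simp: \<nu>_def mult.assoc)
  show "f * x \<in> \<nu>" if "x \<in> \<nu>" "f \<in> F" for x f
    using that \<nu>_sandwich[OF that(1) _ that(2)] subrngD(4)[OF F _ that(2)]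
    by (auto simp: \<nu>_def mult.assoc) (auto simp flip: mult.assoc)
  show "subrng \<nu>" unfolding subrng_def
  proof (intro conjI ballI)
    show "0 \<in> \<nu>" using subrngD(1)[OF C] by (simp add: \<nu>_def)
    fix x y assume xy: "x \<in> \<nu>" "y \<in> \<nu>"
    then show "x + y \<in> \<nu>" "x - y \<in> \<nu>"
      using subrngD(2,3)[OF C] by (auto simp: \<nu>_def distrib_left distrib_right left_diff_distrib right_diff_distrib)
    show "x * y \<in> \<nu>" using 1[OF xy(1)] xy(2) C_in_F by (auto simp: \<nu>_def)
  qed
qed

lemma \<nu>C: "x \<in> \<nu> \<Longrightarrow> x \<in> C" and \<nu>F: "x \<in> \<nu> \<Longrightarrow> x \<in> F"
  using C_in_F by (auto simp: \<nu>_def)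

end

text \<open>With \<open>e\<close> from \<open>nil_corner\<close>, the part of \<open>\<nu>\<close> in the complementary corner is nil, hence null.  The corner of \<open>C\<close> modulo this
null ideal \<open>K\<close> acts faithfully on \<open>F / C\<close>.\<close>

locale critical_corner = critical_pair A Y C F
  for A :: "'u::ring set" and Y :: "'x set" and C F :: "('x \<Rightarrow> 'u) set" +
  fixes e :: "'x \<Rightarrow> 'u"
  assumes e: "e \<in> \<nu>" "e * e = e" and nil: "\<And>x. x \<in> \<nu> \<Longrightarrow> e * x = 0 \<Longrightarrow> x * e = 0 \<Longrightarrow> x * x = 0"
begin

definition K where "K = {x \<in> \<nu>. e * x = 0 \<and> x * e = 0}"

lemma eex: "e * (e * x) = e * x" using e(2) by (simp flip: mult.assoc)
lemma eF: "e \<in> F" using e(1) by (rule \<nu>F)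

lemma K_subgrp: "subgrp K"
  using subrngD(1,2,3)[OF \<nu>_ideal(1)]
  by (auto simp: subgrp_def K_def distrib_left distrib_right left_diff_distrib right_diff_distrib)

lemma K_null: "x \<in> K \<Longrightarrow> y \<in> K \<Longrightarrow> x * y = 0"
proof -
  assume xy: "x \<in> K" "y \<in> K"
  have sq: "x * x = 0" if "x \<in> K" for x using that nil by (auto simp: K_def)
  show ?thesis
    using square_zero_sum_product_zero[OF products_vanish_F, of x y] sq[OF xy(1)] sq[OF xy(2)] sq[OF subgrpD(2)[OF K_subgrp xy]]
      xy \<nu>F by (auto simp: K_def)
qed

text \<open>Compression \<open>(1 - e) f (1 - e)\<close> to the corner, without mention of a unit.\<close>

definition \<rho> where "\<rho> f = f - e * f - f * e + e * (f * e)"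

lemma \<rho>_e: "e * \<rho> f = 0" "\<rho> f * e = 0"
  by (simp_all add: \<rho>_def distrib_left distrib_right left_diff_distrib right_diff_distrib mult.assoc e(2) eex)

lemma \<rho>_id: "e * f = 0 \<Longrightarrow> f * e = 0 \<Longrightarrow> \<rho> f = f" by (simp add: \<rho>_def)

lemma \<rho>_add: "\<rho> (f + g) = \<rho> f + \<rho> g"
  by (simp add: \<rho>_def algebra_simps)

lemma e_mult_\<nu>: "f \<in> F \<Longrightarrow> e * f \<in> \<nu>" "f \<in> F \<Longrightarrow> f * e \<in> \<nu>" "f \<in> F \<Longrightarrow> e * (f * e) \<in> \<nu>"
  using \<nu>_ideal(2,3) e(1) eF by blast+

lemma \<rho>_\<nu>: "f \<in> F \<Longrightarrow> f - \<rho> f \<in> \<nu>"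
  using subrngD(3)[OF \<nu>_ideal(1) subrngD(2)[OF \<nu>_ideal(1) e_mult_\<nu>(2,1)] e_mult_\<nu>(3), of f f f]
  by (simp add: \<rho>_def)

lemma \<rho>_F: "f \<in> F \<Longrightarrow> \<rho> f \<in> F"
  using subrngD(3)[OF F _ \<nu>F[OF \<rho>_\<nu>], of f f] by simp

lemma \<rho>_C: "c \<in> C \<Longrightarrow> \<rho> c \<in> C"
  using subrngD(3)[OF C _ \<nu>C[OF \<rho>_\<nu>], of c c] C_in_F by simp

lemma \<rho>_support: "f x = 0 \<Longrightarrow> \<rho> f x = 0"
  by (simp add: \<rho>_def)

lemma side_square:
  assumes f: "f \<in> F"
  shows "f * e - e * (f * e) \<in> \<nu>" "(f * e - e * (f * e)) * (f * e - e * (f * e)) = 0"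
    "e * f - e * (f * e) \<in> \<nu>" "(e * f - e * (f * e)) * (e * f - e * (f * e)) = 0"
  using subrngD(3)[OF \<nu>_ideal(1) e_mult_\<nu>(2)[OF f] e_mult_\<nu>(3)[OF f]] subrngD(3)[OF \<nu>_ideal(1) e_mult_\<nu>(1)[OF f] e_mult_\<nu>(3)[OF f]]
  by (simp_all add: left_diff_distrib right_diff_distrib mult.assoc eex e(2))

text \<open>The compressed product \<open>\<rho> (f * g)\<close> differs from \<open>\<rho> f * \<rho> g\<close> by \<open>u * v\<close>, where \<open>u = (1 - e) f e\<close> and
\<open>v = e g (1 - e)\<close> square to zero and have their product in the null ring \<open>K\<close>; so \<open>u * v = 0\<close>.\<close>

lemma \<rho>_mult:
  assumes fg: "f \<in> F" "g \<in> F"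
  shows "\<rho> (f * g) = \<rho> f * \<rho> g"
proof -
  define u where "u = f * e - e * (f * e)"
  define v where "v = e * g - e * (g * e)"
  have u: "u \<in> \<nu>" "u * u = 0" and v: "v \<in> \<nu>" "v * v = 0"
    using side_square[OF fg(1)] side_square[OF fg(2)] by (simp_all add: u_def v_def)
  have eu: "e * u = 0" and ve: "v * e = 0"
    by (simp_all add: u_def v_def left_diff_distrib right_diff_distrib mult.assoc eex e(2))
  have "e * (u * v) = 0" using eu by (simp flip: mult.assoc)
  moreover have "u * v * e = 0" using ve by (simp add: mult.assoc)
  ultimately have "u * v \<in> K" using subrngD(4)[OF \<nu>_ideal(1) u(1) v(1)] by (simp add: K_def)
  then have "u * v = 0"
    using square_zero_product_zero[OF F products_vanish_F \<nu>F[OF u(1)] \<nu>F[OF v(1)] u(2) v(2)] K_null by blast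
  moreover have "\<rho> f * \<rho> g + u * v = \<rho> (f * g)"
    by (simp add: \<rho>_def u_def v_def left_diff_distrib right_diff_distrib distrib_left distrib_right mult.assoc eex e(2))
  ultimately show ?thesis by simp
qed

text \<open>The parts of \<open>f\<close> between \<open>e\<close> and the corner square to zero, and so do their products with elements of \<open>K\<close>; hence they
annihilate \<open>K\<close>.\<close>

lemma K_absorb:
  assumes f: "f \<in> F" and j: "j \<in> K"
  shows "\<rho> f * j = f * j" "j * \<rho> f = j * f" "f * j \<in> K" "j * f \<in> K"
proof -
  have j': "j \<in> \<nu>" "e * j = 0" "j * e = 0" "j * j = 0" using j K_null[OF j j] by (auto simp: K_def)
  have ej: "e * (j * x) = 0" "j * (e * x) = 0" for x using j' by (simp_all flip: mult.assoc)
  define v where "v = e * f - e * (f * e)"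
  define u where "u = f * e - e * (f * e)"
  have u: "u \<in> \<nu>" "u * u = 0" and v: "v \<in> \<nu>" "v * v = 0"
    using side_square[OF f] by (simp_all add: u_def v_def)
  have "(v * j) * (v * j) = 0" "(j * u) * (j * u) = 0"
    by (simp_all add: u_def v_def left_diff_distrib right_diff_distrib mult.assoc ej j')
  then have "v * j = 0" "j * u = 0"
    using square_zero_product_zero[OF F products_vanish_F \<nu>F[OF v(1)] \<nu>F[OF j'(1)] v(2) j'(4)]
      square_zero_product_zero[OF F products_vanish_F \<nu>F[OF j'(1)] \<nu>F[OF u(1)] j'(4) u(2)] by blast+
  then have efj: "e * (f * j) = 0" and jfe: "j * (f * e) = 0"
    by (simp_all add: u_def v_def left_diff_distrib right_diff_distrib mult.assoc ej j')
  show "\<rho> f * j = f * j" "j * \<rho> f = j * f"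
    by (simp_all add: \<rho>_def left_diff_distrib right_diff_distrib distrib_left distrib_right mult.assoc ej j' efj jfe)
  show "f * j \<in> K" "j * f \<in> K"
    using \<nu>_ideal(2,3)[OF j'(1) f] efj jfe j' by (auto simp: K_def mult.assoc ej)
qed

text \<open>If \<open>p\<close> vanishes at \<open>y\<close>, then it annihilates the elements of \<open>F\<close> supported at \<open>y\<close>, which together with \<open>C\<close> make up \<open>F\<close>.
So each single coordinate determines the action on \<open>F / C\<close>.\<close>

lemma vanishing_in_K:
  assumes p: "p \<in> C" "e * p = 0" "p * e = 0" and y: "y \<in> Y" "p y = 0"
  shows "p \<in> K"
proof -
  have "p * f \<in> C \<and> f * p \<in> C" if f: "f \<in> F" for f
  proof -
    obtain c n where c: "c \<in> C" "n \<in> F" "f = c + n" "\<And>x. x \<noteq> y \<Longrightarrow> n x = 0" using decompose[OF y(1) f] by blast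
    have "p x * n x = 0 \<and> n x * p x = 0" for x using c(4) y(2) by (cases "x = y") auto
    then have "p * n = 0" "n * p = 0" by (simp_all add: fun_eq_iff)
    then have "p * f = p * c" "f * p = c * p" by (simp_all add: c(3) algebra_simps)
    then show ?thesis using subrngD(4)[OF C] p(1) c(1) by simp
  qed
  then show ?thesis using p by (simp add: K_def \<nu>_def)
qed

text \<open>All three coordinates map \<open>K\<close> onto the same null ideal \<open>M\<close> and agree modulo \<open>M\<close> on the corner, whence they induce the
same bimodule structure on \<open>M\<close>.  Since \<open>M\<close> is null and each element of \<open>F\<close> acts on it like its compression to the corner, adding to the coordinate \<open>w\<close> the
derivations \<open>\<sigma> (y - w)\<close> and \<open>\<tau> (z - w)\<close> gives a ring homomorphism.  The bimodule maps are chosen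
such that they vanish on the elements of \<open>C\<close> supported in \<open>{y, z}\<close>, but not on an element \<open>f0\<close> of \<open>F\<close> outside \<open>C\<close> that is
supported at \<open>y\<close>.\<close>

lemma merge_coordinates:
  assumes wyz: "w \<in> Y" "y \<in> Y" "z \<in> Y" "w \<noteq> y" "w \<noteq> z" "y \<noteq> z"
    and im: "(\<lambda>j. j y) ` K = (\<lambda>j. j w) ` K" "(\<lambda>j. j z) ` K = (\<lambda>j. j w) ` K"
    and agree: "\<And>p. p \<in> C \<Longrightarrow> e * p = 0 \<Longrightarrow> p * e = 0 \<Longrightarrow>
      p y - p w \<in> (\<lambda>j. j w) ` K \<and> p z - p w \<in> (\<lambda>j. j w) ` K"
    and ne: "F \<noteq> C"
  obtains \<Psi> f0 where "\<And>f. f \<in> F \<Longrightarrow> \<Psi> (f w) (f y) (f z) \<in> A"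
    "\<And>f g. f \<in> F \<Longrightarrow> g \<in> F \<Longrightarrow>
      \<Psi> ((f + g) w) ((f + g) y) ((f + g) z) = \<Psi> (f w) (f y) (f z) + \<Psi> (g w) (g y) (g z)"
    "\<And>f g. f \<in> F \<Longrightarrow> g \<in> F \<Longrightarrow>
      \<Psi> ((f * g) w) ((f * g) y) ((f * g) z) = \<Psi> (f w) (f y) (f z) * \<Psi> (g w) (g y) (g z)"
    "\<And>u. u \<in> F \<Longrightarrow> \<forall>f\<in>F. u * f = f \<and> f * u = f \<Longrightarrow> \<Psi> (u w) (u y) (u z) = u w"
    "f0 \<in> F" "\<And>x. x \<noteq> y \<Longrightarrow> x \<noteq> z \<Longrightarrow> f0 x = 0" "\<Psi> (f0 w) (f0 y) (f0 z) \<noteq> 0"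
    "\<And>c. c \<in> C \<Longrightarrow> \<forall>x. x \<noteq> y \<longrightarrow> x \<noteq> z \<longrightarrow> c x = 0 \<Longrightarrow> \<Psi> (c w) (c y) (c z) = 0"
proof -
  define M where "M = (\<lambda>j. j w) ` K"
  define S where "S = (\<lambda>f. f w) ` F"
  have KF: "j \<in> F" if "j \<in> K" for j using that \<nu>F by (auto simp: K_def)
  have KM: "j w \<in> M" "j y \<in> M" "j z \<in> M" if "j \<in> K" for j
    using that im by (auto simp: M_def)
  have Mrep: "\<exists>j\<in>K. m = j t" if "m \<in> M" "t \<in> {w, y, z}" for m t
    using that im by (auto simp: M_def image_iff set_eq_iff)
  have SA: "S \<subseteq> A" using val by (auto simp: S_def)
  have finS: "finite S" using SA finA by (rule finite_subset)
  have S: "subrng S" unfolding subrng_def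
  proof (intro conjI ballI)
    have "0 w \<in> S" unfolding S_def using subrngD(1)[OF F] by (rule imageI)
    then show "0 \<in> S" by simp
    fix a b assume "a \<in> S" "b \<in> S"
    then obtain f g where fg: "f \<in> F" "g \<in> F" "a = f w" "b = g w" by (auto simp: S_def)
    have h: "h w \<in> S" if "h \<in> F" for h using that by (simp add: S_def)
    have "(f + g) w \<in> S" "(f - g) w \<in> S" "(f * g) w \<in> S"
      by (rule h[OF subrngD(2)[OF F fg(1,2)]] h[OF subrngD(3)[OF F fg(1,2)]] h[OF subrngD(4)[OF F fg(1,2)]])+
    then show "a + b \<in> S" "a - b \<in> S" "a * b \<in> S" using fg by (simp_all add: minus_apply)
  qed
  have sapS: "self_annihilating_products_vanish S"
    using A(2) SA unfolding self_annihilating_products_vanish_def by blast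
  have MS: "M \<subseteq> S" using KF by (auto simp: M_def S_def)
  have M: "subgrp M" unfolding subgrp_def
  proof (intro conjI ballI)
    show "0 \<in> M" using KM(1)[OF subgrpD(1)[OF K_subgrp]] by simp
    fix a b assume "a \<in> M" "b \<in> M"
    then obtain i j where "i \<in> K" "j \<in> K" "a = i w" "b = j w" by (auto simp: M_def)
    then show "a + b \<in> M" "a - b \<in> M"
      using KM(1)[OF subgrpD(2)[OF K_subgrp, of i j]] KM(1)[OF subgrpD(3)[OF K_subgrp, of i j]] by (simp_all add: minus_apply)
  qed
  have null: "a * b = 0" if ab: "a \<in> M" "b \<in> M" for a b
  proof -
    obtain i j where "i \<in> K" "j \<in> K" "a = i w" "b = j w" using ab by (auto simp: M_def)
    then show ?thesis using fun_cong[OF K_null[of i j], of w] by simp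
  qed
  have SM: "s * m \<in> M \<and> m * s \<in> M" if sm: "s \<in> S" "m \<in> M" for s m
  proof -
    obtain f j where "f \<in> F" "j \<in> K" "s = f w" "m = j w" using sm by (auto simp: M_def S_def)
    then show ?thesis using KM(1)[OF K_absorb(3), of f j] KM(1)[OF K_absorb(4), of f j] by simp
  qed
  \<comment> \<open>change \<open>f\<close> at a third point \<open>v\<close> in order to move it into \<open>C\<close>\<close>
  have diff: "\<rho> f t - \<rho> f w \<in> M" if f: "f \<in> F" and t: "t \<in> {w, y, z}" for f t
  proof -
    obtain v where v: "v \<in> Y" "v \<noteq> w" "v \<noteq> t" using t wyz by (metis insertE singletonD)
    obtain c n where c: "c \<in> C" "n \<in> F" "f = c + n" "\<And>x. x \<noteq> v \<Longrightarrow> n x = 0" using decompose[OF v(1) f] by blast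
    have "\<rho> f t = \<rho> c t" "\<rho> f w = \<rho> c w" using v c(4) by (simp_all add: c(3) \<rho>_add \<rho>_support)
    then show ?thesis
      using t agree[OF \<rho>_C[OF c(1)] \<rho>_e] subgrpD(1)[OF M] by (auto simp: M_def)
  qed
  have act: "\<rho> f t * m = f w * m" "m * \<rho> f t = m * f w" "f t * m = f w * m" "m * f t = m * f w"
    if f: "f \<in> F" and t: "t \<in> {w, y, z}" and m: "m \<in> M" for f t m
  proof -
    obtain i where i: "i \<in> K" "m = i w" using Mrep[OF m, of w] by auto
    obtain j where j: "j \<in> K" "m = j t" using Mrep[OF m t] by auto
    have w: "\<rho> f w * m = f w * m" "m * \<rho> f w = m * f w"
      using fun_cong[OF K_absorb(1)[OF f i(1)], of w] fun_cong[OF K_absorb(2)[OF f i(1)], of w] i(2) by simp_all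
    have tt: "\<rho> f t * m = f t * m" "m * \<rho> f t = m * f t"
      using fun_cong[OF K_absorb(1)[OF f j(1)], of t] fun_cong[OF K_absorb(2)[OF f j(1)], of t] j(2) by simp_all
    have "(\<rho> f t - \<rho> f w) * m = 0" "m * (\<rho> f t - \<rho> f w) = 0" using null diff[OF f t] m by blast+
    then have "\<rho> f t * m = \<rho> f w * m" "m * \<rho> f t = m * \<rho> f w" by (simp_all add: left_diff_distrib right_diff_distrib)
    then show "\<rho> f t * m = f w * m" "m * \<rho> f t = m * f w" "f t * m = f w * m" "m * f t = m * f w"
      using w tt by simp_all
  qed
  \<comment> \<open>what elements of the corner of \<open>C\<close> can do at \<open>y\<close> and \<open>z\<close> alone\<close>
  define L where "L = {(p y, p z) | p. p \<in> K \<and> (\<forall>x. x \<noteq> y \<longrightarrow> x \<noteq> z \<longrightarrow> p x = 0)}"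
  have LI: "(p y, p z) \<in> L" if "p \<in> K" "\<forall>x. x \<noteq> y \<longrightarrow> x \<noteq> z \<longrightarrow> p x = 0" for p using that by (auto simp: L_def)
  have LM: "L \<subseteq> M \<times> M" using KM by (auto simp: L_def)
  have L: "subgrp L" unfolding subgrp_def
  proof (intro conjI ballI)
    show "0 \<in> L" using LI[OF subgrpD(1)[OF K_subgrp]] by (simp add: zero_prod_def)
    fix a b assume "a \<in> L" "b \<in> L"
    then obtain p q where pq: "p \<in> K" "q \<in> K" "a = (p y, p z)" "b = (q y, q z)"
      "\<forall>x. x \<noteq> y \<longrightarrow> x \<noteq> z \<longrightarrow> p x = 0" "\<forall>x. x \<noteq> y \<longrightarrow> x \<noteq> z \<longrightarrow> q x = 0" by (auto simp: L_def)
    then show "a + b \<in> L" "a - b \<in> L"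
      using LI[OF subgrpD(2)[OF K_subgrp pq(1,2)]] LI[OF subgrpD(3)[OF K_subgrp pq(1,2)]] by (simp_all add: minus_apply)
  qed
  have LS: "(s * a, s * b) \<in> L \<and> (a * s, b * s) \<in> L" if s: "s \<in> S" and ab: "(a, b) \<in> L" for s a b
  proof -
    obtain p where p: "p \<in> K" "a = p y" "b = p z" "\<forall>x. x \<noteq> y \<longrightarrow> x \<noteq> z \<longrightarrow> p x = 0" using ab by (auto simp: L_def)
    obtain f where f: "f \<in> F" "s = f w" using s by (auto simp: S_def)
    have "s * a = (f * p) y" "s * b = (f * p) z" "a * s = (p * f) y" "b * s = (p * f) z"
      using act(3,4)[OF f(1) _ KM(2)[OF p(1)], of y] act(3,4)[OF f(1) _ KM(3)[OF p(1)], of z]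
      by (simp_all add: p(2,3) f(2))
    then show ?thesis using LI[OF K_absorb(3)[OF f(1) p(1)]] LI[OF K_absorb(4)[OF f(1) p(1)]] p(4) by simp
  qed
  obtain f1 where f1: "f1 \<in> F" "f1 \<notin> C" using ne CF by blast
  obtain c1 n where n: "c1 \<in> C" "n \<in> F" "f1 = c1 + n" "\<And>x. x \<noteq> y \<Longrightarrow> n x = 0" using decompose[OF wyz(2) f1(1)] by blast
  define f0 where "f0 = \<rho> n"
  have f0: "f0 \<in> F" "\<And>x. x \<noteq> y \<Longrightarrow> f0 x = 0" using \<rho>_F n \<rho>_support by (auto simp: f0_def)
  have f0C: "f0 \<notin> C"
  proof
    assume "f0 \<in> C"
    then have "c1 + (f0 + (n - \<rho> n)) \<in> C" using n(1) \<nu>C[OF \<rho>_\<nu>[OF n(2)]] by (intro subrngD(2)[OF C])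
    then show False using f1(2) n(3) by (simp add: f0_def)
  qed
  \<comment> \<open>changing \<open>f0\<close> at \<open>z\<close> gives an element of \<open>C\<close> with the same value at \<open>y\<close> which vanishes at \<open>w\<close>\<close>
  obtain c2 n' where n': "c2 \<in> C" "n' \<in> F" "f0 = c2 + n'" "\<And>x. x \<noteq> z \<Longrightarrow> n' x = 0" using decompose[OF wyz(3) f0(1)] by blast
  have "f0 = \<rho> f0" by (rule \<rho>_id[symmetric]) (simp_all add: f0_def \<rho>_e)
  then have f0': "f0 = \<rho> c2 + \<rho> n'" using n'(3) by (simp add: \<rho>_add)
  have "\<rho> c2 w = 0" using f0' f0(2)[of w] wyz n'(4)[of w] by (simp add: \<rho>_support)
  then have "\<rho> c2 \<in> K" using vanishing_in_K[OF \<rho>_C[OF n'(1)] \<rho>_e wyz(1)] by blast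
  moreover have "f0 y = \<rho> c2 y" using f0' wyz n'(4)[of y] by (simp add: \<rho>_support)
  ultimately have f0M: "f0 y \<in> M" using KM(2) by simp
  have f0L: "(f0 y, 0) \<notin> L"
  proof
    assume "(f0 y, 0) \<in> L"
    then obtain p where p: "p \<in> K" "p y = f0 y" "p z = 0" "\<forall>x. x \<noteq> y \<longrightarrow> x \<noteq> z \<longrightarrow> p x = 0" by (auto simp: L_def)
    have "p x = f0 x" for x using p f0(2) wyz by metis
    then have "p = f0" by blast
    then show False using p(1) f0C \<nu>C by (auto simp: K_def)
  qed
  obtain \<sigma> \<tau> where st: "\<sigma> ` M \<subseteq> M" "\<tau> ` M \<subseteq> M" "additive_on M \<sigma>" "additive_on M \<tau>"
    "\<And>s m. s \<in> S \<Longrightarrow> m \<in> M \<Longrightarrow> \<sigma> (s * m) = s * \<sigma> m \<and> \<sigma> (m * s) = \<sigma> m * s"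
    "\<And>s m. s \<in> S \<Longrightarrow> m \<in> M \<Longrightarrow> \<tau> (s * m) = s * \<tau> m \<and> \<tau> (m * s) = \<tau> m * s"
    "\<And>a b. (a, b) \<in> L \<Longrightarrow> \<sigma> a + \<tau> b = 0" "\<sigma> (f0 y) \<noteq> 0"
    by (rule bimodule_separation[OF finS S sapS MS M SM null L LM LS f0M f0L]) (assumption+, rule that)
  \<comment> \<open>\<open>D\<close> is a derivation with respect to the coordinate \<open>w\<close>\<close>
  define D where "D \<theta> t f = \<theta> (\<rho> f t - \<rho> f w)" for \<theta> :: "'u \<Rightarrow> 'u" and t :: 'x and f :: "'x \<Rightarrow> 'u"
  have D: "D \<theta> t f \<in> M" "D \<theta> t (f + g) = D \<theta> t f + D \<theta> t g" "D \<theta> t (f * g) = f w * D \<theta> t g + D \<theta> t f * g w"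
    if \<theta>: "\<theta> ` M \<subseteq> M" "additive_on M \<theta>"
      "\<And>s m. s \<in> S \<Longrightarrow> m \<in> M \<Longrightarrow> \<theta> (s * m) = s * \<theta> m \<and> \<theta> (m * s) = \<theta> m * s"
      and t: "t \<in> {w, y, z}" and f: "f \<in> F" and g: "g \<in> F" for \<theta> t f g
  proof -
    note df = diff[OF f t] and dg = diff[OF g t]
    show "D \<theta> t f \<in> M" using \<theta>(1) df by (auto simp: D_def)
    have "\<rho> (f + g) t - \<rho> (f + g) w = (\<rho> f t - \<rho> f w) + (\<rho> g t - \<rho> g w)" by (simp add: \<rho>_add)
    then show "D \<theta> t (f + g) = D \<theta> t f + D \<theta> t g" using additive_onD(1)[OF \<theta>(2) M df dg] by (simp add: D_def)
    have "\<rho> (f * g) t - \<rho> (f * g) w = \<rho> f t * (\<rho> g t - \<rho> g w) + (\<rho> f t - \<rho> f w) * \<rho> g w"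
      by (simp add: \<rho>_mult[OF f g] left_diff_distrib right_diff_distrib)
    also have "\<dots> = f w * (\<rho> g t - \<rho> g w) + (\<rho> f t - \<rho> f w) * g w"
      using act(1)[OF f t dg] act(2)[OF g _ df, of w] by simp
    finally have eq: "\<rho> (f * g) t - \<rho> (f * g) w = f w * (\<rho> g t - \<rho> g w) + (\<rho> f t - \<rho> f w) * g w" .
    have fS: "f w \<in> S" "g w \<in> S" using f g by (auto simp: S_def)
    have mm: "f w * (\<rho> g t - \<rho> g w) \<in> M" "(\<rho> f t - \<rho> f w) * g w \<in> M" using SM fS df dg by blast+
    have "D \<theta> t (f * g) = \<theta> (f w * (\<rho> g t - \<rho> g w)) + \<theta> ((\<rho> f t - \<rho> f w) * g w)"
      unfolding D_def eq by (rule additive_onD(1)[OF \<theta>(2) M mm])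
    then show "D \<theta> t (f * g) = f w * D \<theta> t g + D \<theta> t f * g w"
      using \<theta>(3)[OF fS(1) dg] \<theta>(3)[OF fS(2) df] by (simp add: D_def)
  qed
  note D\<sigma> = D[OF st(1,3,5), of y] and D\<tau> = D[OF st(2,4,6), of z]
  define E where "E f = D \<sigma> y f + D \<tau> z f" for f
  have EM: "E f \<in> M" if "f \<in> F" for f
    using D\<sigma>(1)[OF _ _ _ that that] D\<tau>(1)[OF _ _ _ that that] subgrpD(2)[OF M] by (simp add: E_def)
  have Eadd: "E (f + g) = E f + E g" if "f \<in> F" "g \<in> F" for f g
    using D\<sigma>(2)[OF _ _ _ that] D\<tau>(2)[OF _ _ _ that] by (simp add: E_def algebra_simps)
  have Emult: "E (f * g) = f w * E g + E f * g w" if "f \<in> F" "g \<in> F" for f g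
    using D\<sigma>(3)[OF _ _ _ that] D\<tau>(3)[OF _ _ _ that] by (simp add: E_def algebra_simps)
  define r where "r t a = a - e t * a - a * e t + e t * (a * e t)" for t a
  have r: "r t (f t) = \<rho> f t" for t f by (simp add: r_def \<rho>_def minus_apply)
  define \<Psi> where "\<Psi> a b c = a + (\<sigma> (r y b - r w a) + \<tau> (r z c - r w a))" for a b c
  have \<Psi>: "\<Psi> (f w) (f y) (f z) = f w + E f" for f by (simp add: \<Psi>_def r E_def D_def)
  have EE: "E f * E g = 0" if "f \<in> F" "g \<in> F" for f g using null EM that by blast
  have MA: "M \<subseteq> A" using MS SA by blast
  show thesis
  proof (rule that[of \<Psi> f0], unfold \<Psi>)
    show "f w + E f \<in> A" if "f \<in> F" for f using EM[OF that] MA val[OF that] subrngD(2)[OF A(1)] by blast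
    show "(f + g) w + E (f + g) = f w + E f + (g w + E g)" if "f \<in> F" "g \<in> F" for f g
      using Eadd[OF that] by simp
    show "(f * g) w + E (f * g) = (f w + E f) * (g w + E g)" if "f \<in> F" "g \<in> F" for f g
      using Emult[OF that] EE[OF that] by (simp add: distrib_left distrib_right)
    \<comment> \<open>a derivation vanishes at an idempotent that acts as the identity\<close>
    show "u w + E u = u w" if u: "u \<in> F" "\<forall>f\<in>F. u * f = f \<and> f * u = f" for u
    proof -
      obtain j where j: "j \<in> K" "E u = j w" using EM[OF u(1)] by (auto simp: M_def)
      have uj: "u * j = j" "j * u = j" "u * u = u" using u KF[OF j(1)] by auto
      have "u w * j w = (u * j) w" "j w * u w = (j * u) w" by simp_all
      then have "u w * E u = E u" "E u * u w = E u" "E (u * u) = E u" by (simp_all only: uj j(2))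
      then show ?thesis using Emult[OF u(1) u(1)] by simp
    qed
    show "f0 \<in> F" by fact
    show "f0 x = 0" if "x \<noteq> y" "x \<noteq> z" for x using f0(2) that by blast
    have "E f0 = \<sigma> (f0 y)"
    proof -
      have "\<rho> f0 = f0" by (rule \<rho>_id) (simp_all add: f0_def \<rho>_e)
      then show ?thesis using f0(2)[of w] f0(2)[of z] wyz additive_onD(2)[OF st(4) M] by (simp add: E_def D_def)
    qed
    then show "f0 w + E f0 \<noteq> 0" using st(8) f0(2)[of w] wyz by simp
    show "c w + E c = 0" if c: "c \<in> C" "\<forall>x. x \<noteq> y \<longrightarrow> x \<noteq> z \<longrightarrow> c x = 0" for c
    proof -
      have cw: "c w = 0" using c(2) wyz by blast
      have "\<rho> c \<in> K" by (rule vanishing_in_K[OF \<rho>_C[OF c(1)] \<rho>_e wyz(1)]) (rule \<rho>_support[of c w, OF cw])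
      then have "(\<rho> c y, \<rho> c z) \<in> L" using c(2) by (intro LI) (auto intro: \<rho>_support)
      then show ?thesis using st(7) cw \<rho>_support[of c w, OF cw] by (simp add: E_def D_def)
    qed
  qed
qed

end


lemma pigeonhole_three:
  assumes "finite T" "\<kappa> ` Y \<subseteq> T" "card Y > 2 * card T"
  obtains w y z where "w \<in> Y" "y \<in> Y" "z \<in> Y" "w \<noteq> y" "w \<noteq> z" "y \<noteq> z" "\<kappa> y = \<kappa> w" "\<kappa> z = \<kappa> w"
proof -
  have finY: "finite Y" using assms(3) by (metis card.infinite not_less0)
  define fib where "fib t = {y \<in> Y. \<kappa> y = t}" for t
  have "\<exists>t\<in>T. 3 \<le> card (fib t)"
  proof (rule ccontr)
    assume "\<not> ?thesis"
    then have "card (fib t) \<le> 2" if "t \<in> T" for t using that by force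
    then have "(\<Sum>t\<in>T. card (fib t)) \<le> 2 * card T" using sum_bounded_above[of T "\<lambda>t. card (fib t)" 2] by simp
    moreover have "Y \<subseteq> (\<Union>t\<in>T. fib t)" using assms(2) by (auto simp: fib_def)
    then have "card Y \<le> card (\<Union>t\<in>T. fib t)" using finY assms(1) by (intro card_mono) (auto simp: fib_def)
    moreover have "card (\<Union>t\<in>T. fib t) \<le> (\<Sum>t\<in>T. card (fib t))" by (rule card_UN_le[OF assms(1)])
    ultimately show False using assms(3) by simp
  qed
  then obtain t U where "U \<subseteq> fib t" "card U = 3" using obtain_subset_with_card_n by metis
  then obtain w y z where "U = {w, y, z}" "w \<noteq> y" "w \<noteq> z" "y \<noteq> z" "{w, y, z} \<subseteq> fib t" by (auto simp: card_3_iff)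
  then show thesis by (intro that[of w y z]) (auto simp: fib_def)
qed

text \<open>Twice the number of pairs of a subset and a self-map of an \<open>n\<close>-element set.  These pairs encode how a
coordinate treats \<open>K\<close> and representatives of the corner modulo \<open>K\<close>.\<close>

definition merge_bound :: "nat \<Rightarrow> nat" where "merge_bound n = 2 * (2 ^ n * n ^ n)"

context critical_pair begin

text \<open>Since an element of the corner of \<open>C\<close> that vanishes at \<open>y0\<close> is in \<open>K\<close>, the elements of the corner are represented
modulo \<open>K\<close> by one element \<open>q a\<close> for each value \<open>a\<close> at \<open>y0\<close>.  Coordinates with the same image of \<open>K\<close> and the same values at
all \<open>q a\<close> agree on the corner modulo that image.\<close>

lemma merge_three:
  assumes big: "card Y > merge_bound (card A)" and ne: "F \<noteq> C"
  obtains w y z \<Psi> f0 where "w \<in> Y" "y \<in> Y" "z \<in> Y" "w \<noteq> y" "w \<noteq> z" "y \<noteq> z"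
    "\<And>f. f \<in> F \<Longrightarrow> \<Psi> (f w) (f y) (f z) \<in> A"
    "\<And>f g. f \<in> F \<Longrightarrow> g \<in> F \<Longrightarrow>
      \<Psi> ((f + g) w) ((f + g) y) ((f + g) z) = \<Psi> (f w) (f y) (f z) + \<Psi> (g w) (g y) (g z)"
    "\<And>f g. f \<in> F \<Longrightarrow> g \<in> F \<Longrightarrow>
      \<Psi> ((f * g) w) ((f * g) y) ((f * g) z) = \<Psi> (f w) (f y) (f z) * \<Psi> (g w) (g y) (g z)"
    "\<And>u. u \<in> F \<Longrightarrow> \<forall>f\<in>F. u * f = f \<and> f * u = f \<Longrightarrow> \<Psi> (u w) (u y) (u z) = u w"
    "f0 \<in> F" "\<And>x. x \<noteq> y \<Longrightarrow> x \<noteq> z \<Longrightarrow> f0 x = 0" "\<Psi> (f0 w) (f0 y) (f0 z) \<noteq> 0"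
    "\<And>c. c \<in> C \<Longrightarrow> \<forall>x. x \<noteq> y \<longrightarrow> x \<noteq> z \<longrightarrow> c x = 0 \<Longrightarrow> \<Psi> (c w) (c y) (c z) = 0"
proof -
  have "finite \<nu>" by (rule finite_subset[OF _ finite_F]) (use \<nu>F in blast)
  then obtain e where e: "e \<in> \<nu>" "e * e = e" "\<And>x. x \<in> \<nu> \<Longrightarrow> e * x = 0 \<Longrightarrow> x * e = 0 \<Longrightarrow> \<exists>n. pow1 x n = 0"
    by (rule nil_corner[OF _ \<nu>_ideal(1)]) (rule that)
  interpret critical_corner A Y C F e
  proof
    show "x * x = 0" if "x \<in> \<nu>" "e * x = 0" "x * e = 0" for x
      using nilpotent_square_zero[OF F products_vanish_F \<nu>F[OF that(1)]] e(3)[OF that] by blast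
  qed fact+
  have "card Y > 0" using three by simp
  then obtain y0 where y0: "y0 \<in> Y" by (metis card_gt_0_iff ex_in_conv)
  define P where "P p \<longleftrightarrow> p \<in> C \<and> e * p = 0 \<and> p * e = 0" for p
  \<comment> \<open>the second alternative gives a harmless element of the corner when no element of it has the value \<open>a\<close> at \<open>y0\<close>\<close>
  define q where "q a = (SOME p. P p \<and> (p y0 = a \<or> (\<forall>p'. P p' \<longrightarrow> p' y0 \<noteq> a)))" for a
  have P0: "P 0" using subrngD(1)[OF C] by (simp add: P_def)
  have q: "P (q a) \<and> (q a y0 = a \<or> (\<forall>p'. P p' \<longrightarrow> p' y0 \<noteq> a))" for a
  proof -
    have "\<exists>p. P p \<and> (p y0 = a \<or> (\<forall>p'. P p' \<longrightarrow> p' y0 \<noteq> a))"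
      by (cases "\<exists>p'. P p' \<and> p' y0 = a") (use P0 in blast)+
    then show ?thesis unfolding q_def by (rule someI_ex)
  qed
  define \<kappa> where "\<kappa> t = ((\<lambda>j. j t) ` K, \<lambda>a\<in>A. q a t)" for t
  define T where "T = Pow A \<times> (A \<rightarrow>\<^sub>E A)"
  have PF: "p \<in> F" if "P p" for p using that C_in_F by (auto simp: P_def)
  have KF: "j \<in> F" if "j \<in> K" for j using that \<nu>F by (auto simp: K_def)
  have \<kappa>T: "\<kappa> ` Y \<subseteq> T" using q PF KF val by (auto simp: \<kappa>_def T_def)
  have finT: "finite T" using finA by (simp add: T_def finite_PiE)
  have "card T = 2 ^ card A * card A ^ card A"
    using finA by (simp add: T_def card_cartesian_product card_Pow card_PiE)
  then have "card Y > 2 * card T" using big by (simp add: merge_bound_def)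
  then obtain w y z where wyz: "w \<in> Y" "y \<in> Y" "z \<in> Y" "w \<noteq> y" "w \<noteq> z" "y \<noteq> z" "\<kappa> y = \<kappa> w" "\<kappa> z = \<kappa> w"
    by (rule pigeonhole_three[OF finT \<kappa>T]) (rule that)
  have im: "(\<lambda>j. j y) ` K = (\<lambda>j. j w) ` K" "(\<lambda>j. j z) ` K = (\<lambda>j. j w) ` K"
    using wyz(7,8) by (simp_all add: \<kappa>_def)
  have agree: "p t - p w \<in> (\<lambda>j. j w) ` K" if p: "P p" and t: "(\<lambda>j. j t) ` K = (\<lambda>j. j w) ` K" "\<kappa> t = \<kappa> w" for p t
  proof -
    define a where "a = p y0"
    have aA: "a \<in> A" using val[OF PF[OF p]] by (simp add: a_def)
    have qa: "P (q a)" "q a y0 = a" using q[of a] p by (auto simp: a_def)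
    define j where "j = p - q a"
    have "j \<in> K"
    proof (rule vanishing_in_K[OF _ _ _ y0])
      show "j \<in> C" using p qa(1) subrngD(3)[OF C] by (simp add: j_def P_def)
      show "e * j = 0" "j * e = 0" using p qa(1) by (simp_all add: j_def P_def left_diff_distrib right_diff_distrib)
      show "j y0 = 0" using qa(2) by (simp add: j_def a_def minus_apply)
    qed
    have "q a t = q a w" using t(2) aA by (auto simp: \<kappa>_def dest: fun_cong[of _ _ a])
    then have d: "p t - p w = j t - j w" by (simp add: j_def minus_apply)
    obtain i where i: "i \<in> K" "j t = i w" using t(1) \<open>j \<in> K\<close> by (metis (no_types, lifting) imageE imageI)
    have "i - j \<in> K" by (rule subgrpD(3)[OF K_subgrp i(1) \<open>j \<in> K\<close>])
    then have "(i - j) w \<in> (\<lambda>j. j w) ` K" by (rule imageI)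
    then show ?thesis using d i(2) by (simp add: minus_apply)
  qed
  have ag: "p y - p w \<in> (\<lambda>j. j w) ` K \<and> p z - p w \<in> (\<lambda>j. j w) ` K"
    if "p \<in> C" "e * p = 0" "p * e = 0" for p
    using agree[OF _ im(1) wyz(7)] agree[OF _ im(2) wyz(8)] that by (simp add: P_def)
  show thesis
    by (rule merge_coordinates[OF wyz(1-6) im ag ne]) (assumption+, rule that[OF wyz(1-6)], assumption+)
qed

end


section \<open>Compactness\<close>

text \<open>Tychonoff's theorem for a power of a finite discrete space: each constraint defines a closed set, and the hypothesis is
the finite intersection property.\<close>

lemma finite_support_compactness:
  fixes I :: "'i set" and V :: "'v set" and J :: "('i set \<times> (('i \<Rightarrow> 'v) \<Rightarrow> bool)) set"
  assumes V: "finite V"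
    and J: "\<And>S P. (S, P) \<in> J \<Longrightarrow> finite S \<and> S \<subseteq> I \<and> (\<forall>\<phi> \<psi>. (\<forall>i\<in>S. \<phi> i = \<psi> i) \<longrightarrow> P \<phi> = P \<psi>)"
    and sat: "\<And>T. finite T \<Longrightarrow> T \<subseteq> I \<Longrightarrow> \<exists>\<phi>\<in>I \<rightarrow>\<^sub>E V. \<forall>(S, P)\<in>J. S \<subseteq> T \<longrightarrow> P \<phi>"
  shows "\<exists>\<phi>\<in>I \<rightarrow>\<^sub>E V. \<forall>(S, P)\<in>J. P \<phi>"
proof -
  define X where "X = product_topology (\<lambda>_. discrete_topology V) I"
  have top: "topspace X = I \<rightarrow>\<^sub>E V" by (simp add: X_def)
  have "compact_space X" unfolding X_def
    by (rule compact_space_product_topology[THEN iffD2]) (simp add: compact_space_discrete_topology V)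
  define c where "c = (\<lambda>(S :: 'i set, P). {\<phi> \<in> I \<rightarrow>\<^sub>E V. P \<phi>} :: ('i \<Rightarrow> 'v) set)"
  have closed: "closedin X (c g)" if g: "g \<in> J" for g
  proof -
    obtain S P where SP: "g = (S, P)" by (cases g)
    note j = J[of S P]
    have "openin X {\<phi> \<in> I \<rightarrow>\<^sub>E V. \<not> P \<phi>}"
      unfolding X_def openin_product_topology_alt
    proof (intro ballI)
      fix \<phi> assume \<phi>: "\<phi> \<in> {\<phi> \<in> I \<rightarrow>\<^sub>E V. \<not> P \<phi>}"
      define U where "U i = (if i \<in> S then {\<phi> i} else V)" for i
      have "finite {i \<in> I. U i \<noteq> topspace (discrete_topology V)}"
        by (rule finite_subset[of _ S]) (use j g SP in \<open>auto simp: U_def\<close>)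
      moreover have "\<forall>i\<in>I. openin (discrete_topology V) (U i)" using \<phi> by (auto simp: U_def)
      moreover have "\<phi> \<in> Pi\<^sub>E I U" using \<phi> by (auto simp: U_def PiE_iff)
      moreover have "Pi\<^sub>E I U \<subseteq> {\<phi> \<in> I \<rightarrow>\<^sub>E V. \<not> P \<phi>}"
      proof
        fix \<psi> assume \<psi>: "\<psi> \<in> Pi\<^sub>E I U"
        then have "\<forall>i\<in>S. \<psi> i = \<phi> i" using j g SP by (fastforce simp: U_def PiE_iff)
        then have "P \<psi> = P \<phi>" using j g SP by blast
        moreover have "\<psi> i \<in> V" if "i \<in> I" for i
          using \<psi> \<phi> that by (auto simp: U_def PiE_iff split: if_splits)
        then have "\<psi> \<in> I \<rightarrow>\<^sub>E V" using \<psi> by (auto simp: PiE_iff)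
        ultimately show "\<psi> \<in> {\<phi> \<in> I \<rightarrow>\<^sub>E V. \<not> P \<phi>}" using \<phi> by blast
      qed
      ultimately show "\<exists>U. finite {i \<in> I. U i \<noteq> topspace (discrete_topology V)} \<and>
          (\<forall>i\<in>I. openin (discrete_topology V) (U i)) \<and> \<phi> \<in> Pi\<^sub>E I U \<and> Pi\<^sub>E I U \<subseteq> {\<phi> \<in> I \<rightarrow>\<^sub>E V. \<not> P \<phi>}"
        by blast
    qed
    moreover have "topspace X - c g = {\<phi> \<in> I \<rightarrow>\<^sub>E V. \<not> P \<phi>}" by (auto simp: top c_def SP)
    ultimately show ?thesis by (simp add: closedin_def top) (auto simp: c_def SP)
  qed
  define \<U> where "\<U> = insert (I \<rightarrow>\<^sub>E V) (c ` J)"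
  have "\<Inter>\<F> \<noteq> {}" if \<F>: "finite \<F>" "\<F> \<subseteq> \<U>" for \<F>
  proof -
    have "finite (\<F> - {I \<rightarrow>\<^sub>E V})" "\<F> - {I \<rightarrow>\<^sub>E V} \<subseteq> c ` J" using \<F> by (auto simp: \<U>_def)
    then obtain J0 where J0: "J0 \<subseteq> J" "finite J0" "\<F> - {I \<rightarrow>\<^sub>E V} = c ` J0" by (meson finite_subset_image)
    define T where "T = (\<Union>(S, P)\<in>J0. S)"
    have "finite S \<and> S \<subseteq> I" if "(S, P) \<in> J0" for S P using J[of S P] J0(1) that by blast
    then have "finite T" "T \<subseteq> I" using J0(2) by (auto simp: T_def)
    then obtain \<phi> where \<phi>: "\<phi> \<in> I \<rightarrow>\<^sub>E V" "\<forall>(S, P)\<in>J. S \<subseteq> T \<longrightarrow> P \<phi>" using sat by blast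
    have "\<phi> \<in> D" if "D \<in> \<F>" for D
    proof (cases "D = I \<rightarrow>\<^sub>E V")
      case False
      with that have "D \<in> \<F> - {I \<rightarrow>\<^sub>E V}" by simp
      then have "D \<in> c ` J0" by (simp only: J0(3))
      then obtain g where g: "g \<in> J0" "D = c g" by (rule imageE)
      obtain S P where SP: "g = (S, P)" by (cases g)
      have "S \<subseteq> T" using g(1) by (auto simp: T_def SP)
      moreover have "g \<in> J" using g(1) J0(1) by (rule subsetD[rotated])
      ultimately have "P \<phi>" using bspec[OF \<phi>(2), of g] by (simp add: SP)
      then show ?thesis using \<phi>(1) by (simp add: g(2) SP c_def)
    qed (use \<phi> in simp)
    then show ?thesis by blast
  qed
  moreover have "\<forall>D\<in>\<U>. closedin X D" using closed closedin_topspace[of X] by (auto simp: \<U>_def top)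
  ultimately have fip: "(\<forall>D\<in>\<U>. closedin X D) \<and> (\<forall>\<F>. finite \<F> \<and> \<F> \<subseteq> \<U> \<longrightarrow> \<Inter>\<F> \<noteq> {})"
    by (intro conjI allI impI) simp_all
  have "\<Inter>\<U> \<noteq> {}" by (rule mp[OF spec[OF iffD1[OF compact_space_fip \<open>compact_space X\<close>]] fip])
  then obtain \<phi> where "\<phi> \<in> I \<rightarrow>\<^sub>E V" "\<forall>g\<in>J. \<phi> \<in> c g" by (auto simp: \<U>_def)
  then show ?thesis by (auto simp: c_def)
qed

lemma Hom_iff:
  "h \<in> Hom L B A \<longleftrightarrow> h \<in> univ B \<rightarrow>\<^sub>E univ A \<and>
     (\<forall>f xs. L f = Some (length xs) \<and> set xs \<subseteq> univ B \<longrightarrow> h (interp B f xs) = interp A f (map h xs))"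
  by (simp add: Hom_def)

text \<open>Near each homomorphism \<open>h\<close> the function depends on a finite set \<open>C h\<close> only.  No homomorphism disagrees with every \<open>h\<close> on
\<open>C h\<close>, so by compactness this is already inconsistent on some finite set \<open>T\<close>, which then works for all homomorphisms together.\<close>

lemma continuous_finite_dependence:
  fixes B :: "('f, 'b) ualg" and A :: "('f, 'a) ualg"
  assumes A: "finite (univ A)" and B: "ualgebra L B"
    and F: "continuous_map (Hom_topology L B A) (discrete_topology (univ A)) F"
  obtains S where "finite S" "S \<subseteq> univ B"
    "\<And>g h. g \<in> Hom L B A \<Longrightarrow> h \<in> Hom L B A \<Longrightarrow> \<forall>b\<in>S. g b = h b \<Longrightarrow> F g = F h"
proof -
  let ?X = "product_topology (\<lambda>_. discrete_topology (univ A)) (univ B)"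
  have HomE: "Hom L B A \<subseteq> univ B \<rightarrow>\<^sub>E univ A" by (auto simp: Hom_def)
  have topH: "topspace (Hom_topology L B A) = Hom L B A" using HomE by (auto simp: Hom_topology_def)
  have "\<exists>S. finite S \<and> S \<subseteq> univ B \<and> (\<forall>g\<in>Hom L B A. (\<forall>b\<in>S. g b = h b) \<longrightarrow> F g = F h)" if h: "h \<in> Hom L B A" for h
  proof -
    have "F h \<in> univ A" using F h topH by (auto simp: continuous_map_def)
    then have "openin (discrete_topology (univ A)) {F h}" by simp
    then have "openin (Hom_topology L B A) {g \<in> topspace (Hom_topology L B A). F g \<in> {F h}}"
      using F by (auto simp: continuous_map_def)
    then obtain T where T: "openin ?X T" "{g \<in> Hom L B A. F g \<in> {F h}} = T \<inter> Hom L B A"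
      unfolding topH by (auto simp: Hom_topology_def openin_subtopology)
    then have "h \<in> T" using h by blast
    then obtain U where U: "finite {b \<in> univ B. U b \<noteq> univ A}" "h \<in> Pi\<^sub>E (univ B) U" "Pi\<^sub>E (univ B) U \<subseteq> T"
      using T(1) unfolding openin_product_topology_alt by (metis topspace_discrete_topology)
    have "F g = F h" if g: "g \<in> Hom L B A" "\<forall>b\<in>{b \<in> univ B. U b \<noteq> univ A}. g b = h b" for g
    proof -
      have "g b \<in> U b" if "b \<in> univ B" for b
        using g U(2) HomE that by (cases "U b = univ A") (auto simp: PiE_iff)
      then have "g \<in> Pi\<^sub>E (univ B) U" using g(1) HomE by (auto simp: PiE_iff)
      then show ?thesis using U(3) T(2) g(1) by blast
    qed
    then show ?thesis using U(1) by (intro exI[of _ "{b \<in> univ B. U b \<noteq> univ A}"]) auto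
  qed
  then obtain C where C: "\<And>h. h \<in> Hom L B A \<Longrightarrow> finite (C h) \<and> C h \<subseteq> univ B"
    "\<And>h g. h \<in> Hom L B A \<Longrightarrow> g \<in> Hom L B A \<Longrightarrow> \<forall>b\<in>C h. g b = h b \<Longrightarrow> F g = F h" by metis
  \<comment> \<open>\<open>J1\<close> says that \<open>\<phi>\<close> is a homomorphism, \<open>J2\<close> that it disagrees with each \<open>h\<close> on \<open>C h\<close>\<close>
  define J1 :: "('b set \<times> (('b \<Rightarrow> 'a) \<Rightarrow> bool)) set" where
    "J1 = {(insert (interp B f xs) (set xs), \<lambda>\<phi>. \<phi> (interp B f xs) = interp A f (map \<phi> xs)) | f xs.
       L f = Some (length xs) \<and> set xs \<subseteq> univ B}"
  define J2 :: "('b set \<times> (('b \<Rightarrow> 'a) \<Rightarrow> bool)) set" where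
    "J2 = {(C h, \<lambda>\<phi>. \<not> (\<forall>b\<in>C h. \<phi> b = h b)) | h. h \<in> Hom L B A}"
  have op: "interp B f xs \<in> univ B" if "L f = Some (length xs)" "set xs \<subseteq> univ B" for f xs
    using B that by (auto simp: ualgebra_def closed_under_def)
  have no: "\<not> (\<exists>\<phi>\<in>univ B \<rightarrow>\<^sub>E univ A. \<forall>(S, P)\<in>J1 \<union> J2. P \<phi>)"
  proof
    assume "\<exists>\<phi>\<in>univ B \<rightarrow>\<^sub>E univ A. \<forall>(S, P)\<in>J1 \<union> J2. P \<phi>"
    then obtain \<phi> where \<phi>: "\<phi> \<in> univ B \<rightarrow>\<^sub>E univ A" "\<forall>(S, P)\<in>J1 \<union> J2. P \<phi>" by blast
    have "\<phi> \<in> Hom L B A" unfolding Hom_iff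
    proof (intro conjI allI impI \<phi>(1))
      fix f xs assume "L f = Some (length xs) \<and> set xs \<subseteq> univ B"
      then have "(insert (interp B f xs) (set xs), \<lambda>\<phi>. \<phi> (interp B f xs) = interp A f (map \<phi> xs)) \<in> J1"
        unfolding J1_def by blast
      from bspec[OF \<phi>(2) UnI1[OF this]] show "\<phi> (interp B f xs) = interp A f (map \<phi> xs)" by simp
    qed
    then have "(C \<phi>, \<lambda>\<psi>. \<not> (\<forall>b\<in>C \<phi>. \<psi> b = \<phi> b)) \<in> J2" unfolding J2_def by blast
    from bspec[OF \<phi>(2) UnI2[OF this]] show False by simp
  qed
  have J: "finite S \<and> S \<subseteq> univ B \<and> (\<forall>\<phi> \<psi>. (\<forall>i\<in>S. \<phi> i = \<psi> i) \<longrightarrow> P \<phi> = P \<psi>)" if "(S, P) \<in> J1 \<union> J2" for S P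
    using that
  proof
    assume "(S, P) \<in> J1"
    then obtain f xs where fx: "S = insert (interp B f xs) (set xs)"
      "P = (\<lambda>\<phi>. \<phi> (interp B f xs) = interp A f (map \<phi> xs))" "L f = Some (length xs)" "set xs \<subseteq> univ B"
      unfolding J1_def mem_Collect_eq prod.inject by (elim exE conjE) (rule that)
    have PP: "P \<phi> = P \<psi>" if "\<forall>i\<in>S. \<phi> i = \<psi> i" for \<phi> \<psi>
    proof -
      have "map \<phi> xs = map \<psi> xs" "\<phi> (interp B f xs) = \<psi> (interp B f xs)" using that by (auto simp: fx(1))
      then show ?thesis by (simp only: fx(2))
    qed
    have "finite S" "S \<subseteq> univ B" using op[OF fx(3,4)] fx(4) by (simp_all add: fx(1))
    then show ?thesis by (intro conjI allI impI PP)
  next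
    assume "(S, P) \<in> J2"
    then obtain h where h: "h \<in> Hom L B A" "S = C h" "P = (\<lambda>\<phi>. \<not> (\<forall>b\<in>C h. \<phi> b = h b))"
      unfolding J2_def mem_Collect_eq prod.inject by (elim exE conjE) (rule that)
    have PP: "P \<phi> = P \<psi>" if "\<forall>i\<in>S. \<phi> i = \<psi> i" for \<phi> \<psi>
      using that unfolding h(2,3) by simp
    have "finite S" "S \<subseteq> univ B" using C(1)[OF h(1)] by (simp_all add: h(2))
    then show ?thesis by (intro conjI allI impI PP)
  qed
  have "\<exists>T. finite T \<and> T \<subseteq> univ B \<and>
    \<not> (\<exists>\<phi>\<in>univ B \<rightarrow>\<^sub>E univ A. \<forall>(S, P)\<in>J1 \<union> J2. S \<subseteq> T \<longrightarrow> P \<phi>)"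
  proof (rule ccontr)
    assume n: "\<not> ?thesis"
    have "\<exists>\<phi>\<in>univ B \<rightarrow>\<^sub>E univ A. \<forall>(S, P)\<in>J1 \<union> J2. P \<phi>"
    proof (rule finite_support_compactness[OF A])
      show "\<exists>\<phi>\<in>univ B \<rightarrow>\<^sub>E univ A. \<forall>(S, P)\<in>J1 \<union> J2. S \<subseteq> T \<longrightarrow> P \<phi>"
        if "finite T" "T \<subseteq> univ B" for T using n that by metis
    qed (rule J)
    then show False using no by (rule rev_notE)
  qed
  then obtain T where T: "finite T" "T \<subseteq> univ B"
    "\<not> (\<exists>\<phi>\<in>univ B \<rightarrow>\<^sub>E univ A. \<forall>(S, P)\<in>J1 \<union> J2. S \<subseteq> T \<longrightarrow> P \<phi>)" by metis
  have "F g = F h" if gh: "g \<in> Hom L B A" "h \<in> Hom L B A" "\<forall>b\<in>T. g b = h b" for g h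
  proof -
    have "g \<in> univ B \<rightarrow>\<^sub>E univ A" using gh(1) HomE by blast
    then have "\<not> (\<forall>(S, P)\<in>J1 \<union> J2. S \<subseteq> T \<longrightarrow> P g)" using T(3) by metis
    then obtain S P where SP: "(S, P) \<in> J1 \<union> J2" "S \<subseteq> T" "\<not> P g" by auto
    have "(S, P) \<notin> J1" using SP(3) gh(1) by (auto simp: J1_def Hom_iff)
    then have "(S, P) \<in> J2" using SP(1) by blast
    then obtain h' where h': "h' \<in> Hom L B A" "C h' \<subseteq> T" "\<forall>b\<in>C h'. g b = h' b"
      using SP(2,3) by (auto simp: J2_def)
    have "\<forall>b\<in>C h'. h b = h' b" using h'(2,3) gh(3) by (metis subsetD)
    then show ?thesis using C(2)[OF h'(1) gh(1) h'(3)] C(2)[OF h'(1) gh(2)] by simp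
  qed
  then show thesis using that T by blast
qed

text \<open>In a power of \<open>A\<close> the tuples that are constant on indices which the elements of \<open>S\<close> cannot tell apart form a subalgebra, and
there are only finitely many classes of such indices.\<close>

lemma SP_locally_finite:
  fixes B :: "('f, 'b) ualg" and A :: "('f, 'a) ualg"
  assumes A: "finite (univ A)" and B: "in_SP L A B" and S: "finite S" "S \<subseteq> univ B"
  obtains C where "finite C" "S \<subseteq> C" "subuniverse L B C"
proof -
  obtain I :: "('b \<Rightarrow> 'a) set" and \<phi> where \<phi>: "\<phi> \<in> Hom L B (power_alg A I)" "inj_on \<phi> (univ B)"
    and alg: "ualgebra L B" using B by (auto simp: in_SP_def)
  define C where "C = {b \<in> univ B. \<forall>i\<in>I. \<forall>j\<in>I. (\<forall>s\<in>S. \<phi> s i = \<phi> s j) \<longrightarrow> \<phi> b i = \<phi> b j}"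
  have \<phi>E: "\<phi> b \<in> I \<rightarrow>\<^sub>E univ A" if "b \<in> univ B" for b using \<phi>(1) that by (auto simp: Hom_def power_alg_def)
  have op: "\<phi> (interp B f xs) i = interp A f (map (\<lambda>x. \<phi> x i) xs)"
    if "L f = Some (length xs)" "set xs \<subseteq> univ B" "i \<in> I" for f xs i
    using \<phi>(1) that by (simp add: Hom_iff power_alg_def comp_def)
  have "subuniverse L B C" unfolding subuniverse_def closed_under_def
  proof (intro conjI allI impI)
    show "C \<subseteq> univ B" by (auto simp: C_def)
    fix f xs assume a: "L f = Some (length xs) \<and> set xs \<subseteq> C"
    then have xs: "set xs \<subseteq> univ B" by (auto simp: C_def)
    have iB: "interp B f xs \<in> univ B" using alg a xs by (auto simp: ualgebra_def closed_under_def)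
    have eq: "\<phi> (interp B f xs) i = \<phi> (interp B f xs) j"
      if ij: "i \<in> I" "j \<in> I" "\<forall>s\<in>S. \<phi> s i = \<phi> s j" for i j
    proof -
      have "\<phi> x i = \<phi> x j" if "x \<in> set xs" for x
      proof -
        have "x \<in> C" using a that by blast
        then show ?thesis using ij unfolding C_def by blast
      qed
      then have meq: "map (\<lambda>x. \<phi> x i) xs = map (\<lambda>x. \<phi> x j) xs" by simp
      show ?thesis by (simp only: op[OF conjunct1[OF a] xs ij(1)] op[OF conjunct1[OF a] xs ij(2)] meq)
    qed
    show "interp B f xs \<in> C" unfolding C_def by (intro CollectI conjI ballI impI iB) (rule eq)
  qed
  moreover have "S \<subseteq> C" using S by (auto simp: C_def)
  moreover have "finite C"
  proof -
    have CB: "b \<in> univ B" if "b \<in> C" for b using that by (simp add: C_def)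
    define t where "t i = (\<lambda>s\<in>S. \<phi> s i)" for i
    define T where "T = t ` I"
    have "T \<subseteq> S \<rightarrow>\<^sub>E univ A" using \<phi>E S(2) by (fastforce simp: T_def t_def PiE_iff)
    then have finT: "finite T" using finite_PiE[OF S(1)] A by (meson finite_subset)
    define p where "p \<tau> = (SOME i. i \<in> I \<and> t i = \<tau>)" for \<tau>
    have p: "p (t i) \<in> I \<and> t (p (t i)) = t i" if "i \<in> I" for i
      unfolding p_def by (rule someI[of "\<lambda>j. j \<in> I \<and> t j = t i" i]) (use that in simp)
    define \<kappa> where "\<kappa> b = (\<lambda>\<tau>\<in>T. \<phi> b (p \<tau>))" for b
    have "inj_on \<kappa> C"
    proof
      fix b c assume bc: "b \<in> C" "c \<in> C" "\<kappa> b = \<kappa> c"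
      have "\<phi> b i = \<phi> c i" if i: "i \<in> I" for i
      proof -
        have pI: "p (t i) \<in> I" and te: "t (p (t i)) = t i" using p[OF i] by simp_all
        have "\<phi> s i = \<phi> s (p (t i))" if "s \<in> S" for s
          using fun_cong[OF te, of s] that by (simp add: t_def)
        then have sS: "\<forall>s\<in>S. \<phi> s i = \<phi> s (p (t i))" ..
        have "\<forall>i\<in>I. \<forall>j\<in>I. (\<forall>s\<in>S. \<phi> s i = \<phi> s j) \<longrightarrow> \<phi> d i = \<phi> d j" if "d \<in> C" for d
          using that unfolding C_def mem_Collect_eq by (rule conjunct2)
        from mp[OF bspec[OF bspec[OF this i] pI] sS]
        have "\<phi> b i = \<phi> b (p (t i))" "\<phi> c i = \<phi> c (p (t i))" using bc(1,2) by blast+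
        moreover have "\<phi> b (p (t i)) = \<phi> c (p (t i))" using fun_cong[OF bc(3), of "t i"] i by (simp add: \<kappa>_def T_def)
        ultimately show ?thesis by simp
      qed
      then have "\<phi> b = \<phi> c" by (rule PiE_ext[OF \<phi>E[OF CB[OF bc(1)]] \<phi>E[OF CB[OF bc(2)]]])
      then show "b = c" by (rule inj_onD[OF \<phi>(2) _ CB[OF bc(1)] CB[OF bc(2)]])
    qed
    moreover have "\<kappa> ` C \<subseteq> T \<rightarrow>\<^sub>E univ A"
    proof
      fix y assume "y \<in> \<kappa> ` C"
      then obtain b where b: "b \<in> C" "y = \<kappa> b" by blast
      have "\<phi> b (p \<tau>) \<in> univ A" if "\<tau> \<in> T" for \<tau>
      proof -
        obtain i where "i \<in> I" "\<tau> = t i" using \<open>\<tau> \<in> T\<close> by (auto simp: T_def)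
        then have "p \<tau> \<in> I" using p by blast
        with \<phi>E[OF CB[OF b(1)]] show ?thesis by (rule PiE_mem)
      qed
      then show "y \<in> T \<rightarrow>\<^sub>E univ A" by (auto simp: b(2) \<kappa>_def)
    qed
    then have "finite (\<kappa> ` C)" using finite_PiE[OF finT, of "\<lambda>_. univ A"] A by (meson finite_subset)
    ultimately show ?thesis using finite_imageD by blast
  qed
  ultimately show thesis using that by blast
qed

text \<open>Let \<open>F\<close> depend on the finite set \<open>C0\<close> only, so that it induces a function \<open>F'\<close> on all maps defined on \<open>C0\<close>.  If \<open>F\<close> is
not an evaluation, then no finite subalgebra \<open>C\<close> above \<open>C0\<close> contains an element at which \<open>F'\<close> is the evaluation; so \<open>k\<close>
homomorphisms on \<open>C\<close> show that \<open>F'\<close> is not local.  By compactness there are \<open>k\<close> homomorphisms on all of \<open>B\<close> for which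
\<open>F\<close> agrees with no element of \<open>B\<close>, and \<open>F\<close> does not preserve the relation consisting of the tuples of their values.\<close>

lemma dualizable_if_finitely_local:
  fixes A :: "('f, 'a) ualg" and k :: nat
  assumes A: "finite (univ A)" "ualgebra L A" and k: "k \<ge> 1"
    and loc: "\<And>(B :: ('f, 'b) ualg) F. ualgebra L B \<Longrightarrow> finite (univ B) \<Longrightarrow>
      \<forall>h\<in>Hom L B A. F h \<in> univ A \<Longrightarrow>
      \<forall>Z. Z \<subseteq> Hom L B A \<and> finite Z \<and> card Z \<le> k \<longrightarrow> (\<exists>b\<in>univ B. \<forall>h\<in>Z. F h = h b) \<Longrightarrow>
      \<exists>b\<in>univ B. \<forall>h\<in>Hom L B A. F h = h b"
  shows "dualizable TYPE('b) L A"
  unfolding dualizable_iff_all_compatible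
proof (intro allI impI)
  fix B :: "('f, 'b) ualg"
  assume SP: "in_SP L A B"
  then have alg: "ualgebra L B" by (simp add: in_SP_def)
  have op: "interp B f xs \<in> univ B" if "L f = Some (length xs)" "set xs \<subseteq> univ B" for f xs
    using alg that by (auto simp: ualgebra_def closed_under_def)
  show "yields_duality L A {\<rho>. compatible_relation L A \<rho>} B"
    unfolding yields_duality_def
  proof (intro allI impI)
    fix F assume "continuous_map (Hom_topology L B A) (discrete_topology (univ A)) F \<and>
      (\<forall>\<rho>\<in>{\<rho>. compatible_relation L A \<rho>}. preserves L B A F \<rho>)"
    then have F: "continuous_map (Hom_topology L B A) (discrete_topology (univ A)) F"
      and pres: "\<And>\<rho>. compatible_relation L A \<rho> \<Longrightarrow> preserves L B A F \<rho>" by auto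
    have HomE: "Hom L B A \<subseteq> univ B \<rightarrow>\<^sub>E univ A" by (auto simp: Hom_def)
    have FA: "F h \<in> univ A" if "h \<in> Hom L B A" for h
      using F that HomE by (auto simp: continuous_map_def Hom_topology_def)
    obtain C0 where C0: "finite C0" "C0 \<subseteq> univ B"
      "\<And>g h. g \<in> Hom L B A \<Longrightarrow> h \<in> Hom L B A \<Longrightarrow> \<forall>b\<in>C0. g b = h b \<Longrightarrow> F g = F h"
      by (rule continuous_finite_dependence[OF A(1) alg F]) (rule that)
    obtain a0 where a0: "a0 \<in> univ A" using A(2) by (auto simp: ualgebra_def)
    define F' where "F' u = (if \<exists>g\<in>Hom L B A. \<forall>b\<in>C0. g b = u b
      then F (SOME g. g \<in> Hom L B A \<and> (\<forall>b\<in>C0. g b = u b)) else a0)" for u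
    have F'eq: "F' u = F g" if g: "g \<in> Hom L B A" "\<forall>b\<in>C0. g b = u b" for u g
    proof -
      let ?g = "SOME g. g \<in> Hom L B A \<and> (\<forall>b\<in>C0. g b = u b)"
      have s: "?g \<in> Hom L B A \<and> (\<forall>b\<in>C0. ?g b = u b)"
        by (rule someI[of "\<lambda>g. g \<in> Hom L B A \<and> (\<forall>b\<in>C0. g b = u b)" g]) (use g in blast)
      have "F' u = F ?g" using g by (auto simp: F'_def)
      also have "\<dots> = F g" using s g by (intro C0(3)) auto
      finally show ?thesis .
    qed
    have F'A: "F' u \<in> univ A" for u
    proof (cases "\<exists>g\<in>Hom L B A. \<forall>b\<in>C0. g b = u b")
      case True
      then show ?thesis using F'eq FA by metis
    next
      case False
      then have "F' u = a0" unfolding F'_def by (rule if_not_P)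
      then show ?thesis using a0 by simp
    qed
    have F'cong: "F' u = F' v" if "\<forall>b\<in>C0. u b = v b" for u v
    proof -
      have "(\<forall>b\<in>C0. g b = u b) = (\<forall>b\<in>C0. g b = v b)" for g using that by auto
      then show ?thesis by (simp only: F'_def)
    qed
    show "\<exists>b\<in>univ B. \<forall>h\<in>Hom L B A. F h = h b"
    proof (rule ccontr)
      assume no: "\<not> ?thesis"
      have bad: "\<exists>h. (\<forall>i<k. h i \<in> Hom L (B\<lparr>univ := C\<rparr>) A) \<and> (\<forall>b\<in>C. \<exists>i<k. F' (h i) \<noteq> h i b)"
        if C: "finite C" "C0 \<subseteq> C" "subuniverse L B C" "C \<noteq> {}" for C
      proof -
        let ?C = "B\<lparr>univ := C\<rparr>"
        have algC: "ualgebra L ?C" using C(3,4) by (auto simp: ualgebra_def subuniverse_def closed_under_def)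
        have CB: "C \<subseteq> univ B" using C(3) by (simp add: subuniverse_def)
        have "\<not> (\<forall>Z. Z \<subseteq> Hom L ?C A \<and> finite Z \<and> card Z \<le> k \<longrightarrow> (\<exists>b\<in>univ ?C. \<forall>h\<in>Z. F' h = h b))"
        proof
          assume "\<forall>Z. Z \<subseteq> Hom L ?C A \<and> finite Z \<and> card Z \<le> k \<longrightarrow> (\<exists>b\<in>univ ?C. \<forall>h\<in>Z. F' h = h b)"
          from loc[OF algC _ _ this] obtain b where b: "b \<in> C" "\<And>h. h \<in> Hom L ?C A \<Longrightarrow> F' h = h b"
            using C(1) F'A by auto
          have "F g = g b" if g: "g \<in> Hom L B A" for g
          proof -
            have "restrict g C \<in> Hom L ?C A" unfolding Hom_iff
            proof (intro conjI allI impI)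
              show "restrict g C \<in> univ ?C \<rightarrow>\<^sub>E univ A" using g HomE CB by (auto simp: PiE_iff)
              fix f xs assume a: "L f = Some (length xs) \<and> set xs \<subseteq> univ ?C"
              have "interp B f xs \<in> C" using C(3) a by (auto simp: subuniverse_def closed_under_def)
              moreover have "map (restrict g C) xs = map g xs" using a by auto
              moreover have "g (interp B f xs) = interp A f (map g xs)" using g a CB by (auto simp: Hom_iff)
              ultimately show "restrict g C (interp ?C f xs) = interp A f (map (restrict g C) xs)"
                by (simp del: map_eq_conv)
            qed
            from b(2)[OF this] b(1) have "F' (restrict g C) = g b" by simp
            moreover have "F' (restrict g C) = F g" by (rule F'eq[OF g]) (use C(2) in auto)
            ultimately show ?thesis by simp
          qed
          then show False using no b(1) CB by blast
        qed
        then obtain Z where Z: "Z \<subseteq> Hom L ?C A" "finite Z" "card Z \<le> k" "\<not> (\<exists>b\<in>C. \<forall>h\<in>Z. F' h = h b)" by auto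
        then have "Z \<noteq> {}" using C(4) by auto
        obtain e where e: "bij_betw e {..<card Z} Z" using ex_bij_betw_nat_finite[OF Z(2)] by (auto simp: lessThan_atLeast0)
        define h where "h i = e (if i < card Z then i else 0)" for i
        have cZ: "card Z > 0" using Z(2) \<open>Z \<noteq> {}\<close> by (simp add: card_gt_0_iff)
        have hZ: "h i \<in> Z" for i using e cZ by (auto simp: h_def bij_betw_def)
        have "\<exists>i<k. F' (h i) \<noteq> h i b" if b: "b \<in> C" for b
        proof -
          obtain g where g: "g \<in> Z" "F' g \<noteq> g b" using Z(4) b by blast
          then have "g \<in> e ` {..<card Z}" using e by (simp add: bij_betw_def)
          then obtain i where "i < card Z" "e i = g" by blast
          then show ?thesis using g Z(3) by (intro exI[of _ i]) (auto simp: h_def)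
        qed
        then show ?thesis using hZ Z(1) by blast
      qed
      define I where "I = univ B \<times> {..<k}"
      \<comment> \<open>\<open>J1\<close> says that the \<open>k\<close> components of \<open>\<phi>\<close> are homomorphisms, \<open>J2\<close> that no \<open>b\<close> evaluates to \<open>F'\<close> on all of them\<close>
      define J1 :: "(('b \<times> nat) set \<times> (('b \<times> nat \<Rightarrow> 'a) \<Rightarrow> bool)) set" where
        "J1 = {(insert (interp B f xs) (set xs) \<times> {..<k},
            \<lambda>\<phi>. \<forall>i<k. \<phi> (interp B f xs, i) = interp A f (map (\<lambda>x. \<phi> (x, i)) xs)) | f xs.
          L f = Some (length xs) \<and> set xs \<subseteq> univ B}"
      define J2 :: "(('b \<times> nat) set \<times> (('b \<times> nat \<Rightarrow> 'a) \<Rightarrow> bool)) set" where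
        "J2 = {(insert b C0 \<times> {..<k}, \<lambda>\<phi>. \<exists>i<k. F' (\<lambda>x. \<phi> (x, i)) \<noteq> \<phi> (b, i)) | b. b \<in> univ B}"
      have "\<exists>\<phi>\<in>I \<rightarrow>\<^sub>E univ A. \<forall>(S, P)\<in>J1 \<union> J2. P \<phi>"
      proof (rule finite_support_compactness[OF A(1)])
        fix S P assume "(S, P) \<in> J1 \<union> J2"
        then show "finite S \<and> S \<subseteq> I \<and> (\<forall>\<phi> \<psi>. (\<forall>i\<in>S. \<phi> i = \<psi> i) \<longrightarrow> P \<phi> = P \<psi>)"
        proof
          assume "(S, P) \<in> J1"
          then obtain f xs where fx: "S = insert (interp B f xs) (set xs) \<times> {..<k}"
            "P = (\<lambda>\<phi>. \<forall>i<k. \<phi> (interp B f xs, i) = interp A f (map (\<lambda>x. \<phi> (x, i)) xs))"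
            "L f = Some (length xs)" "set xs \<subseteq> univ B"
            unfolding J1_def mem_Collect_eq prod.inject by (elim exE conjE) (rule that)
          have PP: "P \<phi> = P \<psi>" if eq: "\<forall>i\<in>S. \<phi> i = \<psi> i" for \<phi> \<psi>
          proof -
            have "map (\<lambda>x. \<phi> (x, i)) xs = map (\<lambda>x. \<psi> (x, i)) xs \<and> \<phi> (interp B f xs, i) = \<psi> (interp B f xs, i)"
              if "i < k" for i using eq that by (auto simp: fx(1))
            then show ?thesis unfolding fx(2) by metis
          qed
          have "finite S" "S \<subseteq> I" using op[OF fx(3,4)] fx(4) by (auto simp: fx(1) I_def)
          then show ?thesis by (intro conjI allI impI PP)
        next
          assume "(S, P) \<in> J2"
          then obtain b where b: "S = insert b C0 \<times> {..<k}"
            "P = (\<lambda>\<phi>. \<exists>i<k. F' (\<lambda>x. \<phi> (x, i)) \<noteq> \<phi> (b, i))" "b \<in> univ B"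
            unfolding J2_def mem_Collect_eq prod.inject by (elim exE conjE) (rule that)
          have PP: "P \<phi> = P \<psi>" if eq: "\<forall>i\<in>S. \<phi> i = \<psi> i" for \<phi> \<psi>
          proof -
            have "F' (\<lambda>x. \<phi> (x, i)) = F' (\<lambda>x. \<psi> (x, i)) \<and> \<phi> (b, i) = \<psi> (b, i)" if "i < k" for i
              using eq that by (auto simp: b(1) intro!: F'cong)
            then show ?thesis unfolding b(2) by metis
          qed
          have "finite S" "S \<subseteq> I" using b(3) C0 by (auto simp: b(1) I_def)
          then show ?thesis by (intro conjI allI impI PP)
        qed
      next
        fix T assume T: "finite T" "T \<subseteq> I"
        obtain b0 where b0: "b0 \<in> univ B" using alg by (auto simp: ualgebra_def)
        have fin: "finite (insert b0 (C0 \<union> fst ` T))" "insert b0 (C0 \<union> fst ` T) \<subseteq> univ B"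
          using T C0 b0 by (auto simp: I_def)
        obtain C where C: "finite C" "insert b0 (C0 \<union> fst ` T) \<subseteq> C" "subuniverse L B C"
          by (rule SP_locally_finite[OF A(1) SP fin]) (rule that)
        have "C0 \<subseteq> C" "C \<noteq> {}" using C(2) by auto
        from bad[OF C(1) this(1) C(3) this(2)]
        obtain h where hh: "(\<forall>i<k. h i \<in> Hom L (B\<lparr>univ := C\<rparr>) A) \<and> (\<forall>b\<in>C. \<exists>i<k. F' (h i) \<noteq> h i b)"
          by (rule exE)
        note h = conjunct1[OF hh, rule_format] conjunct2[OF hh, rule_format]
        define \<phi> where "\<phi> = (\<lambda>(b, i)\<in>I. if b \<in> C then h i b else a0)"
        have CB: "C \<subseteq> univ B" using C(3) by (simp add: subuniverse_def)
        have \<phi>C: "\<phi> (b, i) = h i b" if "b \<in> C" "i < k" for b i using that CB by (auto simp: \<phi>_def I_def)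
        have hA: "h i b \<in> univ A" if "b \<in> C" "i < k" for b i using h(1)[OF that(2)] that(1) by (auto simp: Hom_iff)
        have \<phi>E: "\<phi> \<in> I \<rightarrow>\<^sub>E univ A" using hA a0 by (auto simp: \<phi>_def I_def)
        have PP: "P \<phi>" if SP: "(S, P) \<in> J1 \<union> J2" "S \<subseteq> T" for S P
          using SP(1)
        proof
          assume "(S, P) \<in> J1"
          then obtain f xs where fx: "S = insert (interp B f xs) (set xs) \<times> {..<k}"
            "P = (\<lambda>\<phi>. \<forall>i<k. \<phi> (interp B f xs, i) = interp A f (map (\<lambda>x. \<phi> (x, i)) xs))"
            "L f = Some (length xs)" "set xs \<subseteq> univ B"
            unfolding J1_def mem_Collect_eq prod.inject by (elim exE conjE) (rule that)
          have "(c, 0) \<in> T" if "c \<in> insert (interp B f xs) (set xs)" for c using SP(2) that k by (auto simp: fx(1))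
          then have inC: "insert (interp B f xs) (set xs) \<subseteq> C" using C(2) by force
          show ?thesis unfolding fx(2)
          proof (intro allI impI)
            fix i assume i: "i < k"
            have "map (\<lambda>x. \<phi> (x, i)) xs = map (h i) xs" using \<phi>C[OF _ i] inC by auto
            moreover have "h i (interp B f xs) = interp A f (map (h i) xs)"
              using h(1)[OF i] fx(3) inC by (simp add: Hom_iff)
            ultimately show "\<phi> (interp B f xs, i) = interp A f (map (\<lambda>x. \<phi> (x, i)) xs)"
              using \<phi>C[OF _ i, of "interp B f xs"] inC by (simp del: map_eq_conv)
          qed
        next
          assume "(S, P) \<in> J2"
          then obtain b where b: "S = insert b C0 \<times> {..<k}"
            "P = (\<lambda>\<phi>. \<exists>i<k. F' (\<lambda>x. \<phi> (x, i)) \<noteq> \<phi> (b, i))" "b \<in> univ B"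
            unfolding J2_def mem_Collect_eq prod.inject by (elim exE conjE) (rule that)
          have "(b, 0) \<in> T" using SP(2) k by (auto simp: b(1))
          then have bC: "b \<in> C" using C(2) by force
          obtain i where i: "i < k" "F' (h i) \<noteq> h i b" using h(2)[OF bC] by blast
          have "F' (\<lambda>x. \<phi> (x, i)) = F' (h i)" using \<phi>C[OF _ i(1)] C(2) by (intro F'cong) auto
          then show ?thesis unfolding b(2) using i \<phi>C[OF bC i(1)] by auto
        qed
        show "\<exists>\<phi>\<in>I \<rightarrow>\<^sub>E univ A. \<forall>(S, P)\<in>J1 \<union> J2. S \<subseteq> T \<longrightarrow> P \<phi>"
        proof (intro bexI[of _ \<phi>] ballI \<phi>E)
          fix c assume "c \<in> J1 \<union> J2"
          moreover obtain S P where c: "c = (S, P)" by (cases c)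
          ultimately show "case c of (S, P) \<Rightarrow> S \<subseteq> T \<longrightarrow> P \<phi>" using PP[of S P] by simp
        qed
      qed
      then obtain \<phi> where \<phi>: "\<phi> \<in> I \<rightarrow>\<^sub>E univ A" "\<forall>(S, P)\<in>J1 \<union> J2. P \<phi>" by blast
      define g where "g i = (\<lambda>b\<in>univ B. \<phi> (b, i))" for i
      have gH: "g i \<in> Hom L B A" if i: "i < k" for i unfolding Hom_iff
      proof (intro conjI allI impI)
        show "g i \<in> univ B \<rightarrow>\<^sub>E univ A" using \<phi>(1) i by (auto simp: g_def I_def PiE_iff)
        fix f xs assume a: "L f = Some (length xs) \<and> set xs \<subseteq> univ B"
        then have "(insert (interp B f xs) (set xs) \<times> {..<k},
            \<lambda>\<phi>. \<forall>i<k. \<phi> (interp B f xs, i) = interp A f (map (\<lambda>x. \<phi> (x, i)) xs)) \<in> J1"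
          unfolding J1_def by blast
        from bspec[OF \<phi>(2) UnI1[OF this]] i
        have "\<phi> (interp B f xs, i) = interp A f (map (\<lambda>x. \<phi> (x, i)) xs)" by simp
        moreover have "map (\<lambda>x. \<phi> (x, i)) xs = map (g i) xs" using a by (auto simp: g_def)
        ultimately show "g i (interp B f xs) = interp A f (map (g i) xs)"
          using a op by (simp add: g_def del: map_eq_conv)
      qed
      have viol: "\<exists>i<k. F (g i) \<noteq> g i b" if b: "b \<in> univ B" for b
      proof -
        have "(insert b C0 \<times> {..<k}, \<lambda>\<phi>. \<exists>i<k. F' (\<lambda>x. \<phi> (x, i)) \<noteq> \<phi> (b, i)) \<in> J2"
          unfolding J2_def using b by blast
        from bspec[OF \<phi>(2) UnI2[OF this]] obtain i where i: "i < k" "F' (\<lambda>x. \<phi> (x, i)) \<noteq> \<phi> (b, i)" by auto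
        have "F' (\<lambda>x. \<phi> (x, i)) = F (g i)" by (rule F'eq[OF gH[OF i(1)]]) (use C0(2) in \<open>auto simp: g_def\<close>)
        then show ?thesis using i b by (intro exI[of _ i]) (simp add: g_def)
      qed
      define r where "r = (\<lambda>b. \<lambda>i\<in>{..<k}. g i b) ` univ B"
      have "compatible_relation L A (k, r)"
        unfolding compatible_relation_def subuniverse_def closed_under_def prod.case
      proof (intro conjI allI impI k)
        show "r \<noteq> {}" using alg by (auto simp: r_def ualgebra_def)
        have "g i b \<in> univ A" if "i < k" "b \<in> univ B" for i b
          using PiE_mem[OF subsetD[OF HomE gH[OF that(1)]] that(2)] .
        then show "r \<subseteq> univ (power_alg A {..<k})" by (auto simp: r_def power_alg_def split: if_split_asm)
        fix f xs assume a: "L f = Some (length xs) \<and> set xs \<subseteq> r"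
        then have "xs \<in> lists ((\<lambda>b. \<lambda>i\<in>{..<k}. g i b) ` univ B)" by (auto simp: r_def in_lists_conv_set)
        then obtain bs where "bs \<in> lists (univ B)" and bs2: "xs = map (\<lambda>b. \<lambda>i\<in>{..<k}. g i b) bs"
          unfolding lists_image by (rule imageE)
        then have bs: "set bs \<subseteq> univ B" "xs = map (\<lambda>b. \<lambda>i\<in>{..<k}. g i b) bs" by (auto simp: in_lists_conv_set)
        have "interp (power_alg A {..<k}) f xs = (\<lambda>i\<in>{..<k}. g i (interp B f bs))"
        proof
          fix i
          show "interp (power_alg A {..<k}) f xs i = (\<lambda>i\<in>{..<k}. g i (interp B f bs)) i"
          proof (cases "i < k")
            case True
            have "map (\<lambda>x. x i) xs = map (g i) bs" using True by (simp add: bs(2) comp_def)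
            moreover have "g i (interp B f bs) = interp A f (map (g i) bs)"
              using gH[OF True] a bs by (simp add: Hom_iff)
            ultimately show ?thesis using True by (simp add: power_alg_def del: map_eq_conv)
          qed (simp add: power_alg_def)
        qed
        then show "interp (power_alg A {..<k}) f xs \<in> r" using op[of f bs] a bs by (auto simp: r_def)
      qed
      from pres[OF this] have "(\<lambda>i\<in>{..<k}. F (g i)) \<in> r"
        unfolding preserves_def prod.case using gH by (auto simp: r_def)
      then obtain b where "b \<in> univ B" "(\<lambda>i\<in>{..<k}. F (g i)) = (\<lambda>i\<in>{..<k}. g i b)" by (auto simp: r_def)
      then show False using viol[of b] by (metis lessThan_iff restrict_apply')
    qed
  qed
qed


section \<open>All rings on a type inside one ring\<close>

text \<open>The product of all rings with carrier in the given type.  On indices that are not rings the value is fixed, so that the ring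
laws hold unconditionally.\<close>

typedef ('a, 'm) uring = "{f :: ('a, 'm) ring_scheme \<Rightarrow> 'a. \<forall>R. if rng R then f R \<in> carrier R else f R = undefined}"
proof
  show "(\<lambda>R. if rng R then \<zero>\<^bsub>R\<^esub> else undefined) \<in> {f. \<forall>R. if rng R then f R \<in> carrier R else f R = undefined}"
    by (auto dest!: rng.axioms(1) abelian_group.axioms(1) intro: abelian_monoid.zero_closed)
qed

lemma uring_eqI: "(\<And>R. rng R \<Longrightarrow> Rep_uring x R = Rep_uring y R) \<Longrightarrow> x = y"
proof -
  assume eq: "\<And>R. rng R \<Longrightarrow> Rep_uring x R = Rep_uring y R"
  have "Rep_uring x R = Rep_uring y R" for R
    using Rep_uring[of x] Rep_uring[of y] eq[of R] by (cases "rng R") auto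
  then have "Rep_uring x = Rep_uring y" by (rule ext)
  then show "x = y" by (simp add: Rep_uring_inject)
qed

lemma Rep_uring_carrier: "rng R \<Longrightarrow> Rep_uring x R \<in> carrier R"
  using Rep_uring[of x] by auto

lemma Rep_Abs_uring:
  assumes "\<And>R. rng R \<Longrightarrow> f R \<in> carrier R" "rng R"
  shows "Rep_uring (Abs_uring (\<lambda>R. if rng R then f R else undefined)) R = f R"
  using assms by (subst Abs_uring_inverse) auto

instantiation uring :: (type, type) ring
begin

definition "0 = Abs_uring (\<lambda>R. if rng R then \<zero>\<^bsub>R\<^esub> else undefined)"
definition "x + y = Abs_uring (\<lambda>R. if rng R then Rep_uring x R \<oplus>\<^bsub>R\<^esub> Rep_uring y R else undefined)"
definition "- x = Abs_uring (\<lambda>R. if rng R then \<ominus>\<^bsub>R\<^esub> Rep_uring x R else undefined)"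
definition "x - y = x + - (y :: ('a, 'b) uring)"
definition "x * y = Abs_uring (\<lambda>R. if rng R then Rep_uring x R \<otimes>\<^bsub>R\<^esub> Rep_uring y R else undefined)"

lemma Rep_uring_ops:
  assumes "rng R"
  shows "Rep_uring 0 R = \<zero>\<^bsub>R\<^esub>" "Rep_uring (x + y) R = Rep_uring x R \<oplus>\<^bsub>R\<^esub> Rep_uring y R"
    "Rep_uring (- x) R = \<ominus>\<^bsub>R\<^esub> Rep_uring x R" "Rep_uring (x * y) R = Rep_uring x R \<otimes>\<^bsub>R\<^esub> Rep_uring y R"
proof -
  have ab: "abelian_group S" "abelian_monoid S" if "rng S" for S :: "('a, 'b) ring_scheme"
    using that rng.axioms(1) abelian_group.axioms(1) by blast+
  note c = Rep_uring_carrier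
  show "Rep_uring 0 R = \<zero>\<^bsub>R\<^esub>" unfolding zero_uring_def
    by (rule Rep_Abs_uring[OF _ assms]) (rule abelian_monoid.zero_closed[OF ab(2)])
  show "Rep_uring (x + y) R = Rep_uring x R \<oplus>\<^bsub>R\<^esub> Rep_uring y R" unfolding plus_uring_def
    by (rule Rep_Abs_uring[OF _ assms]) (rule abelian_monoid.a_closed[OF ab(2) c c])
  show "Rep_uring (- x) R = \<ominus>\<^bsub>R\<^esub> Rep_uring x R" unfolding uminus_uring_def
    by (rule Rep_Abs_uring[OF _ assms]) (rule abelian_group.a_inv_closed[OF ab(1) c])
  show "Rep_uring (x * y) R = Rep_uring x R \<otimes>\<^bsub>R\<^esub> Rep_uring y R" unfolding times_uring_def
    by (rule Rep_Abs_uring[OF _ assms]) (rule rng.rng_m_closed[OF _ c c])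
qed

instance
proof
  fix a b c :: "('a, 'b) uring"
  have *: "abelian_group S" "abelian_monoid S" if "rng S" for S :: "('a, 'b) ring_scheme"
    using that rng.axioms(1) abelian_group.axioms(1) by blast+
  note r = Rep_uring_ops Rep_uring_carrier
  show "a + b + c = a + (b + c)"
    by (rule uring_eqI) (simp add: r abelian_monoid.a_assoc[OF *(2)])
  show "a + b = b + a"
    by (rule uring_eqI) (simp add: r abelian_monoid.a_comm[OF *(2)])
  show "0 + a = a"
    by (rule uring_eqI) (simp add: r abelian_monoid.l_zero[OF *(2)])
  show "- a + a = 0"
    by (rule uring_eqI) (simp add: r abelian_group.l_neg[OF *(1)])
  show "a - b = a + - b" by (fact minus_uring_def)
  show "a * b * c = a * (b * c)"
    by (rule uring_eqI) (simp add: r rng.rng_m_assoc)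
  show "(a + b) * c = a * c + b * c"
    by (rule uring_eqI) (simp add: r rng.rng_l_distr)
  show "a * (b + c) = a * b + a * c"
    by (rule uring_eqI) (simp add: r rng.rng_r_distr)
qed

end

definition ring_embedding :: "('a, 'm) ring_scheme \<Rightarrow> ('a \<Rightarrow> 'u::ring) \<Rightarrow> bool" where
  "ring_embedding R \<epsilon> \<longleftrightarrow> inj_on \<epsilon> (carrier R) \<and> \<epsilon> \<zero>\<^bsub>R\<^esub> = 0 \<and>
     (\<forall>x\<in>carrier R. \<epsilon> (\<ominus>\<^bsub>R\<^esub> x) = - \<epsilon> x) \<and>
     (\<forall>x\<in>carrier R. \<forall>y\<in>carrier R. \<epsilon> (x \<oplus>\<^bsub>R\<^esub> y) = \<epsilon> x + \<epsilon> y \<and> \<epsilon> (x \<otimes>\<^bsub>R\<^esub> y) = \<epsilon> x * \<epsilon> y)"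

text \<open>The inclusion of one factor into the product.\<close>

lemma rng_embeds:
  fixes R :: "('a, 'm) ring_scheme"
  assumes R: "rng R"
  obtains \<epsilon> :: "'a \<Rightarrow> ('a, 'm) uring" where "ring_embedding R \<epsilon>"
proof -
  have ab: "abelian_group S" "abelian_monoid S" if "rng S" for S :: "('a, 'm) ring_scheme"
    using that rng.axioms(1) abelian_group.axioms(1) by blast+
  define \<epsilon> where "\<epsilon> a = Abs_uring (\<lambda>S. if rng S then (if S = R then a else \<zero>\<^bsub>S\<^esub>) else undefined)" for a
  have rep: "Rep_uring (\<epsilon> a) S = (if S = R then a else \<zero>\<^bsub>S\<^esub>)" if "a \<in> carrier R" "rng S" for a S
    unfolding \<epsilon>_def by (rule Rep_Abs_uring[OF _ that(2)]) (use that(1) abelian_monoid.zero_closed[OF ab(2)] in auto)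
  note cl = abelian_monoid.a_closed[OF ab(2)] abelian_group.a_inv_closed[OF ab(1)] rng.rng_m_closed
    abelian_monoid.zero_closed[OF ab(2)]
  have z: "\<zero>\<^bsub>S\<^esub> \<oplus>\<^bsub>S\<^esub> \<zero>\<^bsub>S\<^esub> = \<zero>\<^bsub>S\<^esub>" "\<ominus>\<^bsub>S\<^esub> \<zero>\<^bsub>S\<^esub> = \<zero>\<^bsub>S\<^esub>" "\<zero>\<^bsub>S\<^esub> \<otimes>\<^bsub>S\<^esub> \<zero>\<^bsub>S\<^esub> = \<zero>\<^bsub>S\<^esub>" if S: "rng S" for S :: "('a, 'm) ring_scheme"
  proof -
    show 1: "\<zero>\<^bsub>S\<^esub> \<oplus>\<^bsub>S\<^esub> \<zero>\<^bsub>S\<^esub> = \<zero>\<^bsub>S\<^esub>" using abelian_monoid.l_zero[OF ab(2)[OF S]] cl(4)[OF S] by blast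
    have "Rep_uring (- 0) S = Rep_uring 0 S" by simp
    then show "\<ominus>\<^bsub>S\<^esub> \<zero>\<^bsub>S\<^esub> = \<zero>\<^bsub>S\<^esub>" by (simp only: Rep_uring_ops[OF S])
    have "Rep_uring (0 * 0) S = Rep_uring 0 S" by simp
    then show "\<zero>\<^bsub>S\<^esub> \<otimes>\<^bsub>S\<^esub> \<zero>\<^bsub>S\<^esub> = \<zero>\<^bsub>S\<^esub>" by (simp only: Rep_uring_ops[OF S])
  qed
  have "ring_embedding R \<epsilon>" unfolding ring_embedding_def
  proof (intro conjI ballI)
    show "inj_on \<epsilon> (carrier R)"
    proof
      fix x y assume xy: "x \<in> carrier R" "y \<in> carrier R" "\<epsilon> x = \<epsilon> y"
      have "x = Rep_uring (\<epsilon> x) R" using rep[OF xy(1) R] by simp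
      also have "\<dots> = Rep_uring (\<epsilon> y) R" by (simp only: xy(3))
      also have "\<dots> = y" using rep[OF xy(2) R] by simp
      finally show "x = y" .
    qed
    show "\<epsilon> \<zero>\<^bsub>R\<^esub> = 0" by (rule uring_eqI) (simp add: rep cl(4)[OF R] Rep_uring_ops)
    fix x assume x: "x \<in> carrier R"
    show "\<epsilon> (\<ominus>\<^bsub>R\<^esub> x) = - \<epsilon> x" by (rule uring_eqI) (simp add: rep x cl(2)[OF R] Rep_uring_ops z)
    fix y assume y: "y \<in> carrier R"
    show "\<epsilon> (x \<oplus>\<^bsub>R\<^esub> y) = \<epsilon> x + \<epsilon> y" by (rule uring_eqI) (simp add: rep x y cl(1)[OF R] Rep_uring_ops z)
    show "\<epsilon> (x \<otimes>\<^bsub>R\<^esub> y) = \<epsilon> x * \<epsilon> y" by (rule uring_eqI) (simp add: rep x y cl(3)[OF R] Rep_uring_ops z)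
  qed
  then show thesis by (rule that)
qed

text \<open>The two readings of the word ring, each with its language.\<close>

definition ring_language :: "('a, 'm) ring_scheme \<Rightarrow> ring_symbol signature \<Rightarrow> bool" where
  "ring_language R L \<longleftrightarrow> rng R \<and> L = rng_signature \<or> ring R \<and> L = unital_ring_signature"

lemma ring_language_rng: "ring_language R L \<Longrightarrow> rng R"
  unfolding ring_language_def
proof (elim disjE conjE)
  assume "ring R"
  interpret ring R by fact
  show "rng R" by unfold_locales (auto simp: m_assoc l_distr r_distr)
qed

lemma ring_language_symbols:
  assumes "ring_language R L"
  shows "L Zero = Some 0" "L Plus = Some 2" "L Neg = Some 1" "L Times = Some 2"
    "L One = Some n \<Longrightarrow> n = 0 \<and> ring R" "countable (dom L)"
proof -
  show "L Zero = Some 0" "L Plus = Some 2" "L Neg = Some 1" "L Times = Some 2" "L One = Some n \<Longrightarrow> n = 0 \<and> ring R"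
    using assms by (auto simp: ring_language_def rng_signature_def unital_ring_signature_def)
  have "dom L \<subseteq> {Zero, Plus, Neg, Times, One}" using ring_symbol.exhaust by blast
  then have "finite (dom L)" by (rule finite_subset) simp
  then show "countable (dom L)" by (rule countable_finite)
qed

text \<open>Turns the statements about all operation symbols in the definitions of universal algebra into finitely many
statements about the ring operations.\<close>

lemma all_ring_ops:
  assumes L: "ring_language R L"
  shows "(\<forall>f xs. L f = Some (length xs) \<and> set xs \<subseteq> S \<longrightarrow> Q f xs) \<longleftrightarrow>
    Q Zero [] \<and> (\<forall>x\<in>S. \<forall>y\<in>S. Q Plus [x, y]) \<and> (\<forall>x\<in>S. Q Neg [x]) \<and> (\<forall>x\<in>S. \<forall>y\<in>S. Q Times [x, y]) \<and>
    (L One = Some 0 \<longrightarrow> Q One [])" (is "?l \<longleftrightarrow> ?r")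
proof
  assume l: ?l
  then have l': "L f = Some (length xs) \<Longrightarrow> set xs \<subseteq> S \<Longrightarrow> Q f xs" for f xs by blast
  show ?r using ring_language_symbols(1-4)[OF L] by (auto intro!: l')
next
  assume r: ?r
  show ?l
  proof (intro allI impI)
    fix f xs assume a: "L f = Some (length xs) \<and> set xs \<subseteq> S"
    show "Q f xs"
    proof (cases f)
      case Zero
      then show ?thesis using a r ring_language_symbols(1)[OF L] by simp
    next
      case Plus
      then have "length xs = 2" using a ring_language_symbols(2)[OF L] by simp
      then obtain x y where "xs = [x, y]" by (auto simp: length_Suc_conv numeral_2_eq_2)
      then show ?thesis using a r Plus by simp
    next
      case Neg
      then have "length xs = 1" using a ring_language_symbols(3)[OF L] by simp
      then obtain x where "xs = [x]" by (auto simp: length_Suc_conv)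
      then show ?thesis using a r Neg by simp
    next
      case Times
      then have "length xs = 2" using a ring_language_symbols(4)[OF L] by simp
      then obtain x y where "xs = [x, y]" by (auto simp: length_Suc_conv numeral_2_eq_2)
      then show ?thesis using a r Times by simp
    next
      case One
      then have "length xs = 0" using a ring_language_symbols(5)[OF L] by blast
      then show ?thesis using a r One by simp
    qed
  qed
qed

lemma ring_algebra_simps [simp]:
  "univ (ring_algebra R) = carrier R" "interp (ring_algebra R) Zero xs = \<zero>\<^bsub>R\<^esub>"
  "interp (ring_algebra R) Plus [x, y] = x \<oplus>\<^bsub>R\<^esub> y" "interp (ring_algebra R) Neg [x] = \<ominus>\<^bsub>R\<^esub> x"
  "interp (ring_algebra R) Times [x, y] = x \<otimes>\<^bsub>R\<^esub> y" "interp (ring_algebra R) One xs = \<one>\<^bsub>R\<^esub>"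
  by (simp_all add: ring_algebra_def)

lemma closed_under_ring:
  assumes "ring_language R L"
  shows "closed_under L B S \<longleftrightarrow> interp B Zero [] \<in> S \<and> (\<forall>x\<in>S. \<forall>y\<in>S. interp B Plus [x, y] \<in> S) \<and>
    (\<forall>x\<in>S. interp B Neg [x] \<in> S) \<and> (\<forall>x\<in>S. \<forall>y\<in>S. interp B Times [x, y] \<in> S) \<and> (L One = Some 0 \<longrightarrow> interp B One [] \<in> S)"
  unfolding closed_under_def by (rule all_ring_ops[OF assms])

lemma Hom_ring:
  assumes "ring_language R L"
  shows "h \<in> Hom L B (ring_algebra R) \<longleftrightarrow> h \<in> univ B \<rightarrow>\<^sub>E carrier R \<and> h (interp B Zero []) = \<zero>\<^bsub>R\<^esub> \<and>
    (\<forall>x\<in>univ B. \<forall>y\<in>univ B. h (interp B Plus [x, y]) = h x \<oplus>\<^bsub>R\<^esub> h y) \<and>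
    (\<forall>x\<in>univ B. h (interp B Neg [x]) = \<ominus>\<^bsub>R\<^esub> h x) \<and>
    (\<forall>x\<in>univ B. \<forall>y\<in>univ B. h (interp B Times [x, y]) = h x \<otimes>\<^bsub>R\<^esub> h y) \<and>
    (L One = Some 0 \<longrightarrow> h (interp B One []) = \<one>\<^bsub>R\<^esub>)"
  unfolding Hom_iff all_ring_ops[OF assms] by simp

lemma ring_algebra_ualgebra:
  assumes L: "ring_language R L"
  shows "ualgebra L (ring_algebra R)"
proof -
  interpret rng R by (rule ring_language_rng[OF L])
  have "\<one>\<^bsub>R\<^esub> \<in> carrier R" if "L One = Some 0"
    using ring_language_symbols(5)[OF L that] ring.ring_simprules(6) by blast
  then show ?thesis unfolding ualgebra_def closed_under_ring[OF L] using rng_m_closed by auto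
qed


section \<open>Residual smallness\<close>

lemma sum_over_support:
  fixes f :: "'k \<Rightarrow> 'u::ab_group_add"
  assumes "finite S" "{i. f i \<noteq> 0} \<subseteq> S"
  shows "sum f {i. f i \<noteq> 0} = sum f S"
  by (rule sum.mono_neutral_left) (use assms in auto)

text \<open>Suppose \<open>t = a * b\<close> is not zero.  In the power of \<open>R\<close> with exponent \<open>'k\<close> consider the subring \<open>P\<close> of those \<open>p\<close> by which
\<open>t\<close> is multiplied, from both sides and in all coordinates, to one and the same multiple of \<open>t\<close>; it contains the copies of \<open>a\<close> and \<open>b\<close> in single
coordinates and, in the unital case, the unit.  The tuples of multiples of \<open>t\<close> with finite support and sum zero form an ideal
\<open>Z\<close> of \<open>P\<close>, modulo which all copies of \<open>t\<close> coincide.  Let \<open>I\<close> be an ideal above \<open>Z\<close> that is maximal without these copies.  Then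
\<open>P / I\<close> is subdirectly irreducible and lies in the variety, and the copies of \<open>a\<close> are distinct in it: the difference of two
of them, multiplied by a copy of \<open>b\<close>, is a copy of \<open>t\<close>.  So \<open>P / I\<close> is at least as large as \<open>'k\<close>, on which the residual bound
lives.\<close>

lemma residually_small_products_vanish:
  fixes R :: "('a, 'm) ring_scheme" (structure) and \<epsilon> :: "'a \<Rightarrow> 'u::ring"
  assumes L: "ring_language R L" and \<epsilon>: "ring_embedding R \<epsilon>"
    and rs: "generates_residually_small TYPE('k) L (ring_algebra R)"
  shows "self_annihilating_products_vanish (\<epsilon> ` carrier R)"
  unfolding self_annihilating_products_vanish_def
proof (intro ballI impI)
  interpret rng R by (rule ring_language_rng[OF L])
  define A where "A = \<epsilon> ` carrier R"
  fix a b assume "a \<in> \<epsilon> ` carrier R" "b \<in> \<epsilon> ` carrier R"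
    and ann: "a * (a * b) = 0 \<and> a * b * a = 0 \<and> b * (a * b) = 0 \<and> a * b * b = 0"
  then have ab: "a \<in> A" "b \<in> A" by (simp_all add: A_def)
  define t where "t = a * b"
  have t0: "t * a = 0" "a * t = 0" "t * b = 0" "b * t = 0" using ann by (simp_all add: t_def)
  have e: "inj_on \<epsilon> (carrier R)" "\<epsilon> \<zero> = 0" "\<And>x. x \<in> carrier R \<Longrightarrow> \<epsilon> (\<ominus> x) = - \<epsilon> x"
    "\<And>x y. x \<in> carrier R \<Longrightarrow> y \<in> carrier R \<Longrightarrow> \<epsilon> (x \<oplus> y) = \<epsilon> x + \<epsilon> y"
    "\<And>x y. x \<in> carrier R \<Longrightarrow> y \<in> carrier R \<Longrightarrow> \<epsilon> (x \<otimes> y) = \<epsilon> x * \<epsilon> y"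
    using \<epsilon> by (auto simp: ring_embedding_def)
  define \<delta> where "\<delta> = inv_into (carrier R) \<epsilon>"
  have \<delta>: "\<delta> (\<epsilon> x) = x" if "x \<in> carrier R" for x using inv_into_f_f[OF e(1) that] by (simp add: \<delta>_def)
  have \<delta>A: "\<delta> x \<in> carrier R" "\<epsilon> (\<delta> x) = x" if "x \<in> A" for x using that \<delta> by (auto simp: A_def)
  have AI: "x \<in> A" if "y \<in> carrier R" "x = \<epsilon> y" for x y using that by (simp add: A_def)
  have A: "0 \<in> A" "x + y \<in> A" "- x \<in> A" "x - y \<in> A" "x * y \<in> A" if "x \<in> A" "y \<in> A" for x y
  proof -
    note xy = \<delta>A[OF that(1)] \<delta>A[OF that(2)]
    show "0 \<in> A" by (rule AI[OF zero_closed]) (simp add: e)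
    show "x + y \<in> A" by (rule AI[of "\<delta> x \<oplus> \<delta> y"]) (simp_all add: e xy)
    show "- x \<in> A" by (rule AI[of "\<ominus> \<delta> x"]) (simp_all add: e xy)
    show "x - y \<in> A" by (rule AI[of "\<delta> x \<oplus> \<ominus> \<delta> y"]) (simp_all add: e xy)
    show "x * y \<in> A" by (rule AI[of "\<delta> x \<otimes> \<delta> y"]) (simp_all add: e xy rng_m_closed)
  qed
  have tA: "t \<in> A" using A(5)[OF ab] by (simp add: t_def)
  \<comment> \<open>the multiples of \<open>t\<close>\<close>
  define T where "T = \<Inter>{H. subgrp H \<and> t \<in> H}"
  have T_least: "T \<subseteq> H" if "subgrp H" "t \<in> H" for H using that by (auto simp: T_def)
  have T: "subgrp T" "t \<in> T" by (auto simp: T_def subgrp_def)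
  have "subgrp A" using A(1)[OF tA tA] A(2,4) by (simp add: subgrp_def)
  then have TA: "T \<subseteq> A" using T_least tA by blast
  have tt: "t * t = 0" using t0 by (simp add: t_def mult.assoc)
  have "T \<subseteq> {s. t * s = 0 \<and> s * t = 0}" by (rule T_least) (auto simp: subgrp_def tt algebra_simps)
  then have tT: "t * s = 0" "s * t = 0" if "s \<in> T" for s using that by auto
  define P where "P = {p :: 'k \<Rightarrow> 'u. (\<forall>i. p i \<in> A) \<and> (\<exists>c\<in>T. \<forall>i. t * p i = c \<and> p i * t = c)}"
  have scalar: "\<exists>d\<in>T. \<forall>i. s * p i = d \<and> p i * s = d" if p: "p \<in> P" and s: "s \<in> T" for p s
  proof -
    \<comment> \<open>the condition on \<open>s\<close> is additive and holds for \<open>t\<close>\<close>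
    have "subgrp {s. \<exists>d\<in>T. \<forall>i. s * p i = d \<and> p i * s = d}" (is "subgrp ?H")
      unfolding subgrp_def
    proof (intro conjI ballI)
      show "0 \<in> ?H" using subgrpD(1)[OF T(1)] by auto
      fix x y assume "x \<in> ?H" "y \<in> ?H"
      then obtain c d where cd: "c \<in> T" "\<forall>i. x * p i = c \<and> p i * x = c" "d \<in> T" "\<forall>i. y * p i = d \<and> p i * y = d" by blast
      show "x + y \<in> ?H" using cd subgrpD(2)[OF T(1) cd(1,3)]
        by (auto simp: distrib_left distrib_right intro!: bexI[of _ "c + d"])
      show "x - y \<in> ?H" using cd subgrpD(3)[OF T(1) cd(1,3)]
        by (auto simp: left_diff_distrib right_diff_distrib intro!: bexI[of _ "c - d"])
    qed
    moreover have "t \<in> ?H" using p by (auto simp: P_def)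
    ultimately show ?thesis using T_least s by blast
  qed
  have PA: "p i \<in> A" if "p \<in> P" for p i using that by (simp add: P_def)
  have PI: "p \<in> P" if "\<And>i. p i \<in> A" "c \<in> T" "\<And>i. t * p i = c" "\<And>i. p i * t = c" for p c
    using that by (auto simp: P_def)
  have Pc: "\<exists>c\<in>T. \<forall>i. t * p i = c \<and> p i * t = c" if "p \<in> P" for p using that by (simp add: P_def)
  have P0: "0 \<in> P" by (rule PI[of _ 0]) (simp_all add: A[OF tA tA] subgrpD(1)[OF T(1)])
  have Pops: "p + q \<in> P" "p - q \<in> P" "p * q \<in> P" if pq: "p \<in> P" "q \<in> P" for p q
  proof -
    obtain c d where cd: "c \<in> T" "\<And>i. t * p i = c" "\<And>i. p i * t = c" "d \<in> T" "\<And>i. t * q i = d" "\<And>i. q i * t = d"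
      using Pc[OF pq(1)] Pc[OF pq(2)] by blast
    show "p + q \<in> P" by (rule PI[OF _ subgrpD(2)[OF T(1) cd(1,4)]])
      (simp_all add: A PA pq distrib_left distrib_right cd)
    show "p - q \<in> P" by (rule PI[OF _ subgrpD(3)[OF T(1) cd(1,4)]])
      (simp_all add: minus_apply A PA pq left_diff_distrib right_diff_distrib cd)
    obtain d' where d': "d' \<in> T" "\<And>i. c * q i = d'" "\<And>i. q i * c = d'" using scalar[OF pq(2) cd(1)] by blast
    show "p * q \<in> P"
    proof (rule PI[OF _ d'(1)])
      fix i
      show "(p * q) i \<in> A" by (simp add: A PA pq)
      show "t * (p * q) i = d'" using cd(2)[of i] d'(2)[of i] by (simp flip: mult.assoc)
      have "p i * (q i * t) = p i * (t * q i)" by (simp add: cd(5,6))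
      also have "\<dots> = c * q i" using cd(3)[of i] by (simp flip: mult.assoc)
      finally show "(p * q) i * t = d'" using d'(2)[of i] by (simp add: mult.assoc)
    qed
  qed
  have Pneg: "- p \<in> P" if "p \<in> P" for p using Pops(2)[OF P0 that] by simp
  define spike where "spike i x = (\<lambda>j. if j = i then x else 0)" for i :: 'k and x :: 'u
  have spike_mult: "spike i x * spike j y = (if i = j then spike i (x * y) else 0)" for i j x y
    by (auto simp: spike_def fun_eq_iff)
  have spikeP: "spike i x \<in> P" if "x \<in> {a, b}" for i x
    by (rule PI[of _ 0]) (use that ab t0 A(1)[OF tA tA] subgrpD(1)[OF T(1)] in \<open>auto simp: spike_def\<close>)
  define Z where "Z = {z :: 'k \<Rightarrow> 'u. finite {i. z i \<noteq> 0} \<and> (\<forall>i. z i \<in> T) \<and> sum z {i. z i \<noteq> 0} = 0}"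
  have ZP: "Z \<subseteq> P" using TA tT subgrpD(1)[OF T(1)] by (auto simp: Z_def intro!: PI[of _ 0])
  have Zg: "subgrp Z" unfolding subgrp_def
  proof (intro conjI ballI)
    show "0 \<in> Z" using subgrpD(1)[OF T(1)] by (simp add: Z_def)
    fix x y assume xy: "x \<in> Z" "y \<in> Z"
    define S where "S = {i. x i \<noteq> 0} \<union> {i. y i \<noteq> 0}"
    have S: "finite S" "{i. x i \<noteq> 0} \<subseteq> S" "{i. y i \<noteq> 0} \<subseteq> S" "{i. (x + y) i \<noteq> 0} \<subseteq> S" "{i. (x - y) i \<noteq> 0} \<subseteq> S"
      using xy by (auto simp: S_def Z_def minus_apply)
    have s: "sum x S = 0" "sum y S = 0" using xy sum_over_support[OF S(1,2)] sum_over_support[OF S(1,3)] by (simp_all add: Z_def)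
    have "sum (x + y) S = 0" "sum (x - y) S = 0" using s by (simp_all add: sum.distrib sum_subtractf minus_apply)
    then show "x + y \<in> Z" "x - y \<in> Z"
      using xy sum_over_support[OF S(1,4)] sum_over_support[OF S(1,5)] finite_subset[OF S(4,1)] finite_subset[OF S(5,1)]
        subgrpD(2,3)[OF T(1)] by (auto simp: Z_def minus_apply)
  qed
  have ZM: "p * z \<in> Z \<and> z * p \<in> Z" if p: "p \<in> P" and z: "z \<in> Z" for p z
  proof -
    define S where "S = {i. z i \<noteq> 0}"
    have S: "finite S" "sum z S = 0" "\<And>i. z i \<in> T" using z by (auto simp: Z_def S_def)
    have pz: "p i * z i \<in> T" "z i * p i = p i * z i" "p i * z i = p j * z i" for i j
      using scalar[OF p S(3)[of i]] by metis+
    have comm: "z * p = p * z" using pz(2) by (simp add: fun_eq_iff)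
    have sup: "{i. (p * z) i \<noteq> 0} \<subseteq> S" by (auto simp: S_def)
    \<comment> \<open>\<open>undefined\<close> is an arbitrary index: all coordinates of \<open>p\<close> act alike on multiples of \<open>t\<close>\<close>
    have "sum (p * z) S = (\<Sum>i\<in>S. p undefined * z i)" using pz(3)[of _ undefined] by (intro sum.cong) auto
    also have "\<dots> = 0" using S(2) by (simp flip: sum_distrib_left)
    finally have "p * z \<in> Z" using sum_over_support[OF S(1) sup] finite_subset[OF sup S(1)] pz(1) by (simp add: Z_def)
    then show ?thesis by (simp add: comm)
  qed
  have spikeZ: "spike i t - spike j t \<in> Z" for i j
  proof (cases "i = j")
    case True
    then show ?thesis using subgrpD(1)[OF Zg] by simp
  next
    case False
    define z where "z = spike i t - spike j t"
    have sup: "{k. z k \<noteq> 0} \<subseteq> {i, j}" by (auto simp: z_def spike_def minus_apply split: if_splits)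
    have "sum z {i, j} = 0" using False by (simp add: z_def spike_def minus_apply)
    moreover have "z k \<in> T" for k using subgrpD[OF T(1)] T(2) by (auto simp: z_def spike_def minus_apply)
    ultimately show ?thesis using sum_over_support[OF _ sup] finite_subset[OF sup] by (simp add: Z_def z_def)
  qed
  show "a * b = 0"
  proof (rule ccontr)
    assume "a * b \<noteq> 0"
    then have tne: "t \<noteq> 0" by (simp add: t_def)
    \<comment> \<open>one copy of \<open>t\<close>, at an arbitrary index; modulo \<open>Z\<close> it represents all of them\<close>
    define t1 where "t1 = spike undefined t"
    have t1Z: "t1 \<notin> Z"
    proof
      assume "t1 \<in> Z"
      moreover have "sum t1 {i. t1 i \<noteq> 0} = sum t1 {undefined}"
        by (rule sum_over_support) (auto simp: t1_def spike_def split: if_splits)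
      ultimately show False using tne by (simp add: Z_def t1_def spike_def)
    qed
    define ideal where "ideal I \<longleftrightarrow> subgrp I \<and> Z \<subseteq> I \<and> I \<subseteq> P \<and> t1 \<notin> I \<and> (\<forall>p\<in>P. \<forall>x\<in>I. p * x \<in> I \<and> x * p \<in> I)" for I
    have "\<exists>I\<in>Collect ideal. \<forall>X\<in>Collect ideal. I \<subseteq> X \<longrightarrow> X = I"
    proof (rule subset_Zorn_nonempty)
      show "Collect ideal \<noteq> {}" using Zg ZP t1Z ZM by (auto simp: ideal_def)
      fix \<C> assume ne: "\<C> \<noteq> {}" and ch: "subset.chain (Collect ideal) \<C>"
      then have id: "ideal I" if "I \<in> \<C>" for I using that by (auto simp: subset.chain_def)
      have two: "\<exists>I\<in>\<C>. x \<in> I \<and> y \<in> I" if xy: "x \<in> \<Union>\<C>" "y \<in> \<Union>\<C>" for x y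
      proof -
        obtain I J where IJ: "I \<in> \<C>" "x \<in> I" "J \<in> \<C>" "y \<in> J" using xy by blast
        then have "I \<subseteq> J \<or> J \<subseteq> I" using ch by (auto simp: subset_chain_def)
        then show ?thesis using IJ by blast
      qed
      have "subgrp (\<Union>\<C>)" unfolding subgrp_def
      proof (intro conjI ballI)
        show "0 \<in> \<Union>\<C>" using ne id by (auto simp: ideal_def subgrp_def)
        fix x y assume "x \<in> \<Union>\<C>" "y \<in> \<Union>\<C>"
        then obtain I where "I \<in> \<C>" "x \<in> I" "y \<in> I" using two by blast
        then show "x + y \<in> \<Union>\<C>" "x - y \<in> \<Union>\<C>" using id[of I] by (auto simp: ideal_def subgrp_def)
      qed
      moreover have "p * x \<in> \<Union>\<C> \<and> x * p \<in> \<Union>\<C>" if "p \<in> P" "x \<in> \<Union>\<C>" for p x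
        using that id by (auto simp: ideal_def)
      moreover have "Z \<subseteq> X" "X \<subseteq> P" "t1 \<notin> X" if "X \<in> \<C>" for X using id[OF that] by (simp_all add: ideal_def)
      then have "Z \<subseteq> \<Union>\<C>" "\<Union>\<C> \<subseteq> P" "t1 \<notin> \<Union>\<C>" using ne by blast+
      ultimately show "\<Union>\<C> \<in> Collect ideal" by (simp add: ideal_def)
    qed
    then obtain I where I: "ideal I" and max: "\<And>J. ideal J \<Longrightarrow> I \<subseteq> J \<Longrightarrow> J = I" by blast
    have Ig: "subgrp I" and ZI: "Z \<subseteq> I" and IP: "I \<subseteq> P" and t1I: "t1 \<notin> I"
      and IM: "\<And>p x. p \<in> P \<Longrightarrow> x \<in> I \<Longrightarrow> p * x \<in> I \<and> x * p \<in> I"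
      using I by (auto simp: ideal_def)
    define u where "u = (\<lambda>_::'k. \<epsilon> \<one>)"
    define Pa where "Pa = \<lparr>univ = P, interp = (\<lambda>f xs. case f of Zero \<Rightarrow> 0 | Plus \<Rightarrow> xs ! 0 + xs ! 1
      | Neg \<Rightarrow> - (xs ! 0) | Times \<Rightarrow> xs ! 0 * xs ! 1 | One \<Rightarrow> u)\<rparr>"
    have Pa [simp]: "univ Pa = P" "interp Pa Zero xs = 0" "interp Pa Plus [x, y] = x + y" "interp Pa Neg [x] = - x"
      "interp Pa Times [x, y] = x * y" "interp Pa One xs = u" for x y xs by (simp_all add: Pa_def)
    have uone: "u \<in> P \<and> \<one> \<in> carrier R" if "L One = Some 0"
    proof -
      have "ring R" using ring_language_symbols(5)[OF L that] by blast
      then interpret r: ring R .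
      have "\<epsilon> \<one> * \<epsilon> x = \<epsilon> x \<and> \<epsilon> x * \<epsilon> \<one> = \<epsilon> x" if "x \<in> carrier R" for x using that by (simp flip: e(5))
      then have "t * \<epsilon> \<one> = t" "\<epsilon> \<one> * t = t" using tA by (auto simp: A_def)
      then show ?thesis using T(2) by (auto simp: u_def A_def intro!: PI[of _ t])
    qed
    have clP: "closed_under L Pa P" unfolding closed_under_ring[OF L]
      using P0 Pops Pneg uone by auto
    define cls where "cls p = {q \<in> P. q - p \<in> I}" for p
    have cls_eq: "cls p = cls q \<longleftrightarrow> p - q \<in> I" if "p \<in> P" "q \<in> P" for p q
    proof
      assume "cls p = cls q"
      moreover have "p \<in> cls p" using that subgrpD(1)[OF Ig] by (simp add: cls_def)
      ultimately show "p - q \<in> I" by (simp add: cls_def)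
    next
      assume pq: "p - q \<in> I"
      have "x - p \<in> I \<longleftrightarrow> x - q \<in> I" for x
        using subgrpD(2)[OF Ig, of "x - p" "p - q"] subgrpD(3)[OF Ig, of "x - q" "p - q"] pq by auto
      then show "cls p = cls q" by (simp add: cls_def)
    qed
    define rep where "rep c = (SOME p. p \<in> P \<and> cls p = c)" for c
    have rep: "rep (cls p) \<in> P" "cls (rep (cls p)) = cls p" if "p \<in> P" for p
      using someI[of "\<lambda>q. q \<in> P \<and> cls q = cls p" p] that by (auto simp: rep_def)
    have repI: "rep (cls p) - p \<in> I" if "p \<in> P" for p using cls_eq[OF rep(1)[OF that] that] rep(2)[OF that] by simp
    define Q where "Q = \<lparr>univ = cls ` P, interp = (\<lambda>f cs. cls (interp Pa f (map rep cs)))\<rparr>"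
    have Qop: "interp Q f (map cls xs) = cls (interp Pa f xs)"
      if "L f = Some (length xs)" "set xs \<subseteq> P" for f xs
    proof -
      have "\<forall>f xs. L f = Some (length xs) \<and> set xs \<subseteq> P \<longrightarrow> interp Q f (map cls xs) = cls (interp Pa f xs)"
        unfolding all_ring_ops[OF L]
      proof (intro conjI ballI impI)
        show "interp Q Zero (map cls []) = cls (interp Pa Zero [])" "interp Q One (map cls []) = cls (interp Pa One [])"
          by (simp_all add: Q_def)
        fix x assume x: "x \<in> P"
        have "x - rep (cls x) \<in> I" using subgrpD(4)[OF Ig repI[OF x]] by simp
        then show "interp Q Neg (map cls [x]) = cls (interp Pa Neg [x])"
          using x rep by (simp add: Q_def cls_eq Pneg)
        fix y assume y: "y \<in> P"
        have "rep (cls x) + rep (cls y) - (x + y) \<in> I"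
          using subgrpD(2)[OF Ig repI[OF x] repI[OF y]] by (simp add: algebra_simps)
        then show "interp Q Plus (map cls [x, y]) = cls (interp Pa Plus [x, y])"
          using x y rep by (simp add: Q_def cls_eq Pops)
        have "rep (cls x) * rep (cls y) - x * y \<in> I"
          using subgrpD(2)[OF Ig conjunct2[OF IM[OF rep(1)[OF y] repI[OF x]]] conjunct1[OF IM[OF x repI[OF y]]]]
          by (simp add: algebra_simps)
        then show "interp Q Times (map cls [x, y]) = cls (interp Pa Times [x, y])"
          using x y rep by (simp add: Q_def cls_eq Pops)
      qed
      then show ?thesis using that by blast
    qed
    have Quniv: "univ Q = cls ` P" by (simp add: Q_def)
    have algQ: "ualgebra L Q" unfolding ualgebra_def closed_under_def
    proof (intro conjI allI impI)
      show "univ Q \<noteq> {}" using P0 by (auto simp: Quniv)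
      fix f cs assume a: "L f = Some (length cs) \<and> set cs \<subseteq> univ Q"
      then have "set (map rep cs) \<subseteq> P" using rep by (auto simp: Quniv)
      then have "interp Pa f (map rep cs) \<in> P" using clP a by (simp add: closed_under_def)
      then show "interp Q f cs \<in> univ Q" by (simp add: Q_def)
    qed
    \<comment> \<open>each coordinate is a homomorphism to the ring, so that \<open>P\<close> satisfies its identities\<close>
    have coord: "interp (ring_algebra R) f (map (\<lambda>x. \<delta> (x i)) xs) \<in> carrier R \<and>
        interp Pa f xs i = \<epsilon> (interp (ring_algebra R) f (map (\<lambda>x. \<delta> (x i)) xs))"
      if "L f = Some (length xs)" "set xs \<subseteq> P" for f xs i
    proof -
      have "\<forall>f xs. L f = Some (length xs) \<and> set xs \<subseteq> P \<longrightarrow>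
        interp (ring_algebra R) f (map (\<lambda>x. \<delta> (x i)) xs) \<in> carrier R \<and>
        interp Pa f xs i = \<epsilon> (interp (ring_algebra R) f (map (\<lambda>x. \<delta> (x i)) xs))"
        unfolding all_ring_ops[OF L]
        using \<delta>A[OF PA] uone by (auto simp: e rng_m_closed u_def)
      then show ?thesis using that by blast
    qed
    have ev: "eval_trm Pa \<tau> s \<in> P \<and> eval_trm Q \<sigma> s = cls (eval_trm Pa \<tau> s) \<and>
      (\<forall>i. eval_trm (ring_algebra R) (\<lambda>n. \<delta> (\<tau> n i)) s = \<delta> (eval_trm Pa \<tau> s i))"
      if \<tau>: "\<And>n. \<tau> n \<in> P \<and> \<sigma> n = cls (\<tau> n)" and "wf_trm L s" for \<tau> \<sigma> s
      using that(2)
    proof (induction s)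
      case (Var n)
      then show ?case using \<tau> by simp
    next
      case (App f ts)
      define xs where "xs = map (eval_trm Pa \<tau>) ts"
      have IH: "eval_trm Pa \<tau> s \<in> P" "eval_trm Q \<sigma> s = cls (eval_trm Pa \<tau> s)"
        "eval_trm (ring_algebra R) (\<lambda>n. \<delta> (\<tau> n i)) s = \<delta> (eval_trm Pa \<tau> s i)" if "s \<in> set ts" for s i
        using App that by auto
      have xs: "L f = Some (length xs)" "set xs \<subseteq> P" using App.prems IH(1) by (auto simp: xs_def)
      have "map (eval_trm Q \<sigma>) ts = map cls xs" using IH(2) by (simp add: xs_def)
      moreover have "map (eval_trm (ring_algebra R) (\<lambda>n. \<delta> (\<tau> n i))) ts = map (\<lambda>x. \<delta> (x i)) xs" for i
        using IH(3) by (simp add: xs_def)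
      moreover have "interp Pa f xs \<in> P" using clP xs by (simp add: closed_under_def)
      moreover have "\<delta> (interp Pa f xs i) = interp (ring_algebra R) f (map (\<lambda>x. \<delta> (x i)) xs)" for i
        using coord[OF xs, of i] \<delta> by simp
      ultimately show ?case using Qop[OF xs] by (simp add: xs_def[symmetric] del: map_map map_eq_conv)
    qed
    have varQ: "in_generated_variety L (ring_algebra R) Q"
      unfolding in_generated_variety_def satisfies_identity_def
    proof (intro conjI allI impI algQ)
      fix s s' and \<sigma> :: "nat \<Rightarrow> ('k \<Rightarrow> 'u) set"
      assume st: "wf_trm L s \<and> wf_trm L s' \<and> (\<forall>\<sigma>. range \<sigma> \<subseteq> univ (ring_algebra R) \<longrightarrow>
        eval_trm (ring_algebra R) \<sigma> s = eval_trm (ring_algebra R) \<sigma> s')" and \<sigma>: "range \<sigma> \<subseteq> univ Q"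
      have \<tau>: "rep (\<sigma> n) \<in> P \<and> \<sigma> n = cls (rep (\<sigma> n))" for n
      proof -
        have "\<sigma> n \<in> cls ` P" using \<sigma> by (auto simp: Quniv)
        then obtain p where p: "p \<in> P" "\<sigma> n = cls p" by blast
        show ?thesis using rep[OF p(1)] by (simp add: p(2))
      qed
      note es = ev[OF \<tau> conjunct1[OF st]] and es' = ev[OF \<tau> conjunct1[OF conjunct2[OF st]]]
      have "eval_trm Pa (\<lambda>n. rep (\<sigma> n)) s i = eval_trm Pa (\<lambda>n. rep (\<sigma> n)) s' i" for i
      proof -
        have "range (\<lambda>n. \<delta> (rep (\<sigma> n) i)) \<subseteq> univ (ring_algebra R)" using \<delta>A(1) PA \<tau> by auto
        then have "eval_trm (ring_algebra R) (\<lambda>n. \<delta> (rep (\<sigma> n) i)) s = eval_trm (ring_algebra R) (\<lambda>n. \<delta> (rep (\<sigma> n) i)) s'"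
          using st by blast
        then have "\<delta> (eval_trm Pa (\<lambda>n. rep (\<sigma> n)) s i) = \<delta> (eval_trm Pa (\<lambda>n. rep (\<sigma> n)) s' i)" using es es' by simp
        then have "\<epsilon> (\<delta> (eval_trm Pa (\<lambda>n. rep (\<sigma> n)) s i)) = \<epsilon> (\<delta> (eval_trm Pa (\<lambda>n. rep (\<sigma> n)) s' i))" by simp
        then show ?thesis by (simp only: \<delta>A(2)[OF PA[OF conjunct1[OF es]]] \<delta>A(2)[OF PA[OF conjunct1[OF es']]])
      qed
      then have "eval_trm Pa (\<lambda>n. rep (\<sigma> n)) s = eval_trm Pa (\<lambda>n. rep (\<sigma> n)) s'" by (rule ext)
      then show "eval_trm Q \<sigma> s = eval_trm Q \<sigma> s'" using es es' by simp
    qed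
    have t1P: "t1 \<in> P"
      by (rule PI[of _ 0]) (use tA tt A(1)[OF tA tA] subgrpD(1)[OF T(1)] in \<open>auto simp: t1_def spike_def\<close>)
    have siQ: "subdirectly_irreducible L Q"
    proof (rule subdirectly_irreducibleI[OF algQ])
      show "cls t1 \<in> univ Q" "cls 0 \<in> univ Q" using t1P P0 by (auto simp: Quniv)
      show "cls t1 \<noteq> cls 0" using cls_eq[OF t1P P0] t1I by simp
      fix \<theta> assume \<theta>: "congruence L Q \<theta>" "\<theta> \<noteq> Id_on (univ Q)"
      show "(cls t1, cls 0) \<in> \<theta>"
      proof (rule ccontr)
        assume nt: "(cls t1, cls 0) \<notin> \<theta>"
        have eq: "equiv (cls ` P) \<theta>" using \<theta>(1) by (simp add: congruence_def Quniv)
        have refl: "(cls p, cls p) \<in> \<theta>" if "p \<in> P" for p using eq that by (auto simp: equiv_def refl_on_def)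
        have trans: "(x, z) \<in> \<theta>" if "(x, y) \<in> \<theta>" "(y, z) \<in> \<theta>" for x y z using eq that by (auto simp: equiv_def dest: transD)
        have op: "(cls (interp Pa f xs), cls (interp Pa f ys)) \<in> \<theta>"
          if "L f = Some (length xs)" "set xs \<subseteq> P" "set ys \<subseteq> P" "list_all2 (\<lambda>x y. (cls x, cls y) \<in> \<theta>) xs ys" for f xs ys
        proof -
          have "list_all2 (\<lambda>x y. (x, y) \<in> \<theta>) (map cls xs) (map cls ys)" using that(4) by (simp add: list_all2_map1 list_all2_map2)
          then have "(interp Q f (map cls xs), interp Q f (map cls ys)) \<in> \<theta>" using \<theta>(1) that(1) by (auto simp: congruence_def)
          moreover have "length ys = length xs" using that(4) by (simp add: list_all2_lengthD)
          ultimately show ?thesis using Qop[of f xs] Qop[of f ys] that by simp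
        qed
        have plus: "(cls (x + y), cls (x' + y')) \<in> \<theta>" and times: "(cls (x * y), cls (x' * y')) \<in> \<theta>"
          if "x \<in> P" "y \<in> P" "x' \<in> P" "y' \<in> P" "(cls x, cls x') \<in> \<theta>" "(cls y, cls y') \<in> \<theta>" for x y x' y'
          using op[of Plus "[x, y]" "[x', y']"] op[of Times "[x, y]" "[x', y']"] ring_language_symbols[OF L] that by simp_all
        have neg: "(cls (- x), cls (- x')) \<in> \<theta>" if "x \<in> P" "x' \<in> P" "(cls x, cls x') \<in> \<theta>" for x x'
          using op[of Neg "[x]" "[x']"] ring_language_symbols[OF L] that by simp
        \<comment> \<open>a nontrivial congruence induces an ideal above \<open>I\<close>, which by maximality contains the copies of \<open>t\<close>\<close>
        define J where "J = {p \<in> P. (cls p, cls 0) \<in> \<theta>}"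
        have Jneg: "- x \<in> J" if "x \<in> J" for x using neg[of x 0] that P0 Pneg by (simp add: J_def)
        have Jplus: "x + y \<in> J" if "x \<in> J" "y \<in> J" for x y
          using plus[of x y 0 0] that P0 Pops by (simp add: J_def)
        have "subgrp J" unfolding subgrp_def
        proof (intro conjI ballI)
          show "0 \<in> J" using P0 refl by (simp add: J_def)
          fix x y assume xy: "x \<in> J" "y \<in> J"
          show "x + y \<in> J" "x - y \<in> J" using Jplus[OF xy] Jplus[OF xy(1) Jneg[OF xy(2)]] by simp_all
        qed
        moreover have IJ: "I \<subseteq> J"
        proof
          fix x assume x: "x \<in> I"
          then have "cls x = cls 0" using cls_eq[of x 0] P0 IP by auto
          then show "x \<in> J" using x IP refl P0 by (auto simp: J_def)
        qed
        moreover have "p * x \<in> J \<and> x * p \<in> J" if "p \<in> P" "x \<in> J" for p x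
          using times[of p x p 0] times[of x p 0 p] that P0 Pops refl by (simp add: J_def)
        ultimately have "ideal J" using ZI nt by (auto simp: ideal_def J_def)
        then have JI: "J = I" using max IJ by blast
        have inQ: "x \<in> cls ` P" "y \<in> cls ` P" if "(x, y) \<in> \<theta>" for x y
          using eq that by (auto simp: equiv_def refl_on_def)
        have xe: "x = y" if xy: "(x, y) \<in> \<theta>" for x y
        proof -
          obtain p q where pq: "p \<in> P" "x = cls p" "q \<in> P" "y = cls q"
            using inQ[OF xy] by blast
          have "(cls (p + - q), cls (q + - q)) \<in> \<theta>"
            by (rule plus) (use pq xy refl Pneg in auto)
          then have "p - q \<in> J" using pq Pops by (simp add: J_def)
          then show ?thesis using cls_eq pq JI by blast
        qed
        have "(x, y) \<in> \<theta> \<longleftrightarrow> (x, y) \<in> Id_on (univ Q)" for x y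
          using xe[of x y] inQ[of x y] refl by (auto simp: Id_on_iff Quniv)
        then have "\<theta> = Id_on (univ Q)" by auto
        then show False using \<theta>(2) by blast
      qed
    qed
    have inj: "inj (\<lambda>i. cls (spike i a))"
    proof (rule injI)
      fix i j assume eq: "cls (spike i a) = cls (spike j a)"
      show "i = j"
      proof (rule ccontr)
        assume ij: "i \<noteq> j"
        have "spike i a - spike j a \<in> I" using eq cls_eq[of "spike i a" "spike j a"] spikeP[of a] by simp
        then have "(spike i a - spike j a) * spike i b \<in> I" using IM[OF spikeP[of b i]] by blast
        then have "spike i t \<in> I" using ij by (simp add: left_diff_distrib spike_mult t_def)
        moreover have "spike undefined t - spike i t \<in> I" using spikeZ ZI by blast
        ultimately have "spike undefined t - spike i t + spike i t \<in> I" by (intro subgrpD(2)[OF Ig])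
        then show False using t1I by (simp add: t1_def)
      qed
    qed
    have card1: "|UNIV :: 'k set| \<le>o |univ Q|"
      by (rule card_of_ordLeqI[OF inj]) (use spikeP[of a] in \<open>simp add: Quniv\<close>)
    obtain c :: "'k rel" where c: "Card_order c" "residual_bound L (ring_algebra R) c"
      using rs by (auto simp: generates_residually_small_def)
    have "|univ Q| <o c" by (rule residual_bound_all_types[OF ring_language_symbols(6)[OF L] c varQ siQ])
    moreover have "c \<le>o |UNIV :: 'k set|"
    proof -
      have "c =o |Field c|" using ordIso_symmetric[OF card_of_Field_ordIso[OF c(1)]] .
      moreover have "|Field c| \<le>o |UNIV :: 'k set|" by (rule card_of_mono1) simp
      ultimately show ?thesis by (rule ordIso_ordLeq_trans)
    qed
    ultimately have "|univ Q| <o |univ Q|" using card1 by (meson ordLess_ordLeq_trans ordLeq_transitive)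
    then show False using ordLess_irreflexive by blast
  qed
qed


section \<open>Local functions on finite algebras\<close>

text \<open>A counterexample is taken on a set \<open>Y\<close> of homomorphisms of least size, over all local functions.  Locality on \<open>k\<close> points makes
\<open>Y\<close> large, and minimality makes the restrictions to \<open>Y\<close> a critical pair.  The homomorphism \<open>h1\<close> that merges \<open>y\<close> and \<open>z\<close> gives a
smaller counterexample \<open>Y'\<close>: for the function \<open>G0\<close> with restriction \<open>f0\<close>, an evaluation on \<open>Y'\<close> would
vanish outside \<open>{y, z}\<close> and hence at \<open>h1\<close>, whereas locality on the four points \<open>h1\<close>, \<open>w\<close>, \<open>y\<close>, \<open>z\<close> forces a nonzero value of \<open>G0\<close> at
\<open>h1\<close>.  These four points account for the summand 4 in the bound.\<close>

lemma finite_local_evaluation: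
  fixes R :: "('a, 'm) ring_scheme" (structure) and B :: "(ring_symbol, 'b) ualg" and \<epsilon> :: "'a \<Rightarrow> 'u::ring"
  assumes L: "ring_language R L" and finR: "finite (carrier R)" and \<epsilon>: "ring_embedding R \<epsilon>"
    and sap: "self_annihilating_products_vanish (\<epsilon> ` carrier R)"
    and B: "ualgebra L B" "finite (univ B)"
    and F: "\<forall>h\<in>Hom L B (ring_algebra R). F h \<in> carrier R"
    and loc: "\<forall>Z. Z \<subseteq> Hom L B (ring_algebra R) \<and> finite Z \<and> card Z \<le> merge_bound (card (carrier R)) + 4 \<longrightarrow>
      (\<exists>b\<in>univ B. \<forall>h\<in>Z. F h = h b)"
  shows "\<exists>b\<in>univ B. \<forall>h\<in>Hom L B (ring_algebra R). F h = h b"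
proof (rule ccontr)
  assume no: "\<not> ?thesis"
  define X where "X = Hom L B (ring_algebra R)"
  define k where "k = merge_bound (card (carrier R)) + 4"
  define A where "A = \<epsilon> ` carrier R"
  define local where "local G \<longleftrightarrow> (\<forall>h\<in>X. G h \<in> carrier R) \<and>
    (\<forall>Z. Z \<subseteq> X \<and> finite Z \<and> card Z \<le> k \<longrightarrow> (\<exists>b\<in>univ B. \<forall>h\<in>Z. G h = h b))" for G
  interpret rng R by (rule ring_language_rng[OF L])
  note hX = Hom_ring[OF L, of _ B, folded X_def]
  have Bc: "interp B Zero [] \<in> univ B" "\<And>x y. x \<in> univ B \<Longrightarrow> y \<in> univ B \<Longrightarrow> interp B Plus [x, y] \<in> univ B"
    "\<And>x. x \<in> univ B \<Longrightarrow> interp B Neg [x] \<in> univ B"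
    "\<And>x y. x \<in> univ B \<Longrightarrow> y \<in> univ B \<Longrightarrow> interp B Times [x, y] \<in> univ B"
    "L One = Some 0 \<Longrightarrow> interp B One [] \<in> univ B"
    using B(1) by (auto simp: ualgebra_def closed_under_ring[OF L])
  have hc: "h x \<in> carrier R" if "h \<in> X" "x \<in> univ B" for h x using that hX by blast
  have h0: "h (interp B Zero []) = \<zero>" if "h \<in> X" for h using that hX by blast
  have hplus: "h (interp B Plus [x, y]) = h x \<oplus> h y" if "h \<in> X" "x \<in> univ B" "y \<in> univ B" for h x y using that hX by blast
  have hneg: "h (interp B Neg [x]) = \<ominus> h x" if "h \<in> X" "x \<in> univ B" for h x using that hX by blast
  have htimes: "h (interp B Times [x, y]) = h x \<otimes> h y" if "h \<in> X" "x \<in> univ B" "y \<in> univ B" for h x y using that hX by blast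
  have hone: "h (interp B One []) = \<one>" if "h \<in> X" "L One = Some 0" for h using that hX by blast
  have e: "inj_on \<epsilon> (carrier R)" "\<epsilon> \<zero> = 0" "\<And>x. x \<in> carrier R \<Longrightarrow> \<epsilon> (\<ominus> x) = - \<epsilon> x"
    "\<And>x y. x \<in> carrier R \<Longrightarrow> y \<in> carrier R \<Longrightarrow> \<epsilon> (x \<oplus> y) = \<epsilon> x + \<epsilon> y"
    "\<And>x y. x \<in> carrier R \<Longrightarrow> y \<in> carrier R \<Longrightarrow> \<epsilon> (x \<otimes> y) = \<epsilon> x * \<epsilon> y"
    using \<epsilon> by (auto simp: ring_embedding_def)
  have em: "\<epsilon> (x \<oplus> \<ominus> y) = \<epsilon> x - \<epsilon> y" if "x \<in> carrier R" "y \<in> carrier R" for x y using that by (simp add: e(3,4))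
  have A: "finite A" "subrng A"
  proof -
    show "finite A" using finR by (simp add: A_def)
    have I: "\<epsilon> x \<in> A" if "x \<in> carrier R" for x using that by (simp add: A_def)
    show "subrng A" unfolding subrng_def
    proof (intro conjI ballI)
      show "0 \<in> A" using I[OF zero_closed] by (simp add: e(2))
      fix a b assume "a \<in> A" "b \<in> A"
      then obtain x y where xy: "x \<in> carrier R" "y \<in> carrier R" "a = \<epsilon> x" "b = \<epsilon> y" by (auto simp: A_def)
      show "a + b \<in> A" using I[of "x \<oplus> y"] xy by (simp add: e(4))
      show "a - b \<in> A" using I[of "x \<oplus> \<ominus> y"] xy by (simp add: em)
      show "a * b \<in> A" using I[of "x \<otimes> y"] xy by (simp add: e(5) rng_m_closed)
    qed
  qed
  have cardA: "card A = card (carrier R)" using card_image[OF e(1)] by (simp add: A_def)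
  have "X \<subseteq> univ B \<rightarrow>\<^sub>E carrier R" using hX by blast
  then have finX: "finite X" using finite_PiE[OF B(2)] finR by (meson finite_subset)
  define bad where "bad n \<longleftrightarrow> (\<exists>Y G. Y \<subseteq> X \<and> card Y = n \<and> local G \<and> \<not> (\<exists>b\<in>univ B. \<forall>h\<in>Y. G h = h b))" for n
  have "bad (card X)" unfolding bad_def
    by (intro exI[of _ X] exI[of _ F]) (use F loc no in \<open>auto simp: local_def X_def k_def\<close>)
  then have least: "bad (Least bad)" "\<And>m. m < Least bad \<Longrightarrow> \<not> bad m" by (auto intro: LeastI dest: not_less_Least)
  then obtain Y G1 where Y: "Y \<subseteq> X" "card Y = Least bad" "local G1" "\<not> (\<exists>b\<in>univ B. \<forall>h\<in>Y. G1 h = h b)"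
    unfolding bad_def[of "Least bad"] by blast
  have finY: "finite Y" using Y(1) finX by (rule finite_subset)
  have small: "\<exists>b\<in>univ B. \<forall>h\<in>Y'. G h = h b" if "local G" "Y' \<subseteq> X" "card Y' < card Y" for G Y'
    using least(2)[of "card Y'"] that Y(2) unfolding bad_def by metis
  have "card Y > k" using Y(1,3,4) finY unfolding local_def by (meson not_le)
  then have big: "card Y > merge_bound (card A)" "card Y \<ge> 3" by (simp_all add: k_def cardA)
  define \<iota> where "\<iota> G = (\<lambda>h. if h \<in> Y then \<epsilon> (G h) else 0)" for G :: "('b \<Rightarrow> 'a) \<Rightarrow> 'a"
  define ev where "ev b = \<iota> (\<lambda>h. h b)" for b
  define C where "C = ev ` univ B"
  define FF where "FF = \<iota> ` Collect local"
  have lc: "G h \<in> carrier R" if "local G" "h \<in> X" for G h using that by (simp add: local_def)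
  have ll: "\<exists>b\<in>univ B. \<forall>h\<in>Z. G h = h b" if "local G" "Z \<subseteq> X" "finite Z" "card Z \<le> k" for G Z
    using that by (simp add: local_def)
  have lev: "local (\<lambda>h. h b)" if "b \<in> univ B" for b using that hc by (auto simp: local_def)
  have \<iota>add: "\<iota> (\<lambda>h. G h \<oplus> G' h) = \<iota> G + \<iota> G'" "\<iota> (\<lambda>h. G h \<oplus> \<ominus> G' h) = \<iota> G - \<iota> G'"
    "\<iota> (\<lambda>h. G h \<otimes> G' h) = \<iota> G * \<iota> G'" if "local G" "local G'" for G G'
    using lc[OF that(1)] lc[OF that(2)] Y(1) by (auto simp: \<iota>_def fun_eq_iff e(3,4,5) em minus_apply subset_iff)
  have evop: "ev (interp B Plus [b, c]) = ev b + ev c" "ev (interp B Plus [b, interp B Neg [c]]) = ev b - ev c"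
    "ev (interp B Times [b, c]) = ev b * ev c" if "b \<in> univ B" "c \<in> univ B" for b c
    using that Y(1) Bc hc by (auto simp: ev_def \<iota>_def fun_eq_iff e(3,4,5) hplus htimes hneg minus_apply subset_iff)
  have ev0: "ev (interp B Zero []) = 0" using Y(1) by (auto simp: ev_def \<iota>_def fun_eq_iff e(2) h0 subset_iff)
  have C: "subrng C" unfolding subrng_def
  proof (intro conjI ballI)
    show "0 \<in> C" unfolding C_def using ev0 Bc(1) by (metis imageI)
    fix x y assume "x \<in> C" "y \<in> C"
    then obtain b c where bc: "b \<in> univ B" "c \<in> univ B" "x = ev b" "y = ev c" by (auto simp: C_def)
    show "x + y \<in> C" "x - y \<in> C" "x * y \<in> C"
      unfolding C_def bc(3,4) evop[OF bc(1,2), symmetric] using Bc bc(1,2) by (auto intro!: imageI)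
  qed
  have localop: "local (\<lambda>h. G h \<oplus> G' h)" "local (\<lambda>h. G h \<oplus> \<ominus> G' h)" "local (\<lambda>h. G h \<otimes> G' h)"
    if G: "local G" "local G'" for G G'
  proof -
    have key: "\<exists>b c. b \<in> univ B \<and> c \<in> univ B \<and> (\<forall>h\<in>Z. G h = h b \<and> G' h = h c)"
      if Z: "Z \<subseteq> X \<and> finite Z \<and> card Z \<le> k" for Z
      using ll[OF G(1), of Z] ll[OF G(2), of Z] Z by metis
    show "local (\<lambda>h. G h \<oplus> G' h)" unfolding local_def
    proof (intro conjI allI impI ballI)
      show "G h \<oplus> G' h \<in> carrier R" if "h \<in> X" for h using lc G that by simp
      fix Z assume Z: "Z \<subseteq> X \<and> finite Z \<and> card Z \<le> k"
      then obtain b c where "b \<in> univ B" "c \<in> univ B" "\<forall>h\<in>Z. G h = h b \<and> G' h = h c" using key by metis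
      then show "\<exists>b\<in>univ B. \<forall>h\<in>Z. G h \<oplus> G' h = h b"
        using Z Bc by (intro bexI[of _ "interp B Plus [b, c]"]) (auto simp: hplus subset_iff)
    qed
    show "local (\<lambda>h. G h \<oplus> \<ominus> G' h)" unfolding local_def
    proof (intro conjI allI impI ballI)
      show "G h \<oplus> \<ominus> G' h \<in> carrier R" if "h \<in> X" for h using lc G that by simp
      fix Z assume Z: "Z \<subseteq> X \<and> finite Z \<and> card Z \<le> k"
      then obtain b c where "b \<in> univ B" "c \<in> univ B" "\<forall>h\<in>Z. G h = h b \<and> G' h = h c" using key by metis
      then show "\<exists>b\<in>univ B. \<forall>h\<in>Z. G h \<oplus> \<ominus> G' h = h b"
        using Z Bc by (intro bexI[of _ "interp B Plus [b, interp B Neg [c]]"]) (auto simp: hplus hneg subset_iff)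
    qed
    show "local (\<lambda>h. G h \<otimes> G' h)" unfolding local_def
    proof (intro conjI allI impI ballI)
      show "G h \<otimes> G' h \<in> carrier R" if "h \<in> X" for h using lc G that rng_m_closed by simp
      fix Z assume Z: "Z \<subseteq> X \<and> finite Z \<and> card Z \<le> k"
      then obtain b c where "b \<in> univ B" "c \<in> univ B" "\<forall>h\<in>Z. G h = h b \<and> G' h = h c" using key by metis
      then show "\<exists>b\<in>univ B. \<forall>h\<in>Z. G h \<otimes> G' h = h b"
        using Z Bc by (intro bexI[of _ "interp B Times [b, c]"]) (auto simp: htimes subset_iff)
    qed
  qed
  have FF: "subrng FF" unfolding subrng_def
  proof (intro conjI ballI)
    show "0 \<in> FF" unfolding FF_def ev0[symmetric] ev_def using lev[OF Bc(1)] by blast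
    fix x y assume "x \<in> FF" "y \<in> FF"
    then obtain G G' where g: "local G" "local G'" "x = \<iota> G" "y = \<iota> G'" by (auto simp: FF_def)
    show "x + y \<in> FF" "x - y \<in> FF" "x * y \<in> FF"
      unfolding FF_def g(3,4) \<iota>add[OF g(1,2), symmetric] using localop[OF g(1,2)] by (auto intro!: imageI)
  qed
  have CF: "C \<subseteq> FF" using lev by (auto simp: C_def FF_def ev_def)
  have inF: "\<iota> G \<in> FF" if "local G" for G using that by (simp add: FF_def)
  interpret cp: critical_pair A Y C FF
  proof (unfold_locales; (fact A finY C FF CF big(2))?)
    show "self_annihilating_products_vanish A" using sap by (simp add: A_def)
    show "f x \<in> A" if "f \<in> FF" for f x
      using that lc Y(1) subrngD(1)[OF A(2)] by (auto simp: FF_def \<iota>_def A_def subset_iff)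
    show "f x = 0" if "f \<in> FF" "x \<notin> Y" for f x using that by (auto simp: FF_def \<iota>_def)
    show "\<exists>c\<in>C. \<forall>x. x \<noteq> y \<longrightarrow> f x = c x" if y: "y \<in> Y" and f: "f \<in> FF" for y f
    proof -
      obtain G where G: "local G" "f = \<iota> G" using f by (auto simp: FF_def)
      have "card (Y - {y}) < card Y" using finY y by (rule card_Diff1_less)
      then obtain b where b: "b \<in> univ B" "\<forall>h\<in>Y - {y}. G h = h b" using small[OF G(1), of "Y - {y}"] Y(1) by auto
      have "\<forall>x. x \<noteq> y \<longrightarrow> f x = ev b x" using b(2) by (auto simp: G(2) ev_def \<iota>_def)
      then show ?thesis using b(1) by (auto simp: C_def)
    qed
  qed
  have ne: "FF \<noteq> C"
  proof
    assume "FF = C"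
    then obtain b where b: "b \<in> univ B" "\<iota> G1 = ev b" using inF[OF Y(3)] by (auto simp: C_def)
    have "G1 h = h b" if "h \<in> Y" for h
    proof -
      have "\<epsilon> (G1 h) = \<epsilon> (h b)" using fun_cong[OF b(2), of h] that by (simp add: ev_def \<iota>_def)
      then show ?thesis using inj_onD[OF e(1)] lc[OF Y(3)] hc b(1) Y(1) that by blast
    qed
    then show False using Y(4) b(1) by blast
  qed
  obtain w y z \<Psi> f0 where wyz: "w \<in> Y" "y \<in> Y" "z \<in> Y" "w \<noteq> y" "w \<noteq> z" "y \<noteq> z"
    and \<Psi>A: "\<And>f. f \<in> FF \<Longrightarrow> \<Psi> (f w) (f y) (f z) \<in> A"
    and \<Psi>add: "\<And>f g. f \<in> FF \<Longrightarrow> g \<in> FF \<Longrightarrow>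
      \<Psi> ((f + g) w) ((f + g) y) ((f + g) z) = \<Psi> (f w) (f y) (f z) + \<Psi> (g w) (g y) (g z)"
    and \<Psi>mult: "\<And>f g. f \<in> FF \<Longrightarrow> g \<in> FF \<Longrightarrow>
      \<Psi> ((f * g) w) ((f * g) y) ((f * g) z) = \<Psi> (f w) (f y) (f z) * \<Psi> (g w) (g y) (g z)"
    and \<Psi>one: "\<And>u. u \<in> FF \<Longrightarrow> \<forall>f\<in>FF. u * f = f \<and> f * u = f \<Longrightarrow> \<Psi> (u w) (u y) (u z) = u w"
    and f0: "f0 \<in> FF" "\<And>x. x \<noteq> y \<Longrightarrow> x \<noteq> z \<Longrightarrow> f0 x = 0" "\<Psi> (f0 w) (f0 y) (f0 z) \<noteq> 0"
    and \<Psi>C: "\<And>c. c \<in> C \<Longrightarrow> \<forall>x. x \<noteq> y \<longrightarrow> x \<noteq> z \<longrightarrow> c x = 0 \<Longrightarrow> \<Psi> (c w) (c y) (c z) = 0"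
    by (rule cp.merge_three[OF big(1) ne]) (rule that)
  define H where "H f = \<Psi> (f w) (f y) (f z)" for f
  have HA: "H f \<in> A" if "f \<in> FF" for f using \<Psi>A[OF that] by (simp add: H_def)
  have Hadd: "H (f + g) = H f + H g" and Hmult: "H (f * g) = H f * H g" if "f \<in> FF" "g \<in> FF" for f g
    using \<Psi>add[OF that] \<Psi>mult[OF that] by (simp_all add: H_def)
  have evF: "ev b \<in> FF" if "b \<in> univ B" for b using CF that by (auto simp: C_def)
  define \<delta> where "\<delta> = inv_into (carrier R) \<epsilon>"
  have \<delta>: "\<delta> (\<epsilon> x) = x" if "x \<in> carrier R" for x using inv_into_f_f[OF e(1) that] by (simp add: \<delta>_def)
  have \<delta>A: "\<delta> a \<in> carrier R" "\<epsilon> (\<delta> a) = a" if "a \<in> A" for a using that \<delta> by (auto simp: A_def)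
  have \<delta>I: "\<delta> a = x" if "x \<in> carrier R" "a = \<epsilon> x" for a x using \<delta> that by simp
  define h1 where "h1 = (\<lambda>b\<in>univ B. \<delta> (H (ev b)))"
  have h1e: "\<epsilon> (h1 b) = H (ev b)" "h1 b \<in> carrier R" if "b \<in> univ B" for b
    using \<delta>A[OF HA[OF evF[OF that]]] that by (simp_all add: h1_def)
  have h1I: "h1 b = x" if "b \<in> univ B" "x \<in> carrier R" "H (ev b) = \<epsilon> x" for b x
    using that \<delta>I by (simp add: h1_def)
  have H0: "H 0 = 0" using Hadd[of 0 0] subrngD(1)[OF FF] by simp
  have Hneg: "H (ev b - ev c) = H (ev b) - H (ev c)" if "b \<in> univ B" "c \<in> univ B" for b c
    using Hadd[of "ev b - ev c" "ev c"] subrngD(3)[OF FF evF evF] evF that by (simp add: eq_diff_eq)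
  have h1X: "h1 \<in> X" unfolding hX
  proof (intro conjI ballI impI)
    show "h1 \<in> univ B \<rightarrow>\<^sub>E carrier R" using h1e by (auto simp: h1_def)
    show "h1 (interp B Zero []) = \<zero>" by (rule h1I) (simp_all add: Bc ev0 H0 e(2))
    fix b assume b: "b \<in> univ B"
    have "ev (interp B Neg [b]) = 0 - ev b"
      using b Y(1) Bc hc by (auto simp: ev_def \<iota>_def fun_eq_iff e(3) hneg minus_apply subset_iff)
    then show "h1 (interp B Neg [b]) = \<ominus> h1 b"
      using Hneg[OF Bc(1) b] ev0 H0 b by (intro h1I) (simp_all add: Bc h1e e(3))
    fix c assume c: "c \<in> univ B"
    show "h1 (interp B Plus [b, c]) = h1 b \<oplus> h1 c"
      using b c by (intro h1I) (simp_all add: Bc evop Hadd evF h1e e(4))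
    show "h1 (interp B Times [b, c]) = h1 b \<otimes> h1 c"
      using b c by (intro h1I) (simp_all add: Bc evop Hmult evF h1e e(5) rng_m_closed)
  next
    assume one: "L One = Some 0"
    then have "ring R" using ring_language_symbols(5)[OF L] by blast
    then interpret r: ring R .
    let ?u = "ev (interp B One [])"
    have "?u * f = f \<and> f * ?u = f" if "f \<in> FF" for f
    proof -
      obtain G where G: "local G" "f = \<iota> G" using \<open>f \<in> FF\<close> by (auto simp: FF_def)
      have "\<epsilon> \<one> * \<epsilon> (G h) = \<epsilon> (G h) \<and> \<epsilon> (G h) * \<epsilon> \<one> = \<epsilon> (G h)" if "h \<in> Y" for h
        using lc[OF G(1)] Y(1) that by (auto simp: e(5)[symmetric] subset_iff)
      then show ?thesis using Y(1) by (auto simp: G(2) ev_def \<iota>_def fun_eq_iff hone[OF _ one] subset_iff)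
    qed
    then have "H ?u = ?u w" unfolding H_def using \<Psi>one evF[OF Bc(5)[OF one]] by blast
    also have "\<dots> = \<epsilon> \<one>" using wyz(1) Y(1) hone[OF _ one] by (auto simp: ev_def \<iota>_def)
    finally show "h1 (interp B One []) = \<one>" by (intro h1I) (simp_all add: Bc(5)[OF one])
  qed
  obtain G0 where G0: "local G0" "f0 = \<iota> G0" using f0(1) by (auto simp: FF_def)
  define Y' where "Y' = insert h1 (Y - {y, z})"
  have "card Y' < card Y"
  proof -
    have "card Y' \<le> Suc (card (Y - {y, z}))" unfolding Y'_def using finY by (simp add: card_insert_if)
    moreover have "card (Y - {y, z}) = card Y - 2" using wyz(2,3,6) by (subst card_Diff_subset) auto
    ultimately show ?thesis using big(2) by simp
  qed
  then obtain b where b: "b \<in> univ B" "\<forall>h\<in>Y'. G0 h = h b"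
    using small[OF G0(1), of Y'] h1X Y(1) by (auto simp: Y'_def)
  have "ev b x = 0" if "x \<noteq> y" "x \<noteq> z" for x
  proof (cases "x \<in> Y")
    case True
    then have "ev b x = f0 x" using b(2) that by (simp add: ev_def G0(2) \<iota>_def Y'_def)
    then show ?thesis using f0(2) that by simp
  qed (simp add: ev_def \<iota>_def)
  then have "H (ev b) = 0" unfolding H_def using \<Psi>C[of "ev b"] b(1) by (auto simp: C_def)
  then have z1: "\<epsilon> (G0 h1) = 0" using b h1e(1)[OF b(1)] by (simp add: Y'_def)
  have "card {h1, w, y, z} \<le> 4" by (simp add: card_insert_if)
  then have "\<exists>c\<in>univ B. \<forall>h\<in>{h1, w, y, z}. G0 h = h c"
    using h1X wyz Y(1) by (intro ll[OF G0(1)]) (auto simp: k_def)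
  then obtain c where c: "c \<in> univ B" "G0 h1 = h1 c" "G0 w = w c" "G0 y = y c" "G0 z = z c" by auto
  have "ev c w = f0 w" "ev c y = f0 y" "ev c z = f0 z" using c by (simp_all add: ev_def \<iota>_def G0(2))
  then have "H (ev c) = H f0" by (simp add: H_def)
  then show False using z1 c(2) h1e(1)[OF c(1)] f0(3) by (simp add: H_def)
qed


section \<open>Dualizability\<close>

theorem corollary6p12:
  fixes R :: "('a, 'm) ring_scheme" and L :: "ring_symbol signature"
  assumes "rng R \<and> L = rng_signature \<or> ring R \<and> L = unital_ring_signature"
    and "finite (carrier R)"
    and "generates_residually_small TYPE('k) L (ring_algebra R)"
  shows "dualizable TYPE('b) L (ring_algebra R)"
proof -
  have L: "ring_language R L" using assms(1) by (simp add: ring_language_def)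
  obtain \<epsilon> :: "'a \<Rightarrow> ('a, 'm) uring" where \<epsilon>: "ring_embedding R \<epsilon>" by (rule rng_embeds[OF ring_language_rng[OF L]])
  have sap: "self_annihilating_products_vanish (\<epsilon> ` carrier R)"
    by (rule residually_small_products_vanish[OF L \<epsilon> assms(3)])
  show ?thesis
  proof (rule dualizable_if_finitely_local[where k = "merge_bound (card (carrier R)) + 4"])
    show "finite (univ (ring_algebra R))" using assms(2) by simp
    show "ualgebra L (ring_algebra R)" by (rule ring_algebra_ualgebra[OF L])
    show "1 \<le> merge_bound (card (carrier R)) + 4" by simp
    fix B :: "(ring_symbol, 'b) ualg" and F
    assume B: "ualgebra L B" "finite (univ B)"
      and F: "\<forall>h\<in>Hom L B (ring_algebra R). F h \<in> univ (ring_algebra R)"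
      and loc: "\<forall>Z. Z \<subseteq> Hom L B (ring_algebra R) \<and> finite Z \<and> card Z \<le> merge_bound (card (carrier R)) + 4 \<longrightarrow>
        (\<exists>b\<in>univ B. \<forall>h\<in>Z. F h = h b)"
    show "\<exists>b\<in>univ B. \<forall>h\<in>Hom L B (ring_algebra R). F h = h b"
      by (rule finite_local_evaluation[OF L assms(2) \<epsilon> sap B F[unfolded ring_algebra_simps(1)] loc])
  qed
qed

end
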